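(* Let $x\in H$, and let $\|d_q^\ast(x)\|_q$ be the operator norm of the creation operator $d_q^\ast(x)$ on the $q$-Fock space of type D (with norm $\|\cdot\|_q$ induced by $\langle\cdot,\cdot\rangle_q$). (1) For $-1<q<1$: $\displaystyle \frac{\|x\|}{\sqrt{1-q}}\le\|d_q^\ast(x)\|_q$. (2) For $0\le q<1$: $\displaystyle \|d_q^\ast(x)\|_q\le\sqrt{\frac{2}{1-q}}\,\|x\|$. (3) For $-1<q<0$: $\displaystyle \|d_q^\ast(x)\|_q\le\sqrt{1+|q|+q^2}\,\|x\|$.
   Context: $H$ is a complex Hilbert space with inner product $\langle\cdot,\cdot\rangle$ linear in the right argument and antilinear in the left one; $x\mapsto\overline{x}$ is a fixed selfadjoint involution on $H$, i.e. a bounded selfadjoint linear operator whose square is the identity. Let $B(n)$ be the group of permutations $\sigma$ of $\{\pm1,\dots,\pm n\}$ with $\sigma(-k)=-\sigma(k)$; put $\pi_i=(i,i+1)(-i,-i-1)$ for $1\le i\le n-1$, $\overline{\pi}_n=(n,-n)$ and $\widehat{\pi}_{n-1}=\overline{\pi}_n\pi_{n-1}\overline{\pi}_n$. The Coxeter group $D(n)$ of type D is $D(1)=\{e\}$ and, for $n\ge2$, the subgroup of $B(n)$ generated by $\pi_1,\dots,\pi_{n-1},\widehat{\pi}_{n-1}$; $\ell(\sigma)$ is the minimal number of these generators in a product expression of $\sigma\in D(n)$. For $n\ge 2$, $D(n)$ acts on $H^{\otimes n}$ by $\pi_i(x_1\otimes\cdots\otimes x_n)=x_1\otimes\cdots\otimes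 x_{i-1}\otimes x_{i+1}\otimes x_i\otimes x_{i+2}\otimes\cdots\otimes x_n$ and $\widehat{\pi}_{n-1}(x_1\otimes\cdots\otimes x_n)=x_1\otimes\cdots\otimes x_{n-2}\otimes\overline{x}_n\otimes\overline{x}_{n-1}$; $D(1)$ acts trivially on $H$. Put $\widehat{P}_q^{(n)}=\sum_{\sigma\in D(n)}q^{\ell(\sigma)}\sigma$ for $n\ge1$ and $\widehat P_q^{(0)}=I$ (convention $0^0=1$). Let $\mathcal{F}_{\rm fin}(H)=\bigoplus_{n\ge0}H^{\otimes n}$ be the algebraic direct sum, $H^{\otimes0}=\mathbb{C}\Omega$ with $\Omega$ a unit vector, with the usual inner product $\langle x_1\otimes\cdots\otimes x_m,y_1\otimes\cdots\otimes y_n\rangle_0=\delta_{m,n}\prod_i\langle x_i,y_i\rangle$, and $\widehat P_q=\bigoplus_n\widehat P_q^{(n)}$. For $q\in(-1,1)$, $\widehat P_q$ is known to be strictly positive, so $\langle f,g\rangle_q:=\langle f,\widehat P_q g\rangle_0$ is an inner product; $\mathcal{F}_{\rm fin}(H)$ with this inner product is the $q$-Fock space of type D. The creation operator is $d_q^\ast(x)(x_1\otimes\cdots\otimes x_n)=x\otimes x_1\otimes\cdots\otimes x_n$, $d_q^\ast(x)\Omega=x$. *)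

theory Defs
  imports
    Complex_Main
    "HOL-Library.Extended_Real"
    "HOL-Library.Poly_Mapping"
    "HOL-Combinatorics.Permutations"
    "HOL-Algebra.Generated_Groups"
begin

section \<open>Complex Hilbert spaces\<close>

class complex_vector = ab_group_add +
  fixes scaleC :: "complex \<Rightarrow> 'a \<Rightarrow> 'a" (infixr "*\<^sub>C" 75)
  assumes scaleC_add_right: "a *\<^sub>C (x + y) = a *\<^sub>C x + a *\<^sub>C y"
    and scaleC_add_left: "(a + b) *\<^sub>C x = a *\<^sub>C x + b *\<^sub>C x"
    and scaleC_scaleC: "a *\<^sub>C (b *\<^sub>C x) = (a * b) *\<^sub>C x"
    and scaleC_one: "1 *\<^sub>C x = x"

text \<open>Completeness, and the agreement of metric and norm, are inherited from class banach.\<close>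

class complex_hilbert_space = complex_vector + banach +
  fixes cinner :: "'a \<Rightarrow> 'a \<Rightarrow> complex"
  assumes scaleR_scaleC: "r *\<^sub>R x = complex_of_real r *\<^sub>C x"
    and cinner_commute: "cinner x y = cnj (cinner y x)"
    and cinner_add_right: "cinner x (y + z) = cinner x y + cinner x z"
    and cinner_scaleC_right: "cinner x (a *\<^sub>C y) = a * cinner x y"
    and cinner_ge_zero: "0 \<le> Re (cinner x x)"
    and cinner_eq_zero_iff: "cinner x x = 0 \<longleftrightarrow> x = 0"
    and norm_eq_sqrt_cinner: "norm x = sqrt (Re (cinner x x))"

instantiation complex :: complex_hilbert_space
begin

definition scaleC_complex_def: "a *\<^sub>C (z::complex) = a * z"
definition cinner_complex_def: "cinner (w::complex) z = cnj w * z"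

instance
proof
  fix x :: complex
  show "(cinner x x = 0) = (x = 0)"
    by (simp add: cinner_complex_def)
  show "0 \<le> Re (cinner x x)"
    by (simp add: cinner_complex_def)
  show "norm x = sqrt (Re (cinner x x))"
    by (simp add: cinner_complex_def cmod_def power2_eq_square)
qed (simp_all add: scaleC_complex_def cinner_complex_def algebra_simps scaleR_conv_of_real)

end

lemma scaleC_zero_left [simp]: "0 *\<^sub>C (x::'a::complex_vector) = 0"
  using scaleC_add_left[of 0 0 x] by simp

lemma scaleC_zero_right [simp]: "a *\<^sub>C (0::'a::complex_vector) = 0"
  using scaleC_add_right[of a 0 "0::'a"] by simp

lemma scaleC_minus_left: "(- a) *\<^sub>C (x::'a::complex_vector) = - (a *\<^sub>C x)"
proof -
  have "(- a) *\<^sub>C x + a *\<^sub>C x = 0"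
    by (metis add.left_inverse scaleC_add_left scaleC_zero_left)
  then show ?thesis by (rule eq_neg_iff_add_eq_0[THEN iffD2])
qed

lemma scaleC_sum_right: "a *\<^sub>C (\<Sum>i\<in>I. f i) = (\<Sum>i\<in>I. a *\<^sub>C (f i :: 'a::complex_vector))"
  by (induction I rule: infinite_finite_induct) (simp_all add: scaleC_add_right)

definition clinear :: "('a::complex_vector \<Rightarrow> 'b::complex_vector) \<Rightarrow> bool" where
  "clinear T \<longleftrightarrow> (\<forall>x y. T (x + y) = T x + T y) \<and> (\<forall>a x. T (a *\<^sub>C x) = a *\<^sub>C T x)"

definition selfadjoint_involution :: "('h::complex_hilbert_space \<Rightarrow> 'h) \<Rightarrow> bool" where
  "selfadjoint_involution J \<longleftrightarrow>
     clinear J \<and> (\<exists>K. \<forall>x. norm (J x) \<le> K * norm x) \<and>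
     (\<forall>x y. cinner (J x) y = cinner x (J y)) \<and> (\<forall>x. J (J x) = x)"


section \<open>The algebraic full Fock space\<close>

text \<open>
  The algebraic direct sum of all algebraic tensor powers of a complex vector space is built at
  one stroke: formal complex combinations of words (finite lists of vectors), modulo
  the relations expressing linearity in each letter.  The relations only involve words of one and
  the same length, so the quotient is graded by word length, and its degree-n part is the n-th
  tensor power; the empty word represents the vacuum.
\<close>

definition formal_scale :: "complex \<Rightarrow> ('a \<Rightarrow>\<^sub>0 complex) \<Rightarrow> ('a \<Rightarrow>\<^sub>0 complex)" where
  "formal_scale c p = Poly_Mapping.map ((*) c) p"

lemma lookup_formal_scale [simp]:
  "Poly_Mapping.lookup (formal_scale c p) k = c * Poly_Mapping.lookup p k"
  by (simp add: formal_scale_def Poly_Mapping.map.rep_eq when_def)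

interpretation formal: vector_space formal_scale
  by unfold_locales (rule poly_mapping_eqI; simp add: lookup_add algebra_simps)+

abbreviation formal_word :: "'a \<Rightarrow> ('a \<Rightarrow>\<^sub>0 complex)" where
  "formal_word w \<equiv> Poly_Mapping.single w 1"

definition tensor_relations :: "('h::complex_vector list \<Rightarrow>\<^sub>0 complex) set" where
  "tensor_relations =
     {formal_word (w[i := a *\<^sub>C x + y])
        - formal_scale a (formal_word (w[i := x])) - formal_word (w[i := y]) | w i a x y.
      i < length w}"

definition tensor_equiv ::
    "('h::complex_vector list \<Rightarrow>\<^sub>0 complex) \<Rightarrow> ('h list \<Rightarrow>\<^sub>0 complex) \<Rightarrow> bool" where
  "tensor_equiv p q \<longleftrightarrow> p - q \<in> formal.span tensor_relations"

quotient_type (overloaded) 'h fock = "'h::complex_vector list \<Rightarrow>\<^sub>0 complex" / tensor_equiv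
proof (rule equivpI)
  show "reflp (tensor_equiv :: ('h list \<Rightarrow>\<^sub>0 complex) \<Rightarrow> _)"
    by (auto simp: reflp_def tensor_equiv_def formal.span_zero)
  show "symp (tensor_equiv :: ('h list \<Rightarrow>\<^sub>0 complex) \<Rightarrow> _)"
    unfolding symp_def tensor_equiv_def using formal.span_neg by fastforce
  show "transp (tensor_equiv :: ('h list \<Rightarrow>\<^sub>0 complex) \<Rightarrow> _)"
    unfolding transp_def tensor_equiv_def
    using formal.span_add by fastforce
qed

instantiation fock :: (complex_vector) complex_vector
begin

lift_definition zero_fock :: "'a fock" is 0 .

lift_definition plus_fock :: "'a fock \<Rightarrow> 'a fock \<Rightarrow> 'a fock" is "(+)"
  unfolding tensor_equiv_def by (metis add_diff_add formal.span_add)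

lift_definition uminus_fock :: "'a fock \<Rightarrow> 'a fock" is uminus
  unfolding tensor_equiv_def by (metis formal.span_neg minus_diff_minus)

lift_definition minus_fock :: "'a fock \<Rightarrow> 'a fock \<Rightarrow> 'a fock" is "(-)"
  unfolding tensor_equiv_def
proof -
  fix p p' q q' :: "'a list \<Rightarrow>\<^sub>0 complex"
  assume "p - p' \<in> formal.span tensor_relations" "q - q' \<in> formal.span tensor_relations"
  then have "(p - p') - (q - q') \<in> formal.span tensor_relations"
    by (rule formal.span_diff)
  then show "p - q - (p' - q') \<in> formal.span tensor_relations"
    by (simp add: algebra_simps)
qed

lift_definition scaleC_fock :: "complex \<Rightarrow> 'a fock \<Rightarrow> 'a fock" is formal_scale
  unfolding tensor_equiv_def by (metis formal.scale_right_diff_distrib formal.span_scale)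

instance
  by standard
    (transfer; simp add: tensor_equiv_def formal.span_zero algebra_simps)+

end

lift_definition tensor :: "'h::complex_vector list \<Rightarrow> 'h fock" is formal_word .

lemma tensor_update:
  assumes "i < length w"
  shows "tensor (w[i := a *\<^sub>C x + y]) = a *\<^sub>C tensor (w[i := x]) + tensor (w[i := y])"
  using assms
proof transfer
  fix i a x y and w :: "'a list"
  assume "i < length w"
  then have "formal_word (w[i := a *\<^sub>C x + y])
      - formal_scale a (formal_word (w[i := x])) - formal_word (w[i := y]) \<in> tensor_relations"
    unfolding tensor_relations_def by blast
  then show "tensor_equiv (formal_word (w[i := a *\<^sub>C x + y]))
      (formal_scale a (formal_word (w[i := x])) + formal_word (w[i := y]))"
    unfolding tensor_equiv_def diff_diff_eq[symmetric] by (rule formal.span_base)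
qed

definition multilinear_on_words :: "('h::complex_vector list \<Rightarrow> 'b::complex_vector) \<Rightarrow> bool" where
  "multilinear_on_words f \<longleftrightarrow>
     (\<forall>w i a x y. i < length w \<longrightarrow>
        f (w[i := a *\<^sub>C x + y]) = a *\<^sub>C f (w[i := x]) + f (w[i := y]))"

text \<open>
  The linear map on the Fock space that is determined by its values on simple tensors.  The
  definition picks a representative; for multilinear f the result does not depend on it.
\<close>

definition formal_ext :: "('a \<Rightarrow> 'b::complex_vector) \<Rightarrow> ('a \<Rightarrow>\<^sub>0 complex) \<Rightarrow> 'b" where
  "formal_ext f p = (\<Sum>w\<in>Poly_Mapping.keys p. Poly_Mapping.lookup p w *\<^sub>C f w)"

definition linear_ext ::
    "('h::complex_vector list \<Rightarrow> 'b::complex_vector) \<Rightarrow> 'h fock \<Rightarrow> 'b" where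
  "linear_ext f t = formal_ext f (rep_fock t)"

lemma formal_ext_superset:
  assumes "finite A" "Poly_Mapping.keys p \<subseteq> A"
  shows "formal_ext f p = (\<Sum>w\<in>A. Poly_Mapping.lookup p w *\<^sub>C f w)"
  unfolding formal_ext_def
  by (rule sum.mono_neutral_left) (use assms in \<open>auto simp: in_keys_iff\<close>)

lemma formal_ext_add: "formal_ext f (p + q) = formal_ext f p + formal_ext f q"
proof -
  let ?A = "Poly_Mapping.keys p \<union> Poly_Mapping.keys q"
  have "formal_ext f (p + q) = (\<Sum>w\<in>?A. Poly_Mapping.lookup (p + q) w *\<^sub>C f w)"
    by (rule formal_ext_superset) (auto simp: Poly_Mapping.keys_add)
  also have "\<dots> =
      (\<Sum>w\<in>?A. Poly_Mapping.lookup p w *\<^sub>C f w) + (\<Sum>w\<in>?A. Poly_Mapping.lookup q w *\<^sub>C f w)"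
    by (simp add: lookup_add scaleC_add_left sum.distrib)
  also have "\<dots> = formal_ext f p + formal_ext f q"
    using formal_ext_superset[of ?A p f] formal_ext_superset[of ?A q f] by simp
  finally show ?thesis .
qed

lemma formal_ext_scale: "formal_ext f (formal_scale c p) = c *\<^sub>C formal_ext f p"
proof -
  have "Poly_Mapping.keys (formal_scale c p) \<subseteq> Poly_Mapping.keys p"
    by (auto simp: in_keys_iff)
  then have "formal_ext f (formal_scale c p) =
      (\<Sum>w\<in>Poly_Mapping.keys p. Poly_Mapping.lookup (formal_scale c p) w *\<^sub>C f w)"
    by (rule formal_ext_superset[rotated]) simp
  then show ?thesis
    by (simp add: formal_ext_def scaleC_sum_right scaleC_scaleC)
qed

lemma formal_ext_diff: "formal_ext f (p - q) = formal_ext f p - formal_ext f q"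
  using formal_ext_add[of f "p - q" q] by (simp add: algebra_simps)

lemma formal_ext_word [simp]: "formal_ext f (formal_word w) = f w"
  by (simp add: formal_ext_def scaleC_one)

lemma formal_ext_null:
  assumes "multilinear_on_words f" "p \<in> formal.span tensor_relations"
  shows "formal_ext f p = 0"
  using assms(2)
proof (induction rule: formal.span_induct_alt)
  case base
  show ?case by (simp add: formal_ext_def)
next
  case (step c g p)
  then have "formal_ext f g = 0"
    using assms(1)
    by (auto simp: tensor_relations_def multilinear_on_words_def formal_ext_diff formal_ext_scale)
  with step show ?case
    by (simp add: formal_ext_add formal_ext_scale)
qed

lemma linear_ext_abs:
  assumes "multilinear_on_words f"
  shows "linear_ext f (abs_fock p) = formal_ext f p"
proof -
  have "tensor_equiv (rep_fock (abs_fock p)) p"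
    by (rule rep_abs_rsp_left[OF Quotient3_fock]) (simp add: tensor_equiv_def formal.span_zero)
  then have "formal_ext f (rep_fock (abs_fock p) - p) = 0"
    by (intro formal_ext_null assms) (simp add: tensor_equiv_def)
  then show ?thesis
    by (simp add: linear_ext_def formal_ext_diff)
qed

lemma linear_ext_tensor:
  assumes "multilinear_on_words f"
  shows "linear_ext f (tensor w) = f w"
  by (simp add: tensor.abs_eq linear_ext_abs[OF assms])

lemma clinear_linear_ext:
  assumes "multilinear_on_words f"
  shows "clinear (linear_ext f)"
  unfolding clinear_def
proof (intro conjI allI)
  fix s t :: "'a fock" and a :: complex
  obtain p q where pq: "s = abs_fock p" "t = abs_fock q"
    by (metis Quotient3_fock Quotient3_abs_rep)
  show "linear_ext f (s + t) = linear_ext f s + linear_ext f t"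
    by (simp add: pq plus_fock.abs_eq linear_ext_abs[OF assms] formal_ext_add)
  show "linear_ext f (a *\<^sub>C s) = a *\<^sub>C linear_ext f s"
    by (simp add: pq scaleC_fock.abs_eq linear_ext_abs[OF assms] formal_ext_scale)
qed

definition word_inner :: "'h::complex_hilbert_space list \<Rightarrow> 'h list \<Rightarrow> complex" where
  "word_inner u v =
     (if length u = length v then (\<Prod>i<length u. cinner (u ! i) (v ! i)) else 0)"

text \<open>The conjugations make the form antilinear in its left argument.\<close>

definition fock_inner0 :: "'h::complex_hilbert_space fock \<Rightarrow> 'h fock \<Rightarrow> complex" where
  "fock_inner0 f g = cnj (linear_ext (\<lambda>u. cnj (linear_ext (word_inner u) g)) f)"

lemma cinner_add_left: "cinner (x + y) z = cinner x z + cinner y z"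
  by (metis cinner_add_right cinner_commute complex_cnj_add)

lemma cinner_scaleC_left: "cinner (a *\<^sub>C x) z = cnj a * cinner x z"
  by (metis cinner_scaleC_right cinner_commute complex_cnj_mult)

lemma word_inner_commute: "word_inner u v = cnj (word_inner v u)"
proof -
  have "(\<Prod>i<n. cinner (u ! i) (v ! i)) = cnj (\<Prod>i<n. cinner (v ! i) (u ! i))" for n
    unfolding cnj_prod by (rule prod.cong[OF refl]) (rule cinner_commute)
  then show ?thesis by (simp add: word_inner_def)
qed

lemma multilinear_word_inner: "multilinear_on_words (word_inner u)"
  unfolding multilinear_on_words_def
proof (intro allI impI)
  fix w :: "'a list" and i a x y
  assume i: "i < length w"
  show "word_inner u (w[i := a *\<^sub>C x + y]) =
      a *\<^sub>C word_inner u (w[i := x]) + word_inner u (w[i := y])"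
  proof (cases "length u = length w")
    case True
    have "word_inner u (w[i := z]) =
        cinner (u ! i) z * (\<Prod>j\<in>{..<length w} - {i}. cinner (u ! j) (w ! j))" for z
      using True i by (simp add: word_inner_def prod.remove[of _ i])
    then show ?thesis
      by (simp add: cinner_add_right cinner_scaleC_right scaleC_complex_def algebra_simps)
  qed (simp add: word_inner_def)
qed

lemma fock_inner0_tensor: "fock_inner0 (tensor u) (tensor v) = word_inner u v"
proof -
  have "(\<lambda>u. cnj (word_inner u v)) = word_inner v"
    by (rule ext) (metis word_inner_commute)
  then show ?thesis
    by (simp add: fock_inner0_def linear_ext_tensor multilinear_word_inner
        word_inner_commute[of u v])
qed

definition creation :: "'h::complex_hilbert_space \<Rightarrow> 'h fock \<Rightarrow> 'h fock" where
  "creation x = linear_ext (\<lambda>w. tensor (x # w))"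

lemma multilinear_creation: "multilinear_on_words (\<lambda>w. tensor (x # w))"
  unfolding multilinear_on_words_def
proof (intro allI impI)
  fix w :: "'a list" and i a y z
  assume "i < length w"
  then show "tensor (x # w[i := a *\<^sub>C y + z]) =
      a *\<^sub>C tensor (x # w[i := y]) + tensor (x # w[i := z])"
    using tensor_update[of "Suc i" "x # w" a y z] by simp
qed

lemma creation_tensor: "creation x (tensor w) = tensor (x # w)"
  by (simp add: creation_def linear_ext_tensor multilinear_creation)


section \<open>The Coxeter groups of type D\<close>

definition signed_points :: "nat \<Rightarrow> int set" where
  "signed_points n = {- int n..int n} - {0}"

text \<open>As functions on the integers, signed permutations fix 0 and everything beyond n.\<close>

definition type_B_group :: "nat \<Rightarrow> (int \<Rightarrow> int) monoid" where
  "type_B_group n =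
     \<lparr>carrier = {\<sigma>. \<sigma> permutes signed_points n \<and> (\<forall>k. \<sigma> (- k) = - \<sigma> k)},
      monoid.mult = (\<circ>), one = id\<rparr>"

definition adjacent_swap :: "nat \<Rightarrow> int \<Rightarrow> int" where
  "adjacent_swap i =
     transpose (int i) (int i + 1) \<circ> transpose (- int i) (- int i - 1)"

definition sign_change :: "nat \<Rightarrow> int \<Rightarrow> int" where
  "sign_change n = transpose (int n) (- int n)"

definition signed_swap :: "nat \<Rightarrow> int \<Rightarrow> int" where
  "signed_swap n = sign_change n \<circ> adjacent_swap (n - 1) \<circ> sign_change n"

definition type_D_generators :: "nat \<Rightarrow> (int \<Rightarrow> int) set" where
  "type_D_generators n =
     (if n \<ge> 2 then adjacent_swap ` {1..n - 1} \<union> {signed_swap n} else {})"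

definition type_D :: "nat \<Rightarrow> (int \<Rightarrow> int) set" where
  "type_D n = generate (type_B_group n) (type_D_generators n)"

definition type_D_length :: "nat \<Rightarrow> (int \<Rightarrow> int) \<Rightarrow> nat" where
  "type_D_length n \<sigma> =
     (LEAST k. \<exists>gs. length gs = k \<and> set gs \<subseteq> type_D_generators n \<and> foldr (\<circ>) gs id = \<sigma>)"

text \<open>
  The action on simple tensors.  Extending a word by the convention that its letter at position
  -k is the conjugate of the letter at position k, a signed permutation s moves the letter at
  position k to position s(k).  The lemmas below show that this is an action of the type B group and
  that the generators of the type D group act as they should.  Positions start from 1, list indices
  from 0.
\<close>

definition signed_letter :: "('h \<Rightarrow> 'h) \<Rightarrow> 'h list \<Rightarrow> int \<Rightarrow> 'h" where
  "signed_letter J w k = (if k > 0 then w ! (nat k - 1) else J (w ! (nat (- k) - 1)))"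

definition act_word :: "('h \<Rightarrow> 'h) \<Rightarrow> (int \<Rightarrow> int) \<Rightarrow> 'h list \<Rightarrow> 'h list" where
  "act_word J \<sigma> w = map (\<lambda>i. signed_letter J w (inv_into UNIV \<sigma> (int i + 1))) [0..<length w]"

text \<open>The action on the n-th tensor power, extended by zero to the other degrees.\<close>

definition act ::
    "('h::complex_hilbert_space \<Rightarrow> 'h) \<Rightarrow> nat \<Rightarrow> (int \<Rightarrow> int) \<Rightarrow> 'h fock \<Rightarrow> 'h fock" where
  "act J n \<sigma> = linear_ext (\<lambda>w. if length w = n then tensor (act_word J \<sigma> w) else 0)"

lemma length_act_word [simp]: "length (act_word J \<sigma> w) = length w"
  by (simp add: act_word_def)

lemma nth_act_word:
  "j < length w \<Longrightarrow> act_word J \<sigma> w ! j = signed_letter J w (inv_into UNIV \<sigma> (int j + 1))"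
  by (simp add: act_word_def)

lemma type_B_inv:
  assumes "\<sigma> \<in> carrier (type_B_group n)"
  shows "bij \<sigma>" "\<sigma> (- k) = - \<sigma> k" "inv_into UNIV \<sigma> (- k) = - inv_into UNIV \<sigma> k"
    and "k \<in> signed_points n \<Longrightarrow> \<sigma> k \<in> signed_points n"
    and "k \<in> signed_points n \<Longrightarrow> inv_into UNIV \<sigma> k \<in> signed_points n"
proof -
  have p: "\<sigma> permutes signed_points n" and neg: "\<sigma> (- k) = - \<sigma> k" for k
    using assms by (auto simp: type_B_group_def)
  show "bij \<sigma>" by (rule permutes_bij[OF p])
  show "\<sigma> (- k) = - \<sigma> k" by (rule neg)
  show "inv_into UNIV \<sigma> (- k) = - inv_into UNIV \<sigma> k"
    by (metis neg p permutes_inverses)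
  show "k \<in> signed_points n \<Longrightarrow> \<sigma> k \<in> signed_points n"
    using permutes_in_image[OF p] by blast
  show "k \<in> signed_points n \<Longrightarrow> inv_into UNIV \<sigma> k \<in> signed_points n"
    using permutes_in_image[OF permutes_inv[OF p]] by blast
qed

lemma act_word_update:
  assumes \<sigma>: "\<sigma> \<in> carrier (type_B_group n)" and "length w = n" "i < n"
  defines "m \<equiv> \<sigma> (int i + 1)"
  shows "act_word J \<sigma> (w[i := z]) =
           (act_word J \<sigma> w)[nat \<bar>m\<bar> - 1 := if m > 0 then z else J z]"
    and "nat \<bar>m\<bar> - 1 < n"
proof -
  have "m \<in> signed_points n"
    unfolding m_def using assms by (intro type_B_inv[OF \<sigma>]) (auto simp: signed_points_def)
  then have m: "m \<noteq> 0" "\<bar>m\<bar> \<le> int n" by (auto simp: signed_points_def)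
  then show "nat \<bar>m\<bar> - 1 < n" by linarith
  show "act_word J \<sigma> (w[i := z]) =
      (act_word J \<sigma> w)[nat \<bar>m\<bar> - 1 := if m > 0 then z else J z]"
  proof (rule nth_equalityI)
    fix j assume "j < length (act_word J \<sigma> (w[i := z]))"
    then have j: "j < n" using assms by simp
    define k where "k = inv_into UNIV \<sigma> (int j + 1)"
    have "k \<in> signed_points n"
      unfolding k_def using j by (intro type_B_inv[OF \<sigma>]) (auto simp: signed_points_def)
    then have k: "k \<noteq> 0" "\<bar>k\<bar> \<le> int n" by (auto simp: signed_points_def)
    have \<sigma>k: "\<sigma> k = int j + 1"
      unfolding k_def using type_B_inv(1)[OF \<sigma>] by (simp add: bij_is_surj surj_f_inv_f)
    have inj: "\<sigma> a = \<sigma> b \<longleftrightarrow> a = b" for a b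
      using type_B_inv(1)[OF \<sigma>] by (simp add: bij_is_inj inj_eq)
    have pos: "k = int i + 1 \<longleftrightarrow> m = int j + 1"
      unfolding m_def \<sigma>k[symmetric] using inj by metis
    have neg: "k = - (int i + 1) \<longleftrightarrow> m = - (int j + 1)"
      unfolding m_def \<sigma>k[symmetric] using inj type_B_inv(2)[OF \<sigma>] by (metis minus_minus)
    have L: "act_word J \<sigma> (w[i := z]) ! j = signed_letter J (w[i := z]) k"
      using j assms by (simp add: nth_act_word k_def)
    have R: "act_word J \<sigma> w ! j = signed_letter J w k"
      using j assms by (simp add: nth_act_word k_def)
    consider "k = int i + 1" | "k = - (int i + 1)" | "\<bar>k\<bar> \<noteq> int i + 1" by linarith
    then show "act_word J \<sigma> (w[i := z]) ! j =
        (act_word J \<sigma> w)[nat \<bar>m\<bar> - 1 := if m > 0 then z else J z] ! j"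
    proof cases
      case 1
      with pos have mj: "m = int j + 1" by simp
      have "nat k - 1 = i" "k > 0" using 1 by auto
      moreover have "nat \<bar>m\<bar> - 1 = j" "m > 0" using mj by auto
      ultimately show ?thesis
        unfolding L using j assms(2,3) by (simp add: signed_letter_def)
    next
      case 2
      with neg have mj: "m = - (int j + 1)" by simp
      have "nat (- k) - 1 = i" "\<not> k > 0" using 2 by auto
      moreover have "nat \<bar>m\<bar> - 1 = j" "\<not> m > 0" using mj by auto
      ultimately show ?thesis
        unfolding L using j assms(2,3) by (simp add: signed_letter_def)
    next
      case 3
      have "\<bar>m\<bar> \<noteq> int j + 1"
        using 3 pos neg by linarith
      then have "nat \<bar>m\<bar> - 1 \<noteq> j" using m by linarith
      moreover have "k > 0 \<Longrightarrow> nat k - 1 \<noteq> i" "\<not> k > 0 \<Longrightarrow> nat (- k) - 1 \<noteq> i"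
        using 3 k by linarith+
      ultimately show ?thesis unfolding L by (auto simp: R signed_letter_def)
    qed
  qed (use assms in simp)
qed

lemma act_tensor:
  assumes J: "clinear J" and \<sigma>: "\<sigma> \<in> carrier (type_B_group n)"
  shows "act J n \<sigma> (tensor w) = (if length w = n then tensor (act_word J \<sigma> w) else 0)"
proof -
  have "multilinear_on_words (\<lambda>w. if length w = n then tensor (act_word J \<sigma> w) else 0)"
    unfolding multilinear_on_words_def
  proof (intro allI impI)
    fix w :: "'a list" and i a x y
    assume i: "i < length w"
    show "(if length (w[i := a *\<^sub>C x + y]) = n then tensor (act_word J \<sigma> (w[i := a *\<^sub>C x + y])) else 0) =
      a *\<^sub>C (if length (w[i := x]) = n then tensor (act_word J \<sigma> (w[i := x])) else 0) +
      (if length (w[i := y]) = n then tensor (act_word J \<sigma> (w[i := y])) else 0)"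
    proof (cases "length w = n")
      case True
      with i show ?thesis
        using act_word_update(2)[OF \<sigma> True, of i] J
        by (simp add: act_word_update(1)[OF \<sigma> True] tensor_update clinear_def)
    qed simp
  qed
  then show ?thesis
    unfolding act_def by (rule linear_ext_tensor)
qed

lemma act_word_comp:
  assumes J: "\<And>x. J (J x) = x"
    and \<sigma>: "\<sigma> \<in> carrier (type_B_group n)" and \<tau>: "\<tau> \<in> carrier (type_B_group n)"
    and "length w = n"
  shows "act_word J (\<sigma> \<circ> \<tau>) w = act_word J \<sigma> (act_word J \<tau> w)"
proof (rule nth_equalityI)
  fix j assume "j < length (act_word J (\<sigma> \<circ> \<tau>) w)"
  then have j: "j < n" using assms by simp
  define k where "k = inv_into UNIV \<sigma> (int j + 1)"
  have "k \<in> signed_points n"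
    unfolding k_def using j by (intro type_B_inv[OF \<sigma>]) (auto simp: signed_points_def)
  then have k: "k \<noteq> 0" "\<bar>k\<bar> \<le> int n" "inv_into UNIV \<tau> k \<in> signed_points n"
    using type_B_inv(5)[OF \<tau>, of k] by (auto simp: signed_points_def)
  have "inv_into UNIV (\<sigma> \<circ> \<tau>) (int j + 1) = inv_into UNIV \<tau> k"
    using type_B_inv(1)[OF \<sigma>] type_B_inv(1)[OF \<tau>] by (simp add: o_inv_distrib k_def)
  then have "act_word J (\<sigma> \<circ> \<tau>) w ! j = signed_letter J w (inv_into UNIV \<tau> k)"
    using j assms by (simp add: nth_act_word)
  also have "\<dots> = signed_letter J (act_word J \<tau> w) k"
  proof (cases "k > 0")
    case True
    then have "nat k - 1 < n" "int (nat k - 1) + 1 = k" using k by auto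
    with True show ?thesis
      using assms(4) by (simp add: signed_letter_def[of J "act_word J \<tau> w"] nth_act_word)
  next
    case False
    then have "nat (- k) - 1 < n" "int (nat (- k) - 1) + 1 = - k" using k by auto
    then have "signed_letter J (act_word J \<tau> w) k = J (signed_letter J w (inv_into UNIV \<tau> (- k)))"
      using False assms(4) by (simp add: signed_letter_def[of J "act_word J \<tau> w"] nth_act_word)
    also have "\<dots> = signed_letter J w (inv_into UNIV \<tau> k)"
      using k(3) by (auto simp: type_B_inv(3)[OF \<tau>] signed_letter_def signed_points_def J)
    finally show ?thesis by simp
  qed
  also have "\<dots> = act_word J \<sigma> (act_word J \<tau> w) ! j"
    using j assms by (simp add: nth_act_word k_def)
  finally show "act_word J (\<sigma> \<circ> \<tau>) w ! j = act_word J \<sigma> (act_word J \<tau> w) ! j" .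
qed simp

lemma adjacent_swap_in_type_B:
  assumes "1 \<le> i" "i < n"
  shows "adjacent_swap i \<in> carrier (type_B_group n)"
proof -
  have "adjacent_swap i permutes signed_points n"
    unfolding adjacent_swap_def using assms
    by (intro permutes_compose permutes_swap_id) (auto simp: signed_points_def)
  moreover have "adjacent_swap i (- k) = - adjacent_swap i k" for k
    using assms by (auto simp: adjacent_swap_def transpose_def)
  ultimately show ?thesis by (simp add: type_B_group_def)
qed

lemma signed_swap_in_type_B:
  assumes "2 \<le> n"
  shows "signed_swap n \<in> carrier (type_B_group n)"
proof -
  have "sign_change n permutes signed_points n"
    unfolding sign_change_def using assms
    by (intro permutes_swap_id) (auto simp: signed_points_def)
  moreover have "sign_change n (- k) = - sign_change n k" for k
    by (auto simp: sign_change_def transpose_def)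
  moreover have "adjacent_swap (n - 1) \<in> carrier (type_B_group n)"
    using assms by (intro adjacent_swap_in_type_B) auto
  ultimately show ?thesis
    unfolding signed_swap_def type_B_group_def by (auto intro!: permutes_compose)
qed

lemma adjacent_swap_apply:
  assumes "1 \<le> i"
  shows "adjacent_swap i k =
    (if k = int i then int i + 1 else if k = int i + 1 then int i
     else if k = - int i then - int i - 1 else if k = - int i - 1 then - int i else k)"
  using assms by (simp add: adjacent_swap_def transpose_def)

lemma signed_swap_apply:
  assumes "2 \<le> n"
  shows "signed_swap n k =
    (if k = int n then - (int n - 1) else if k = int n - 1 then - int n
     else if k = - int n then int n - 1 else if k = - (int n - 1) then int n else k)"
proof -
  have "1 \<le> n - 1" "int (n - 1) = int n - 1" using assms by auto
  then show ?thesis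
    using assms by (simp add: signed_swap_def adjacent_swap_apply sign_change_def transpose_def)
qed

lemma act_adjacent_swap:
  assumes "clinear J" and i: "i = length u + 1" and n: "n = length u + 2 + length v"
  shows "act J n (adjacent_swap i) (tensor (u @ [x, y] @ v)) = tensor (u @ [y, x] @ v)"
proof -
  have i1: "1 \<le> i" using i by simp
  have inv: "inv_into UNIV (adjacent_swap i) = adjacent_swap i"
    by (rule inv_unique_comp) (use i1 in \<open>auto simp: adjacent_swap_apply fun_eq_iff\<close>)
  have "act_word J (adjacent_swap i) (u @ [x, y] @ v) = u @ [y, x] @ v"
  proof (rule nth_equalityI)
    fix j assume "j < length (act_word J (adjacent_swap i) (u @ [x, y] @ v))"
    then have j: "j < length (u @ [x, y] @ v)" by simp
    then have eq: "act_word J (adjacent_swap i) (u @ [x, y] @ v) ! j =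
        signed_letter J (u @ [x, y] @ v) (adjacent_swap i (int j + 1))"
      by (simp only: nth_act_word inv)
    consider "j < length u" | "j = length u" | "j = Suc (length u)" | "j > Suc (length u)"
      by linarith
    then show "act_word J (adjacent_swap i) (u @ [x, y] @ v) ! j = (u @ [y, x] @ v) ! j"
    proof cases
      case 1
      then have "adjacent_swap i (int j + 1) = int j + 1"
        using i by (subst adjacent_swap_apply[OF i1]) simp
      with 1 show ?thesis
        unfolding eq by (simp add: signed_letter_def nth_append nat_add_distrib)
    next
      case 2
      then have "adjacent_swap i (int j + 1) = int (length u) + 2"
        using i by (subst adjacent_swap_apply[OF i1]) simp
      with 2 show ?thesis
        unfolding eq by (simp add: signed_letter_def nth_append nat_add_distrib)
    next
      case 3
      then have "adjacent_swap i (int j + 1) = int (length u) + 1"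
        using i by (subst adjacent_swap_apply[OF i1]) simp
      with 3 show ?thesis
        unfolding eq by (simp add: signed_letter_def nth_append nat_add_distrib)
    next
      case 4
      then have "adjacent_swap i (int j + 1) = int j + 1"
        using i by (subst adjacent_swap_apply[OF i1]) simp
      moreover obtain k where "j = length u + 2 + k"
        using 4 by (metis Suc_leI add_2_eq_Suc' add_Suc le_Suc_ex)
      ultimately show ?thesis
        unfolding eq by (simp add: signed_letter_def nth_append nat_add_distrib)
    qed
  qed simp
  moreover have "length (u @ [x, y] @ v) = n" using n by simp
  moreover have "adjacent_swap i \<in> carrier (type_B_group n)"
    using i n by (intro adjacent_swap_in_type_B) auto
  ultimately show ?thesis
    by (simp only: act_tensor[OF assms(1)] if_True refl)
qed

lemma act_signed_swap:
  assumes "clinear J" and n: "n = length u + 2"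
  shows "act J n (signed_swap n) (tensor (u @ [x, y])) = tensor (u @ [J y, J x])"
proof -
  have n2: "2 \<le> n" using n by simp
  have inv: "inv_into UNIV (signed_swap n) = signed_swap n"
    by (rule inv_unique_comp) (use n2 in \<open>auto simp: signed_swap_apply fun_eq_iff\<close>)
  have "act_word J (signed_swap n) (u @ [x, y]) = u @ [J y, J x]"
  proof (rule nth_equalityI)
    fix j assume "j < length (act_word J (signed_swap n) (u @ [x, y]))"
    then have j: "j < n" using n by simp
    then have "j < length (u @ [x, y])" using n by simp
    then have eq: "act_word J (signed_swap n) (u @ [x, y]) ! j =
        signed_letter J (u @ [x, y]) (signed_swap n (int j + 1))"
      by (simp only: nth_act_word inv)
    consider "j < length u" | "j = length u" | "j = Suc (length u)"
      using j n by linarith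
    then show "act_word J (signed_swap n) (u @ [x, y]) ! j = (u @ [J y, J x]) ! j"
    proof cases
      case 1
      then have "signed_swap n (int j + 1) = int j + 1"
        using n by (subst signed_swap_apply[OF n2]) simp
      with 1 show ?thesis
        unfolding eq by (simp add: signed_letter_def nth_append nat_add_distrib)
    next
      case 2
      then have "signed_swap n (int j + 1) = - (int (length u) + 2)"
        using n by (subst signed_swap_apply[OF n2]) simp
      with 2 show ?thesis
        unfolding eq by (simp add: signed_letter_def nth_append nat_add_distrib)
    next
      case 3
      then have "signed_swap n (int j + 1) = - (int (length u) + 1)"
        using n by (subst signed_swap_apply[OF n2]) simp
      with 3 show ?thesis
        unfolding eq by (simp add: signed_letter_def nth_append nat_add_distrib)
    qed
  qed simp
  moreover have "length (u @ [x, y]) = n" using n by simp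
  ultimately show ?thesis
    by (simp only: act_tensor[OF assms(1) signed_swap_in_type_B[OF n2]] if_True refl)
qed


section \<open>The q-deformed inner product of type D\<close>

definition symmetrizer ::
    "('h::complex_hilbert_space \<Rightarrow> 'h) \<Rightarrow> real \<Rightarrow> nat \<Rightarrow> 'h fock \<Rightarrow> 'h fock" where
  "symmetrizer J q n f = (\<Sum>\<sigma>\<in>type_D n. complex_of_real (q ^ type_D_length n \<sigma>) *\<^sub>C act J n \<sigma> f)"

text \<open>
  The direct sum over n of the degree-n symmetrizers.  For n = 0 the group is trivial, so
  the vacuum is fixed.
\<close>

definition fock_symmetrizer ::
    "('h::complex_hilbert_space \<Rightarrow> 'h) \<Rightarrow> real \<Rightarrow> 'h fock \<Rightarrow> 'h fock" where
  "fock_symmetrizer J q = linear_ext (\<lambda>w. symmetrizer J q (length w) (tensor w))"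

lemma type_D_subset_type_B: "type_D n \<subseteq> carrier (type_B_group n)"
proof
  let ?G = "type_B_group n"
  have comp: "\<sigma> \<circ> \<tau> \<in> carrier ?G" if "\<sigma> \<in> carrier ?G" "\<tau> \<in> carrier ?G" for \<sigma> \<tau>
    using that by (auto simp: type_B_group_def intro: permutes_compose)
  have id: "id \<in> carrier ?G"
    by (simp add: type_B_group_def permutes_id)
  have "adjacent_swap i \<in> carrier ?G" if "i \<in> {1..n - 1}" for i
    using that by (intro adjacent_swap_in_type_B) auto
  then have gens: "type_D_generators n \<subseteq> carrier ?G"
    by (auto simp: type_D_generators_def intro: signed_swap_in_type_B)
  interpret group ?G
  proof (rule groupI)
    fix \<sigma> assume \<sigma>: "\<sigma> \<in> carrier ?G"
    have "inv_into UNIV \<sigma> \<in> carrier ?G"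
      using \<sigma> type_B_inv(3)[OF \<sigma>] by (auto simp: type_B_group_def intro: permutes_inv)
    moreover have "inv_into UNIV \<sigma> \<circ> \<sigma> = id"
      using type_B_inv(1)[OF \<sigma>] by (simp add: bij_is_inj)
    ultimately show "\<exists>\<tau>\<in>carrier ?G. \<tau> \<otimes>\<^bsub>?G\<^esub> \<sigma> = \<one>\<^bsub>?G\<^esub>"
      by (intro bexI[of _ "inv_into UNIV \<sigma>"]) (simp_all add: type_B_group_def)
  qed (use comp id in \<open>auto simp: type_B_group_def comp_assoc\<close>)
  fix \<sigma> assume "\<sigma> \<in> type_D n"
  then show "\<sigma> \<in> carrier ?G"
    unfolding type_D_def by (rule generate_in_carrier[OF gens])
qed

lemma multilinear_symmetrizer:
  assumes "clinear J"
  shows "multilinear_on_words (\<lambda>w. symmetrizer J q (length w) (tensor w))"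
  unfolding multilinear_on_words_def
proof (intro allI impI)
  fix w :: "'a list" and i a x y
  assume i: "i < length w"
  let ?n = "length w"
  have act: "act J ?n \<sigma> (tensor (w[i := a *\<^sub>C x + y])) =
      a *\<^sub>C act J ?n \<sigma> (tensor (w[i := x])) + act J ?n \<sigma> (tensor (w[i := y]))"
    if "\<sigma> \<in> type_D ?n" for \<sigma>
  proof -
    have \<sigma>: "\<sigma> \<in> carrier (type_B_group ?n)" using that type_D_subset_type_B by blast
    show ?thesis
      using act_word_update(2)[OF \<sigma> refl i] assms
      by (simp add: act_tensor[OF assms \<sigma>] act_word_update(1)[OF \<sigma> refl i] tensor_update
          clinear_def)
  qed
  let ?c = "\<lambda>\<sigma>. complex_of_real (q ^ type_D_length ?n \<sigma>)"
  have "symmetrizer J q ?n (tensor (w[i := a *\<^sub>C x + y])) =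
      (\<Sum>\<sigma>\<in>type_D ?n. a *\<^sub>C (?c \<sigma> *\<^sub>C act J ?n \<sigma> (tensor (w[i := x])))
        + ?c \<sigma> *\<^sub>C act J ?n \<sigma> (tensor (w[i := y])))"
    unfolding symmetrizer_def
    by (rule sum.cong[OF refl]) (simp only: act scaleC_add_right scaleC_scaleC mult.commute)
  also have "\<dots> = a *\<^sub>C symmetrizer J q ?n (tensor (w[i := x])) +
      symmetrizer J q ?n (tensor (w[i := y]))"
    by (simp only: symmetrizer_def scaleC_sum_right sum.distrib)
  finally show "symmetrizer J q (length (w[i := a *\<^sub>C x + y])) (tensor (w[i := a *\<^sub>C x + y])) =
      a *\<^sub>C symmetrizer J q (length (w[i := x])) (tensor (w[i := x])) +
      symmetrizer J q (length (w[i := y])) (tensor (w[i := y]))"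
    by (simp only: length_list_update)
qed

lemma fock_symmetrizer_tensor:
  assumes "clinear J"
  shows "fock_symmetrizer J q (tensor w) = symmetrizer J q (length w) (tensor w)"
  unfolding fock_symmetrizer_def by (rule linear_ext_tensor[OF multilinear_symmetrizer[OF assms]])

definition fock_inner ::
    "('h::complex_hilbert_space \<Rightarrow> 'h) \<Rightarrow> real \<Rightarrow> 'h fock \<Rightarrow> 'h fock \<Rightarrow> complex" where
  "fock_inner J q f g = fock_inner0 f (fock_symmetrizer J q g)"

definition fock_norm ::
    "('h::complex_hilbert_space \<Rightarrow> 'h) \<Rightarrow> real \<Rightarrow> 'h fock \<Rightarrow> real" where
  "fock_norm J q f = sqrt (Re (fock_inner J q f f))"

text \<open>The supremum is taken in the extended reals; it is infinite if T is unbounded.\<close>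

definition fock_onorm ::
    "('h::complex_hilbert_space \<Rightarrow> 'h) \<Rightarrow> real \<Rightarrow> ('h fock \<Rightarrow> 'h fock) \<Rightarrow> ereal" where
  "fock_onorm J q T = (SUP f\<in>{f. fock_norm J q f \<le> 1}. ereal (fock_norm J q (T f)))"

end

theory Submission
  imports Defs "HOL-Library.Complex_Order"
begin

text \<open>
Write $\langle f, g\rangle _q$ for the deformed inner product, $J$ for the involution of $H$, and $d(x)$ for
the adjoint of the creation operator $d^*(x)$ with respect to $\langle \cdot,\cdot\rangle_q$.

An element of the type D group on $n$ positions is, in a unique way, an element that fixes the
first position, composed with a coset representative, which is determined by the signed position
that it brings to the front; the lengths of the two factors add up (bij_betw_even_coset,
inversions_shift_coset_rep).  Grouping the sum over the group by cosets shows that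
$d(x)$ is given on words by
$$d(x)(y_1 \cdots y_n) = \sum_k q^{k-1} \langle x, y_k\rangle\, w_k
  + \sum_k q^{2n-1-k} \langle x, J y_k\rangle\, E w_k ,$$
where $w_k$ is the word without its $k$-th letter, $E$ (flip) applies $J$ to the last letter of a word, and
the second sum is present for $n \ge 2$ (creation_adjoint).  Comparing this formula for a word and for
the word with an extra first letter gives, on elements $f$ of degree $n \ge 2$,
$$d(x)\, d^*(x) f = \|x\|^2 f + q\, d^*(x)\, d(x) f + q^{2n} \langle x, Jx\rangle\, E f$$
(annihilation_creation), and hence
$$\|d^*(x) f\|_q^2 = \|x\|^2 \|f\|_q^2 + q \|d(x) f\|_q^2 + q^{2n} \langle x, Jx\rangle \langle f, E f\rangle_q .$$
Since $E$ is a symmetric involution, the last term is at most $q^{2n} \|x\|^2 \|f\|_q^2$.  For $q < 0$ the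
middle term is not positive, and the factor $1 + q^2$ results.  For $q \ge 0$ the middle term is
controlled by the norm of $d^*(x)$ one degree lower, because $d(x)$ is its adjoint; so a
bound $K$ for the squared norm passes from one degree to the next as soon as $2 + qK \le K$,
which is how $K = 2/(1-q)$ arises.  Degrees 0 and 1 are computed directly.

For the lower bound the vacuum suffices when $q < 0$.  For $q \ge 0$ the tensor powers of $x$ are
used: in the expansion of $\|x^{\otimes (n+1)}\|_q^2$ all terms that come from sign changes are
nonnegative, so that
$\|x^{\otimes (n+1)}\|_q^2 \ge (1 + q + \cdots + q^n) \|x\|^2 \|x^{\otimes n}\|_q^2$.

All of this uses that $\langle\cdot,\cdot\rangle_q$ is positive semidefinite (word_form_positive).
The length of $\sigma^{-1}\tau$ is the number of positive roots on whose signs $\sigma^{-1}$ and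
$\tau^{-1}$ disagree; hence $q^{\ell(\sigma^{-1}\tau)}$ is a product, over the roots, of kernels with the two
values 1 and $q$, and it is a positive definite kernel for $|q| \le 1$.
\<close>

section \<open>Roots and lengths in the Coxeter groups of type D\<close>

text \<open>
  A pair (a, b) with \<bar>a\<bar> \<noteq> \<bar>b\<bar> stands for the root e(a) + e(b) of the root system of type D, where e(-k) = -e(k).
  Its sign is the sign of the term with the smaller index.
\<close>

definition neg_root :: "int \<Rightarrow> int \<Rightarrow> bool" where
  "neg_root a b \<longleftrightarrow> (if \<bar>a\<bar> < \<bar>b\<bar> then a < 0 else b < 0)"

text \<open>
  Putting the leading term first represents every positive root by exactly one pair.
\<close>

definition pos_roots :: "nat \<Rightarrow> (int \<times> int) set" where
  "pos_roots n = {(a, b). 0 < a \<and> a < \<bar>b\<bar> \<and> \<bar>b\<bar> \<le> int n}"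

text \<open>
  The Hamming distance between the sign patterns that two signed permutations produce on the
  positive roots.  Its value at the identity is the number of inversions, which is going to be the
  length; the distance of two elements is the length of their quotient.
\<close>

definition root_dist :: "nat \<Rightarrow> (int \<Rightarrow> int) \<Rightarrow> (int \<Rightarrow> int) \<Rightarrow> nat" where
  "root_dist n \<sigma> \<tau> = card {(a, b) \<in> pos_roots n. neg_root (\<sigma> a) (\<sigma> b) \<noteq> neg_root (\<tau> a) (\<tau> b)}"

abbreviation inversions :: "nat \<Rightarrow> (int \<Rightarrow> int) \<Rightarrow> nat" where
  "inversions n \<sigma> \<equiv> root_dist n \<sigma> id"

abbreviation signed_perms :: "nat \<Rightarrow> (int \<Rightarrow> int) set" where
  "signed_perms n \<equiv> carrier (type_B_group n)"

lemma finite_pos_roots [simp]: "finite (pos_roots n)"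
  by (rule finite_subset[of _ "{- int n..int n} \<times> {- int n..int n}"]) (auto simp: pos_roots_def)

lemma signed_permsI:
  "\<sigma> permutes signed_points n \<Longrightarrow> (\<And>k. \<sigma> (- k) = - \<sigma> k) \<Longrightarrow> \<sigma> \<in> signed_perms n"
  by (simp add: type_B_group_def)

lemma signed_perms_permutes: "\<sigma> \<in> signed_perms n \<Longrightarrow> \<sigma> permutes signed_points n"
  by (simp add: type_B_group_def)

lemma id_signed_perms: "id \<in> signed_perms n"
  by (simp add: type_B_group_def permutes_id)

lemma comp_signed_perms:
  "\<sigma> \<in> signed_perms n \<Longrightarrow> \<tau> \<in> signed_perms n \<Longrightarrow> \<sigma> \<circ> \<tau> \<in> signed_perms n"
  by (auto simp: type_B_group_def intro: permutes_compose)

lemma inv_signed_perms: "\<sigma> \<in> signed_perms n \<Longrightarrow> inv_into UNIV \<sigma> \<in> signed_perms n"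
  using type_B_inv(3)[of \<sigma> n] by (auto simp: type_B_group_def intro: permutes_inv)

lemma signed_perms_inverse:
  assumes "\<sigma> \<in> signed_perms n"
  shows "\<sigma> (inv_into UNIV \<sigma> k) = k" "inv_into UNIV \<sigma> (\<sigma> k) = k"
  using permutes_inverses[OF signed_perms_permutes[OF assms]] by auto

lemma inv_comp_signed_perms:
  assumes "\<sigma> \<in> signed_perms n"
  shows "\<sigma> \<circ> inv_into UNIV \<sigma> = id" "inv_into UNIV \<sigma> \<circ> \<sigma> = id"
  using signed_perms_inverse[OF assms] by (auto simp: fun_eq_iff)

lemma signed_perms_zero: "\<sigma> \<in> signed_perms n \<Longrightarrow> \<sigma> 0 = 0"
  using type_B_inv(2)[of \<sigma> n 0] by simp

lemma signed_perms_inj: "\<sigma> \<in> signed_perms n \<Longrightarrow> \<sigma> a = \<sigma> b \<longleftrightarrow> a = b"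
  by (metis signed_perms_inverse(2))

lemma signed_perms_abs_eq: 
  assumes "\<sigma> \<in> signed_perms n"
  shows "\<bar>\<sigma> a\<bar> = \<bar>\<sigma> b\<bar> \<longleftrightarrow> \<bar>a\<bar> = \<bar>b\<bar>"
proof -
  have "\<bar>\<sigma> a\<bar> = \<bar>\<sigma> b\<bar> \<longleftrightarrow> \<sigma> a = \<sigma> b \<or> \<sigma> a = \<sigma> (- b)"
    unfolding type_B_inv(2)[OF assms] by (auto simp: abs_eq_iff)
  then show ?thesis unfolding signed_perms_inj[OF assms] by (auto simp: abs_eq_iff)
qed

lemma signed_perms_outside: "\<sigma> \<in> signed_perms n \<Longrightarrow> \<bar>k\<bar> > int n \<Longrightarrow> \<sigma> k = k"
  by (rule permutes_not_in[OF signed_perms_permutes]) (auto simp: signed_points_def)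

lemma signed_perms_range:
  assumes "\<sigma> \<in> signed_perms n" "k \<noteq> 0" "\<bar>k\<bar> \<le> int n"
  shows "\<sigma> k \<noteq> 0" "\<bar>\<sigma> k\<bar> \<le> int n"
proof -
  have "k \<in> signed_points n" using assms(2,3) by (simp add: signed_points_def abs_le_iff)
  then have "\<sigma> k \<in> signed_points n" by (rule type_B_inv(4)[OF assms(1)])
  then show "\<sigma> k \<noteq> 0" "\<bar>\<sigma> k\<bar> \<le> int n" by (auto simp: signed_points_def)
qed

text \<open>
  Positive roots are not permuted by the group, but these pairs are: they represent all
  roots, each by two ordered pairs.
\<close>

definition all_roots :: "nat \<Rightarrow> (int \<times> int) set" where
  "all_roots n = {(a, b). a \<in> signed_points n \<and> b \<in> signed_points n \<and> \<bar>a\<bar> \<noteq> \<bar>b\<bar>}"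

text \<open>
  A root and its negative have four representing pairs, one of which is a positive root with its
  leading term first.
\<close>

lemma card_all_roots:
  assumes swap: "\<And>a b. (a, b) \<in> all_roots n \<Longrightarrow> P b a \<longleftrightarrow> P a b"
    and neg: "\<And>a b. (a, b) \<in> all_roots n \<Longrightarrow> P (- a) (- b) \<longleftrightarrow> P a b"
  shows "card {(a, b) \<in> all_roots n. P a b} = 4 * card {(a, b) \<in> pos_roots n. P a b}"
proof -
  let ?A = "{(a, b) \<in> all_roots n. P a b}"
  define S where "S = {(a, b) \<in> pos_roots n. P a b}"
  define M where "M = (\<lambda>(a::int, b::int). (- a, - b)) ` S"
  have fin: "finite S" unfolding S_def by (rule finite_subset[OF _ finite_pos_roots[of n]]) auto
  have root: "(a, b) \<in> all_roots n" if "(a, b) \<in> pos_roots n" for a b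
    using that by (auto simp: all_roots_def pos_roots_def signed_points_def)
  have M: "(a, b) \<in> M \<longleftrightarrow> (a, b) \<in> all_roots n \<and> P a b \<and> a < 0 \<and> - a < \<bar>b\<bar>" for a b
  proof -
    have "(a, b) \<in> M \<longleftrightarrow> (- a, - b) \<in> S" unfolding M_def by force
    moreover have "(- a, - b) \<in> pos_roots n \<longleftrightarrow> (a, b) \<in> all_roots n \<and> a < 0 \<and> - a < \<bar>b\<bar>"
      by (simp add: all_roots_def pos_roots_def signed_points_def abs_if) linarith
    ultimately show ?thesis
      using neg[of a b] by (auto simp: S_def)
  qed
  have S: "(a, b) \<in> S \<longleftrightarrow> (a, b) \<in> all_roots n \<and> P a b \<and> 0 < a \<and> a < \<bar>b\<bar>" for a b
    unfolding S_def by (auto simp: all_roots_def pos_roots_def signed_points_def)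
  have SM: "(a, b) \<in> S \<union> M \<longleftrightarrow> (a, b) \<in> all_roots n \<and> P a b \<and> \<bar>a\<bar> < \<bar>b\<bar>" for a b
  proof -
    have "a \<noteq> 0" if "(a, b) \<in> all_roots n" using that by (simp add: all_roots_def signed_points_def)
    then show ?thesis unfolding Un_iff M S by (cases a "0::int" rule: linorder_cases) auto
  qed
  have pairs: "(a, b) \<in> ?A \<longleftrightarrow> (a, b) \<in> (S \<union> M) \<union> prod.swap ` (S \<union> M)" for a b
  proof -
    have "(b, a) \<in> all_roots n \<longleftrightarrow> (a, b) \<in> all_roots n"
      and "(a, b) \<in> all_roots n \<Longrightarrow> \<bar>a\<bar> < \<bar>b\<bar> \<or> \<bar>b\<bar> < \<bar>a\<bar>"
      by (auto simp: all_roots_def)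
    moreover have "(a, b) \<in> prod.swap ` (S \<union> M) \<longleftrightarrow> (b, a) \<in> S \<union> M" by force
    ultimately show ?thesis
      using swap[of a b] by (simp only: Un_iff[of _ "S \<union> M"] SM mem_Collect_eq prod.case) blast
  qed
  have eq: "?A = (S \<union> M) \<union> prod.swap ` (S \<union> M)"
    unfolding set_eq_iff split_paired_All using pairs by blast
  have fM: "finite M" unfolding M_def using fin by simp
  have "card ?A = card (S \<union> M) + card (prod.swap ` (S \<union> M))"
    unfolding eq
  proof (rule card_Un_disjoint)
    show "(S \<union> M) \<inter> prod.swap ` (S \<union> M) = {}"
      by (auto simp: S M)
  qed (use fin fM in auto)
  also have "card (prod.swap ` (S \<union> M)) = card (S \<union> M)"
    by (rule card_image) (auto simp: inj_on_def)
  also have "card (S \<union> M) = card S + card M"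
    by (rule card_Un_disjoint) (use fin fM in \<open>auto simp: S M\<close>)
  also have "card M = card S"
    unfolding M_def by (rule card_image) (auto simp: inj_on_def)
  finally show ?thesis by (simp add: S_def)
qed

lemma neg_root_commute: "\<bar>a\<bar> \<noteq> \<bar>b\<bar> \<Longrightarrow> neg_root b a \<longleftrightarrow> neg_root a b"
  by (auto simp: neg_root_def)

lemma neg_root_minus: "\<bar>a\<bar> \<noteq> \<bar>b\<bar> \<Longrightarrow> a \<noteq> 0 \<Longrightarrow> b \<noteq> 0 \<Longrightarrow> neg_root (- a) (- b) \<longleftrightarrow> \<not> neg_root a b"
  by (auto simp: neg_root_def)

lemma root_dist_all_roots:
  assumes \<sigma>: "\<sigma> \<in> signed_perms n" and \<tau>: "\<tau> \<in> signed_perms n"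
  shows "card {(a, b) \<in> all_roots n. neg_root (\<sigma> a) (\<sigma> b) \<noteq> neg_root (\<tau> a) (\<tau> b)}
    = 4 * root_dist n \<sigma> \<tau>"
  unfolding root_dist_def
proof (rule card_all_roots)
  fix a b assume "(a, b) \<in> all_roots n"
  then have ab: "\<bar>a\<bar> \<noteq> \<bar>b\<bar>" "a \<noteq> 0" "b \<noteq> 0" "\<bar>a\<bar> \<le> int n" "\<bar>b\<bar> \<le> int n"
    by (auto simp: all_roots_def signed_points_def)
  have *: "\<bar>\<rho> a\<bar> \<noteq> \<bar>\<rho> b\<bar>" "\<rho> a \<noteq> 0" "\<rho> b \<noteq> 0" if "\<rho> \<in> signed_perms n" for \<rho>
    using ab signed_perms_abs_eq[OF that] signed_perms_range[OF that] by auto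
  show "(neg_root (\<sigma> b) (\<sigma> a) \<noteq> neg_root (\<tau> b) (\<tau> a)) =
      (neg_root (\<sigma> a) (\<sigma> b) \<noteq> neg_root (\<tau> a) (\<tau> b))"
    using *[OF \<sigma>] *[OF \<tau>] by (metis neg_root_commute)
  show "(neg_root (\<sigma> (- a)) (\<sigma> (- b)) \<noteq> neg_root (\<tau> (- a)) (\<tau> (- b))) =
      (neg_root (\<sigma> a) (\<sigma> b) \<noteq> neg_root (\<tau> a) (\<tau> b))"
    unfolding type_B_inv(2)[OF \<sigma>] type_B_inv(2)[OF \<tau>]
    using *[OF \<sigma>] *[OF \<tau>] by (metis neg_root_minus)
qed

text \<open>
  Composing with a third element on the right only relabels the roots.  To see this the count has to
  be taken over the full, invariant set of pairs.
\<close>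

lemma root_dist_comp_right:
  assumes \<sigma>: "\<sigma> \<in> signed_perms n" and \<tau>: "\<tau> \<in> signed_perms n" and \<rho>: "\<rho> \<in> signed_perms n"
  shows "root_dist n (\<sigma> \<circ> \<rho>) (\<tau> \<circ> \<rho>) = root_dist n \<sigma> \<tau>"
proof -
  let ?D = "\<lambda>\<sigma> \<tau>. {(a, b) \<in> all_roots n. neg_root (\<sigma> a) (\<sigma> b) \<noteq> neg_root (\<tau> a) (\<tau> b)}"
  have mem: "(\<rho> a, \<rho> b) \<in> all_roots n \<longleftrightarrow> (a, b) \<in> all_roots n" for a b
    using permutes_in_image[OF signed_perms_permutes[OF \<rho>]] signed_perms_abs_eq[OF \<rho>, of a b]
    by (simp add: all_roots_def)
  have "bij_betw (map_prod \<rho> \<rho>) (?D (\<sigma> \<circ> \<rho>) (\<tau> \<circ> \<rho>)) (?D \<sigma> \<tau>)"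
  proof (rule bij_betw_byWitness[where f' = "map_prod (inv_into UNIV \<rho>) (inv_into UNIV \<rho>)"])
    show "map_prod (inv_into UNIV \<rho>) (inv_into UNIV \<rho>) ` ?D \<sigma> \<tau> \<subseteq> ?D (\<sigma> \<circ> \<rho>) (\<tau> \<circ> \<rho>)"
      using signed_perms_inverse[OF \<rho>] mem
      by (auto; metis)
  qed (use signed_perms_inverse[OF \<rho>] mem in auto)
  then have "card (?D (\<sigma> \<circ> \<rho>) (\<tau> \<circ> \<rho>)) = card (?D \<sigma> \<tau>)"
    by (rule bij_betw_same_card)
  then show ?thesis
    using root_dist_all_roots[OF \<sigma> \<tau>]
      root_dist_all_roots[OF comp_signed_perms[OF \<sigma> \<rho>] comp_signed_perms[OF \<tau> \<rho>]] by simp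
qed

lemma root_dist_commute: "root_dist n \<sigma> \<tau> = root_dist n \<tau> \<sigma>"
  unfolding root_dist_def by (rule arg_cong[where f = card]) auto

lemma inversions_eq: "inversions n \<sigma> = card {(a, b) \<in> pos_roots n. neg_root (\<sigma> a) (\<sigma> b)}"
  unfolding root_dist_def
  by (rule arg_cong[where f = card]) (auto simp: pos_roots_def neg_root_def)

lemma inversions_comp_inv:
  assumes "\<sigma> \<in> signed_perms n" "\<tau> \<in> signed_perms n"
  shows "inversions n (\<sigma> \<circ> inv_into UNIV \<tau>) = root_dist n \<sigma> \<tau>"
  using root_dist_comp_right[OF assms inv_signed_perms[OF assms(2)]]
  by (simp add: inv_comp_signed_perms[OF assms(2)])

subsection \<open>Parity\<close>

text \<open>
  This is 1 or -1 according to the parity of the number of positive points sent to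
  negative ones.
\<close>

definition sign_product :: "nat \<Rightarrow> (int \<Rightarrow> int) \<Rightarrow> int" where
  "sign_product n \<sigma> = (\<Prod>i\<in>{1..int n}. sgn (\<sigma> i))"

lemma sign_product_id [simp]: "sign_product n id = 1"
  by (simp add: sign_product_def)

lemma bij_abs_signed_perm:
  assumes "\<tau> \<in> signed_perms n"
  shows "bij_betw (\<lambda>i. \<bar>\<tau> i\<bar>) {1..int n} {1..int n}"
proof -
  have "inj_on (\<lambda>i. \<bar>\<tau> i\<bar>) {1..int n}"
    by (auto simp: inj_on_def signed_perms_abs_eq[OF assms])
  moreover have "(\<lambda>i. \<bar>\<tau> i\<bar>) ` {1..int n} \<subseteq> {1..int n}"
  proof
    fix j assume "j \<in> (\<lambda>i. \<bar>\<tau> i\<bar>) ` {1..int n}"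
    then obtain i where "j = \<bar>\<tau> i\<bar>" "1 \<le> i" "i \<le> int n" by auto
    with signed_perms_range[OF assms, of i] show "j \<in> {1..int n}" by simp
  qed
  ultimately show ?thesis
    by (simp add: bij_betw_def endo_inj_surj)
qed

lemma sign_product_comp:
  assumes \<sigma>: "\<sigma> \<in> signed_perms n" and \<tau>: "\<tau> \<in> signed_perms n"
  shows "sign_product n (\<sigma> \<circ> \<tau>) = sign_product n \<sigma> * sign_product n \<tau>"
proof -
  have "sgn (\<sigma> (\<tau> i)) = sgn (\<sigma> \<bar>\<tau> i\<bar>) * sgn (\<tau> i)" for i
    using type_B_inv(2)[OF \<sigma>, of "\<tau> i"] signed_perms_zero[OF \<sigma>]
    by (cases "\<tau> i" "0::int" rule: linorder_cases) (auto simp: sgn_minus)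
  then have "sign_product n (\<sigma> \<circ> \<tau>) = (\<Prod>i\<in>{1..int n}. sgn (\<sigma> \<bar>\<tau> i\<bar>)) * sign_product n \<tau>"
    by (simp add: sign_product_def prod.distrib)
  also have "(\<Prod>i\<in>{1..int n}. sgn (\<sigma> \<bar>\<tau> i\<bar>)) = sign_product n \<sigma>"
    unfolding sign_product_def by (rule prod.reindex_bij_betw[OF bij_abs_signed_perm[OF \<tau>]])
  finally show ?thesis .
qed

text \<open>
  The explicit description of the type D group; the identification is made below, once every
  such element has been written as a product of generators.
\<close>

definition even_signed_perms :: "nat \<Rightarrow> (int \<Rightarrow> int) set" where
  "even_signed_perms n = {\<sigma> \<in> signed_perms n. sign_product n \<sigma> = 1}"

lemma even_signed_permsD:
  "\<sigma> \<in> even_signed_perms n \<Longrightarrow> \<sigma> \<in> signed_perms n"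
  "\<sigma> \<in> even_signed_perms n \<Longrightarrow> sign_product n \<sigma> = 1"
  by (simp_all add: even_signed_perms_def)

lemma id_even: "id \<in> even_signed_perms n"
  by (simp add: even_signed_perms_def id_signed_perms)

lemma comp_even:
  "\<sigma> \<in> even_signed_perms n \<Longrightarrow> \<tau> \<in> even_signed_perms n \<Longrightarrow> \<sigma> \<circ> \<tau> \<in> even_signed_perms n"
  by (simp add: even_signed_perms_def comp_signed_perms sign_product_comp)

lemma inv_even:
  assumes "\<sigma> \<in> even_signed_perms n"
  shows "inv_into UNIV \<sigma> \<in> even_signed_perms n"
proof -
  note \<sigma> = even_signed_permsD[OF assms]
  have "sign_product n (\<sigma> \<circ> inv_into UNIV \<sigma>) = 1"
    by (simp add: inv_comp_signed_perms[OF \<sigma>(1)])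
  then show ?thesis
    using \<sigma> by (simp add: even_signed_perms_def inv_signed_perms sign_product_comp)
qed

subsection \<open>Length\<close>

lemma adjacent_swap_even:
  assumes "1 \<le> i" "i < n"
  shows "adjacent_swap i \<in> even_signed_perms n"
proof -
  have "sgn (adjacent_swap i k) = 1" if "k \<in> {1..int n}" for k
    using that assms by (auto simp: adjacent_swap_apply)
  then have "sign_product n (adjacent_swap i) = 1"
    by (simp add: sign_product_def)
  then show ?thesis
    using adjacent_swap_in_type_B[OF assms] by (simp add: even_signed_perms_def)
qed

lemma signed_swap_even:
  assumes "2 \<le> n"
  shows "signed_swap n \<in> even_signed_perms n"
proof -
  have *: "{1..int n} = insert (int n) (insert (int n - 1) {1..int n - 2})" using assms by auto
  have "sgn (signed_swap n k) = 1" if "k \<in> {1..int n - 2}" for k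
    using that assms by (auto simp: signed_swap_apply)
  then have "sign_product n (signed_swap n) = 1"
    unfolding sign_product_def * using assms by (simp add: signed_swap_apply)
  then show ?thesis
    using signed_swap_in_type_B[OF assms] by (simp add: even_signed_perms_def)
qed

lemma generator_even: "g \<in> type_D_generators n \<Longrightarrow> g \<in> even_signed_perms n"
  by (auto simp: type_D_generators_def adjacent_swap_even signed_swap_even split: if_splits)

lemma generator_involution:
  assumes "g \<in> type_D_generators n"
  shows "g \<circ> g = id"
proof -
  have n: "2 \<le> n" using assms by (auto simp: type_D_generators_def split: if_splits)
  have "adjacent_swap i \<circ> adjacent_swap i = id" if "1 \<le> i" for i
    using that by (auto simp: adjacent_swap_apply fun_eq_iff)
  moreover have "signed_swap n \<circ> signed_swap n = id"
    using n by (auto simp: signed_swap_apply fun_eq_iff)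
  ultimately show ?thesis
    using assms n by (auto simp: type_D_generators_def)
qed

text \<open>
  A generator is the reflection in a simple root, which is the only positive root that it makes negative.
\<close>

lemma neg_root_adjacent_swap:
  assumes i: "1 \<le> i" "i < n" and ab: "(a, b) \<in> pos_roots n"
  shows "neg_root (adjacent_swap i a) (adjacent_swap i b) \<longleftrightarrow> (a, b) = (int i, - int i - 1)"
proof -
  have ab: "0 < a" "a < \<bar>b\<bar>" using ab by (auto simp: pos_roots_def)
  consider "a = int i" | "a = int i + 1" | "a \<noteq> int i" "a \<noteq> int i + 1" by blast
  then show ?thesis
  proof cases
    case 1
    then have "adjacent_swap i a = int i + 1" using i by (simp add: adjacent_swap_apply)
    moreover consider "b = int i + 1" | "b = - int i - 1" | "\<bar>b\<bar> > int i + 1"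
      using ab 1 by linarith
    then have "neg_root (int i + 1) (adjacent_swap i b) \<longleftrightarrow> b = - int i - 1"
      using i by cases (auto simp: adjacent_swap_apply neg_root_def)
    ultimately show ?thesis using 1 by simp
  next
    case 2
    then have "adjacent_swap i a = int i" "adjacent_swap i b = b"
      using i ab by (auto simp: adjacent_swap_apply)
    then show ?thesis using 2 ab by (simp add: neg_root_def)
  next
    case 3
    then have "adjacent_swap i a = a" using i ab by (auto simp: adjacent_swap_apply)
    moreover have "a < \<bar>adjacent_swap i b\<bar>"
      using i ab 3 by (auto simp: adjacent_swap_apply)
    ultimately show ?thesis using 3 ab by (simp add: neg_root_def)
  qed
qed

lemma neg_root_signed_swap:
  assumes n: "2 \<le> n" and ab: "(a, b) \<in> pos_roots n"
  shows "neg_root (signed_swap n a) (signed_swap n b) \<longleftrightarrow> (a, b) = (int n - 1, int n)"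
proof -
  have ab: "0 < a" "a < \<bar>b\<bar>" "\<bar>b\<bar> \<le> int n" using ab by (auto simp: pos_roots_def)
  consider "a = int n - 1" | "a < int n - 1" using ab by linarith
  then show ?thesis
  proof cases
    case 1
    then have "signed_swap n a = - int n" using n by (simp add: signed_swap_apply)
    moreover consider "b = int n" | "b = - int n" using ab 1 by linarith
    then have "neg_root (- int n) (signed_swap n b) \<longleftrightarrow> b = int n"
      using n by cases (auto simp: signed_swap_apply neg_root_def)
    ultimately show ?thesis using 1 by simp
  next
    case 2
    then have "signed_swap n a = a" using n ab by (auto simp: signed_swap_apply)
    moreover have "a < \<bar>signed_swap n b\<bar>"
      using n ab 2 by (auto simp: signed_swap_apply)
    ultimately show ?thesis using 2 ab by (simp add: neg_root_def)
  qed
qed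

text \<open>
  Precomposing with a simple reflection changes the sign pattern at its simple root only.
\<close>

lemma inversions_comp_reflection:
  assumes \<sigma>: "\<sigma> \<in> signed_perms n" and g: "g \<in> signed_perms n" "g \<circ> g = id"
    and root: "(c, d) \<in> pos_roots n"
      "\<And>a b. (a, b) \<in> pos_roots n \<Longrightarrow> neg_root (g a) (g b) \<longleftrightarrow> (a, b) = (c, d)"
  shows "inversions n (\<sigma> \<circ> g) \<le> Suc (inversions n \<sigma>)"
    and "neg_root (\<sigma> c) (\<sigma> d) \<Longrightarrow> inversions n \<sigma> = Suc (inversions n (\<sigma> \<circ> g))"
proof -
  let ?N = "{(a, b) \<in> pos_roots n. neg_root (\<sigma> a) (\<sigma> b)}"
  let ?M = "{(a, b) \<in> pos_roots n. neg_root (\<sigma> a) (\<sigma> b) \<noteq> neg_root (g a) (g b)}"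
  have fin: "finite ?N" by (rule finite_subset[OF _ finite_pos_roots[of n]]) auto
  have "inversions n (\<sigma> \<circ> g) = root_dist n \<sigma> g"
    using root_dist_comp_right[OF comp_signed_perms[OF \<sigma> g(1)] id_signed_perms g(1)] g(2)
    by (simp add: comp_assoc)
  then have M: "inversions n (\<sigma> \<circ> g) = card ?M"
    by (simp add: root_dist_def)
  have N: "inversions n \<sigma> = card ?N" by (rule inversions_eq)
  have "?M \<subseteq> insert (c, d) ?N" using root by auto
  then have "card ?M \<le> card (insert (c, d) ?N)"
    by (rule card_mono[rotated]) (use fin in simp)
  also have "\<dots> \<le> Suc (card ?N)"
    using fin by (simp add: card_insert_if)
  finally show "inversions n (\<sigma> \<circ> g) \<le> Suc (inversions n \<sigma>)"
    unfolding M N .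
  assume neg: "neg_root (\<sigma> c) (\<sigma> d)"
  have "?N = insert (c, d) ?M" "(c, d) \<notin> ?M" using neg root by auto
  moreover have "finite ?M" by (rule finite_subset[OF _ finite_pos_roots[of n]]) auto
  ultimately have "card ?N = Suc (card ?M)" by (simp only: card_insert_disjoint not_False_eq_True)
  then show "inversions n \<sigma> = Suc (inversions n (\<sigma> \<circ> g))"
    unfolding M N .
qed

lemma inversions_comp_generator:
  assumes "g \<in> type_D_generators n" "\<sigma> \<in> signed_perms n"
  shows "inversions n (\<sigma> \<circ> g) \<le> Suc (inversions n \<sigma>)"
proof -
  have g: "g \<in> signed_perms n" using generator_even[OF assms(1)] by (rule even_signed_permsD)
  have n: "2 \<le> n" using assms(1) by (auto simp: type_D_generators_def split: if_splits)
  consider i where "1 \<le> i" "i < n" "g = adjacent_swap i" | "g = signed_swap n"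
    using assms(1) n by (fastforce simp: type_D_generators_def)
  then show ?thesis
  proof cases
    case 1
    then show ?thesis
      using inversions_comp_reflection(1)[OF assms(2) g generator_involution[OF assms(1)],
          of "int i" "- int i - 1"] neg_root_adjacent_swap[of i n]
      by (simp add: pos_roots_def)
  next
    case 2
    then show ?thesis
      using inversions_comp_reflection(1)[OF assms(2) g generator_involution[OF assms(1)],
          of "int n - 1" "int n"] neg_root_signed_swap[of n] n
      by (simp add: pos_roots_def)
  qed
qed

text \<open>
  If all simple roots stay positive, then
  \<sigma> 1 < \<dots> < \<sigma> (n - 1) < \<bar>\<sigma> n\<bar>, with positive terms, so that \<sigma> fixes 1, \<dots>, n - 1, and
  the parity condition excludes a sign change at n.
\<close>

lemma descent:
  assumes \<sigma>: "\<sigma> \<in> even_signed_perms n" and "\<sigma> \<noteq> id"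
  obtains g where "g \<in> type_D_generators n" "inversions n \<sigma> = Suc (inversions n (\<sigma> \<circ> g))"
proof -
  note \<sigma>B = even_signed_permsD(1)[OF \<sigma>]
  have "\<sigma> = id" if none: "\<forall>g\<in>type_D_generators n. inversions n \<sigma> \<noteq> Suc (inversions n (\<sigma> \<circ> g))"
  proof -
    have adj: "\<not> neg_root (\<sigma> (int i)) (- \<sigma> (int i + 1))" if i: "1 \<le> i" "i < n" for i
    proof
      have g: "adjacent_swap i \<in> type_D_generators n" using i by (auto simp: type_D_generators_def)
      assume "neg_root (\<sigma> (int i)) (- \<sigma> (int i + 1))"
      then have "neg_root (\<sigma> (int i)) (\<sigma> (- int i - 1))"
        using type_B_inv(2)[OF \<sigma>B, of "int i + 1"] by simp
      then have "inversions n \<sigma> = Suc (inversions n (\<sigma> \<circ> adjacent_swap i))"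
        using inversions_comp_reflection(2)[OF \<sigma>B even_signed_permsD(1)[OF generator_even[OF g]]
            generator_involution[OF g], of "int i" "- int i - 1"] neg_root_adjacent_swap[OF i] i
        by (simp add: pos_roots_def)
      with none g show False by blast
    qed
    have last: "\<not> neg_root (\<sigma> (int n - 1)) (\<sigma> (int n))" if n: "2 \<le> n"
    proof
      have g: "signed_swap n \<in> type_D_generators n" using n by (auto simp: type_D_generators_def)
      assume "neg_root (\<sigma> (int n - 1)) (\<sigma> (int n))"
      then have "inversions n \<sigma> = Suc (inversions n (\<sigma> \<circ> signed_swap n))"
        using inversions_comp_reflection(2)[OF \<sigma>B even_signed_permsD(1)[OF generator_even[OF g]]
            generator_involution[OF g], of "int n - 1" "int n"] neg_root_signed_swap[OF n] n
        by (simp add: pos_roots_def)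
      with none g show False by blast
    qed
    have step: "1 \<le> i \<Longrightarrow> i + k + 1 = n \<Longrightarrow> \<sigma> (int i) > 0 \<and> \<sigma> (int i) < \<bar>\<sigma> (int i + 1)\<bar>" for i k
    proof (induction k arbitrary: i)
      case 0
      have nz: "\<sigma> (int i) \<noteq> 0" "\<sigma> (int i + 1) \<noteq> 0" "\<bar>\<sigma> (int i)\<bar> \<noteq> \<bar>\<sigma> (int i + 1)\<bar>"
        using 0 signed_perms_range[OF \<sigma>B] signed_perms_abs_eq[OF \<sigma>B] by auto
      have eqs: "int n = int i + 1" "int n - 1 = int i" using 0 by auto
      from adj[of i] last[unfolded eqs] 0 have
        "\<not> neg_root (\<sigma> (int i)) (- \<sigma> (int i + 1))" "\<not> neg_root (\<sigma> (int i)) (\<sigma> (int i + 1))"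
        by auto
      with nz show ?case by (auto simp: neg_root_def split: if_splits)
    next
      case (Suc k)
      from Suc.IH[of "Suc i"] Suc.prems have pos: "\<sigma> (int i + 1) > 0" by (simp add: add.commute)
      have nz: "\<sigma> (int i) \<noteq> 0" "\<bar>\<sigma> (int i)\<bar> \<noteq> \<bar>\<sigma> (int i + 1)\<bar>"
        using Suc.prems signed_perms_range[OF \<sigma>B] signed_perms_abs_eq[OF \<sigma>B] by auto
      with pos adj[of i] Suc.prems show ?case by (auto simp: neg_root_def split: if_splits)
    qed
    have pos: "\<sigma> (int i) > 0" and less: "\<bar>\<sigma> (int i)\<bar> < \<bar>\<sigma> (int i + 1)\<bar>" if "1 \<le> i" "i < n" for i
    proof -
      obtain k where "i + k + 1 = n" using \<open>i < n\<close> by (metis less_iff_Suc_add Suc_eq_plus1 add_Suc_right)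
      from step[OF \<open>1 \<le> i\<close> this] show "\<sigma> (int i) > 0" "\<bar>\<sigma> (int i)\<bar> < \<bar>\<sigma> (int i + 1)\<bar>" by auto
    qed
    have ge: "1 \<le> i \<Longrightarrow> i \<le> n \<Longrightarrow> int i \<le> \<bar>\<sigma> (int i)\<bar>" for i
    proof (induction i)
      case (Suc i)
      show ?case
      proof (cases "i = 0")
        case True
        then show ?thesis using signed_perms_range(1)[OF \<sigma>B, of 1] Suc.prems by simp
      next
        case False
        then show ?thesis using Suc less[of i] by (simp add: add.commute)
      qed
    qed simp
    have le: "1 \<le> i \<Longrightarrow> i + k = n \<Longrightarrow> \<bar>\<sigma> (int i)\<bar> \<le> int i" for i k
    proof (induction k arbitrary: i)
      case 0
      then show ?case using signed_perms_range(2)[OF \<sigma>B, of "int i"] by simp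
    next
      case (Suc k)
      then show ?case using less[of i] Suc.IH[of "Suc i"] by (simp add: add.commute)
    qed
    have abs: "\<bar>\<sigma> (int i)\<bar> = int i" if "1 \<le> i" "i \<le> n" for i
      using ge[OF that] le[OF that(1), of "n - i"] that by simp
    have fixes_small: "\<sigma> (int i) = int i" if "1 \<le> i" "i < n" for i
      using abs[of i] pos[OF that] that by simp
    have "\<sigma> (int n) = int n" if "n \<noteq> 0"
    proof -
      have "{1..int n} = insert (int n) {1..<int n}" using that by auto
      moreover have "sgn (\<sigma> k) = 1" if "k \<in> {1..<int n}" for k
        using that fixes_small[of "nat k"] by (simp add: nat_less_iff le_nat_iff)
      ultimately have "sgn (\<sigma> (int n)) = 1"
        using even_signed_permsD(2)[OF \<sigma>] by (simp add: sign_product_def)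
      then show ?thesis using abs[of n] that by (simp add: sgn_if split: if_splits)
    qed
    with fixes_small have pos_fix: "\<sigma> (int i) = int i" if "1 \<le> i" "i \<le> n" for i
      using that by (cases "i = n") auto
    show "\<sigma> = id"
    proof
      fix k
      consider "\<bar>k\<bar> > int n" | "k = 0" | "k = int (nat k)" "1 \<le> nat k" "nat k \<le> n"
        | "k = - int (nat (- k))" "1 \<le> nat (- k)" "nat (- k) \<le> n" by linarith
      then show "\<sigma> k = id k"
      proof cases
        case 1 then show ?thesis using signed_perms_outside[OF \<sigma>B] by simp
      next
        case 2 then show ?thesis using signed_perms_zero[OF \<sigma>B] by simp
      next
        case 3 then show ?thesis using pos_fix[of "nat k"] by simp
      next
        case 4 then show ?thesis using pos_fix[of "nat (- k)"] type_B_inv(2)[OF \<sigma>B, of "- k"]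
          by (simp split: if_splits)
      qed
    qed
  qed
  with assms(2) that show ?thesis by blast
qed

lemma foldr_comp_snoc: "foldr (\<circ>) (gs @ [g]) id = foldr (\<circ>) gs id \<circ> g"
  by (induction gs) (simp_all add: comp_assoc)

lemma even_reduced_word:
  "\<sigma> \<in> even_signed_perms n \<Longrightarrow>
    \<exists>gs. length gs = inversions n \<sigma> \<and> set gs \<subseteq> type_D_generators n \<and> foldr (\<circ>) gs id = \<sigma>"
proof (induction "inversions n \<sigma>" arbitrary: \<sigma> rule: less_induct)
  case less
  show ?case
  proof (cases "\<sigma> = id")
    case True
    then show ?thesis by (intro exI[of _ "[]"]) (simp add: root_dist_def)
  next
    case False
    then obtain g where g: "g \<in> type_D_generators n" "inversions n \<sigma> = Suc (inversions n (\<sigma> \<circ> g))"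
      using descent[OF less.prems] by blast
    have "\<sigma> \<circ> g \<in> even_signed_perms n" by (rule comp_even[OF less.prems generator_even[OF g(1)]])
    with less.hyps[of "\<sigma> \<circ> g"] g(2) obtain gs where
      "length gs = inversions n (\<sigma> \<circ> g)" "set gs \<subseteq> type_D_generators n" "foldr (\<circ>) gs id = \<sigma> \<circ> g"
      by auto
    moreover have "\<sigma> \<circ> g \<circ> g = \<sigma>" by (simp add: comp_assoc generator_involution[OF g(1)])
    ultimately show ?thesis
      using g by (intro exI[of _ "gs @ [g]"]) (simp add: foldr_comp_snoc del: foldr_append)
  qed
qed

lemma word_even: "set gs \<subseteq> type_D_generators n \<Longrightarrow> foldr (\<circ>) gs id \<in> even_signed_perms n"
  by (induction gs) (simp_all add: id_even comp_even generator_even)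

lemma inversions_word_le:
  "set gs \<subseteq> type_D_generators n \<Longrightarrow> inversions n (foldr (\<circ>) gs id) \<le> length gs"
proof (induction gs rule: rev_induct)
  case Nil
  then show ?case by (simp add: root_dist_def)
next
  case (snoc g gs)
  then have "foldr (\<circ>) gs id \<in> signed_perms n"
    using word_even[of gs n] even_signed_permsD(1) by simp
  then have "inversions n (foldr (\<circ>) gs id \<circ> g) \<le> Suc (inversions n (foldr (\<circ>) gs id))"
    using snoc.prems by (intro inversions_comp_generator) simp_all
  also have "inversions n (foldr (\<circ>) gs id) \<le> length gs"
    by (rule snoc.IH) (use snoc.prems in simp)
  finally show ?case by (simp only: foldr_comp_snoc length_append_singleton Suc_le_mono)
qed

text \<open>
  Descents produce a word with as many letters as there are inversions; a shorter one is
  impossible because one letter adds at most one inversion.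
\<close>

theorem type_D_length_eq_inversions:
  assumes "\<sigma> \<in> even_signed_perms n"
  shows "type_D_length n \<sigma> = inversions n \<sigma>"
  unfolding type_D_length_def
  by (rule Least_equality) (use even_reduced_word[OF assms] inversions_word_le in auto)

lemma group_type_B: "group (type_B_group n)"
proof (rule groupI)
  fix \<sigma> assume \<sigma>: "\<sigma> \<in> signed_perms n"
  show "\<exists>\<tau>\<in>signed_perms n. \<tau> \<otimes>\<^bsub>type_B_group n\<^esub> \<sigma> = \<one>\<^bsub>type_B_group n\<^esub>"
    using inv_signed_perms[OF \<sigma>] inv_comp_signed_perms(2)[OF \<sigma>]
    by (intro bexI[of _ "inv_into UNIV \<sigma>"]) (simp_all add: type_B_group_def)
qed (use comp_signed_perms id_signed_perms in \<open>auto simp: type_B_group_def comp_assoc\<close>)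

theorem type_D_eq_even: "type_D n = even_signed_perms n"
proof
  interpret group "type_B_group n" by (rule group_type_B)
  have mult: "\<sigma> \<otimes>\<^bsub>type_B_group n\<^esub> \<tau> = \<sigma> \<circ> \<tau>" and one: "\<one>\<^bsub>type_B_group n\<^esub> = id" for \<sigma> \<tau>
    by (simp_all add: type_B_group_def)
  show "type_D n \<subseteq> even_signed_perms n"
  proof
    fix \<sigma> assume "\<sigma> \<in> type_D n"
    then show "\<sigma> \<in> even_signed_perms n"
      unfolding type_D_def
    proof (induction rule: generate.induct)
      case (inv g)
      have "inv\<^bsub>type_B_group n\<^esub> g = g"
        using generator_involution[OF inv] even_signed_permsD(1)[OF generator_even[OF inv]]
        by (intro inv_equality) (simp_all add: mult one)
      then show ?case using generator_even[OF inv] by simp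
    next
      case (eng \<sigma> \<tau>)
      then show ?case unfolding mult by (intro comp_even)
    qed (simp_all only: one id_even generator_even)
  qed
  show "even_signed_perms n \<subseteq> type_D n"
  proof
    fix \<sigma> assume "\<sigma> \<in> even_signed_perms n"
    then obtain gs where gs: "set gs \<subseteq> type_D_generators n" "foldr (\<circ>) gs id = \<sigma>"
      using even_reduced_word by blast
    have "foldr (\<circ>) gs id \<in> type_D n" using gs(1)
    proof (induction gs)
      case Nil
      show ?case using generate.one[of "type_B_group n"] by (simp add: type_D_def one id_def)
    next
      case (Cons g gs)
      have "g \<in> generate (type_B_group n) (type_D_generators n)"
        using Cons.prems by (intro generate.incl) simp
      moreover have "foldr (\<circ>) gs id \<in> type_D n"
        by (rule Cons.IH) (use Cons.prems in simp)
      ultimately have "g \<circ> foldr (\<circ>) gs id \<in> type_D n"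
        unfolding type_D_def using generate.eng mult by metis
      moreover have "foldr (\<circ>) (g # gs) id = g \<circ> foldr (\<circ>) gs id" by simp
      ultimately show ?case by (simp only:)
    qed
    with gs show "\<sigma> \<in> type_D n" by simp
  qed
qed

section \<open>Factoring out the stabilizer of the first position\<close>

lemma signed_perms_bijI:
  assumes "\<sigma> \<circ> \<tau> = id" "\<tau> \<circ> \<sigma> = id" "\<And>k. \<sigma> (- k) = - \<sigma> k" "\<And>k. \<bar>k\<bar> > int n \<Longrightarrow> \<sigma> k = k"
  shows "\<sigma> \<in> signed_perms n"
proof (rule signed_permsI)
  have "bij \<sigma>" using assms(1,2) by (rule o_bij[rotated])
  moreover have "\<sigma> k = k" if "k \<notin> signed_points n" for k
  proof (cases "k = 0")
    case True
    then show ?thesis using assms(3)[of 0] by simp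
  next
    case False
    with that have "\<bar>k\<bar> > int n" by (auto simp: signed_points_def)
    then show ?thesis by (rule assms(4))
  qed
  ultimately show "\<sigma> permutes signed_points n" by (simp add: permutes_def bij_iff)
qed (rule assms(3))

text \<open>
  These two maps move the signed positions one step away from the origin and back.  They identify the
  positions \<plusminus>1, \<dots>, \<plusminus>n with \<plusminus>2, \<dots>, \<plusminus>(n+1), and so embed the group on n positions as the
  stabilizer of the first of n+1 positions.
\<close>

definition outward :: "int \<Rightarrow> int" where
  "outward k = k + sgn k"

definition inward :: "int \<Rightarrow> int" where
  "inward k = k - sgn k"

definition shift :: "(int \<Rightarrow> int) \<Rightarrow> int \<Rightarrow> int" where
  "shift \<tau> k = (if \<bar>k\<bar> \<le> 1 then k else outward (\<tau> (inward k)))"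

lemma outward_minus: "outward (- k) = - outward k"
  and inward_minus: "inward (- k) = - inward k"
  by (simp_all add: outward_def inward_def sgn_minus)

lemma inward_outward [simp]: "inward (outward k) = k"
  by (auto simp: inward_def outward_def sgn_if)

lemma outward_inward: "\<bar>k\<bar> \<noteq> 1 \<Longrightarrow> outward (inward k) = k"
  by (auto simp: inward_def outward_def sgn_if)

lemma abs_outward: "k \<noteq> 0 \<Longrightarrow> \<bar>outward k\<bar> = \<bar>k\<bar> + 1"
  by (auto simp: outward_def sgn_if)

lemma abs_inward: "k \<noteq> 0 \<Longrightarrow> \<bar>inward k\<bar> = \<bar>k\<bar> - 1"
  by (auto simp: inward_def sgn_if)

lemma inward_nz: "\<bar>k\<bar> > 1 \<Longrightarrow> inward k \<noteq> 0"
  by (auto simp: inward_def sgn_if)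

lemma outward_neg_iff: "outward k < 0 \<longleftrightarrow> k < 0"
  by (auto simp: outward_def sgn_if)

lemma neg_root_outward: 
  "a \<noteq> 0 \<Longrightarrow> b \<noteq> 0 \<Longrightarrow> neg_root (outward a) (outward b) \<longleftrightarrow> neg_root a b"
  unfolding neg_root_def by (simp add: abs_outward outward_neg_iff)

lemma sgn_outward [simp]: "sgn (outward k) = sgn k"
  by (auto simp: outward_def sgn_if)

lemma shift_comp:
  assumes "\<sigma> \<in> signed_perms n" "\<tau> \<in> signed_perms n"
  shows "shift \<sigma> \<circ> shift \<tau> = shift (\<sigma> \<circ> \<tau>)"
proof
  fix k
  show "(shift \<sigma> \<circ> shift \<tau>) k = shift (\<sigma> \<circ> \<tau>) k"
  proof (cases "\<bar>k\<bar> \<le> 1")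
    case False
    then have "inward k \<noteq> 0" by (simp add: inward_nz)
    then have "\<tau> (inward k) \<noteq> 0"
      using signed_perms_inj[OF assms(2), of _ 0] signed_perms_zero[OF assms(2)] by simp
    then have "\<not> \<bar>outward (\<tau> (inward k))\<bar> \<le> 1" by (simp add: abs_outward)
    with False show ?thesis by (simp add: shift_def)
  qed (simp add: shift_def)
qed

lemma shift_id: "shift id = id"
  by (auto simp: shift_def outward_inward fun_eq_iff)

lemma shift_minus: 
  "\<tau> \<in> signed_perms n \<Longrightarrow> shift \<tau> (- k) = - shift \<tau> k"
  by (simp add: shift_def inward_minus outward_minus type_B_inv(2))

lemma shift_signed_perms:
  assumes "\<tau> \<in> signed_perms n"
  shows "shift \<tau> \<in> signed_perms (Suc n)"
proof (rule signed_perms_bijI)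
  show "shift \<tau> \<circ> shift (inv_into UNIV \<tau>) = id" "shift (inv_into UNIV \<tau>) \<circ> shift \<tau> = id"
    by (simp_all only: shift_comp[OF assms inv_signed_perms[OF assms]]
        shift_comp[OF inv_signed_perms[OF assms] assms] inv_comp_signed_perms[OF assms] shift_id)
  show "shift \<tau> (- k) = - shift \<tau> k" for k by (rule shift_minus[OF assms])
  show "shift \<tau> k = k" if "\<bar>k\<bar> > int (Suc n)" for k
    using that signed_perms_outside[OF assms, of "inward k"]
    by (auto simp: shift_def abs_inward outward_inward)
qed

lemma inv_shift:
  assumes "\<tau> \<in> signed_perms n"
  shows "inv_into UNIV (shift \<tau>) = shift (inv_into UNIV \<tau>)"
  by (rule inv_unique_comp)
    (simp_all only: shift_comp[OF assms inv_signed_perms[OF assms]]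
        shift_comp[OF inv_signed_perms[OF assms] assms] inv_comp_signed_perms[OF assms] shift_id)

lemma sign_product_shift: "sign_product (Suc n) (shift \<tau>) = sign_product n \<tau>"
proof -
  have *: "{1..int (Suc n)} = insert 1 ((\<lambda>k. k + 1) ` {1..int n})"
    by (auto simp: image_iff)
  have "sgn (shift \<tau> (k + 1)) = sgn (\<tau> k)" if "k \<in> {1..int n}" for k
    using that by (simp add: shift_def inward_def)
  moreover have "sign_product (Suc n) (shift \<tau>)
      = sgn (shift \<tau> 1) * (\<Prod>k\<in>(\<lambda>k. k + 1) ` {1..int n}. sgn (shift \<tau> k))"
    unfolding sign_product_def * by (rule prod.insert) auto
  moreover have "(\<Prod>k\<in>(\<lambda>k. k + 1) ` {1..int n}. sgn (shift \<tau> k)) = (\<Prod>k\<in>{1..int n}. sgn (shift \<tau> (k + 1)))"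
    by (subst prod.reindex) (auto simp: inj_on_def)
  ultimately show ?thesis
    by (simp add: sign_product_def shift_def[of _ 1])
qed

lemma shift_even: "\<tau> \<in> even_signed_perms n \<Longrightarrow> shift \<tau> \<in> even_signed_perms (Suc n)"
  by (simp add: even_signed_perms_def shift_signed_perms sign_product_shift)

lemma shift_inject: "shift \<sigma> = shift \<tau> \<Longrightarrow> \<sigma> 0 = \<tau> 0 \<Longrightarrow> \<sigma> = \<tau>"
proof
  fix k
  assume eq: "shift \<sigma> = shift \<tau>" "\<sigma> 0 = \<tau> 0"
  show "\<sigma> k = \<tau> k"
  proof (cases "k = 0")
    case False
    then have "outward (\<sigma> k) = outward (\<tau> k)"
      using fun_cong[OF eq(1), of "outward k"] by (simp add: shift_def abs_outward)
    then show ?thesis by (metis inward_outward)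
  qed (simp add: eq)
qed

lemma unshift:
  assumes \<sigma>: "\<sigma> \<in> signed_perms (Suc n)" "\<sigma> 1 = 1"
  obtains \<tau> where "\<tau> \<in> signed_perms n" "\<sigma> = shift \<tau>"
proof -
  define unshift where "unshift \<rho> = inward \<circ> \<rho> \<circ> outward" for \<rho> :: "int \<Rightarrow> int"
  have big: "\<bar>\<rho> (outward k)\<bar> \<noteq> 1" if "\<rho> \<in> signed_perms (Suc n)" "\<rho> 1 = 1" for \<rho> k
  proof -
    have "\<bar>outward k\<bar> \<noteq> \<bar>1\<bar>" by (cases "k = 0") (simp add: outward_def, simp add: abs_outward)
    then have "\<bar>\<rho> (outward k)\<bar> \<noteq> \<bar>\<rho> 1\<bar>" using signed_perms_abs_eq[OF that(1)] by blast
    then show ?thesis using that(2) by simp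
  qed
  let ?i = "inv_into UNIV \<sigma>"
  have i: "?i \<in> signed_perms (Suc n)" "?i 1 = 1"
    using inv_signed_perms[OF \<sigma>(1)] signed_perms_inverse(2)[OF \<sigma>(1), of 1] \<sigma>(2) by simp_all
  have "unshift \<sigma> \<in> signed_perms n"
  proof (rule signed_perms_bijI)
    show "unshift \<sigma> \<circ> unshift ?i = id" "unshift ?i \<circ> unshift \<sigma> = id"
      by (auto simp: fun_eq_iff unshift_def outward_inward big[OF i] big[OF \<sigma>] signed_perms_inverse[OF \<sigma>(1)])
    show "unshift \<sigma> (- k) = - unshift \<sigma> k" for k
      by (simp add: unshift_def outward_minus inward_minus type_B_inv(2)[OF \<sigma>(1)])
    show "unshift \<sigma> k = k" if "\<bar>k\<bar> > int n" for k
    proof -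
      have "\<bar>outward k\<bar> > int (Suc n)" using that by (subst abs_outward) auto
      then show ?thesis using signed_perms_outside[OF \<sigma>(1)] by (simp add: unshift_def)
    qed
  qed
  moreover have "\<sigma> = shift (unshift \<sigma>)"
  proof
    fix k :: int
    have "k = 0 \<or> k = 1 \<or> k = - 1 \<or> \<bar>k\<bar> > 1" by arith
    then consider "k = 0" | "k = 1" | "k = - 1" | "\<bar>k\<bar> > 1" by blast
    then show "\<sigma> k = shift (unshift \<sigma>) k"
    proof cases
      case 4
      then show ?thesis using big[OF \<sigma>, of "inward k"]
        by (simp add: shift_def unshift_def outward_inward)
    qed (use signed_perms_zero[OF \<sigma>(1)] \<sigma>(2) type_B_inv(2)[OF \<sigma>(1), of 1] in \<open>auto simp: shift_def\<close>)
  qed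
  ultimately show ?thesis using that by blast
qed

text \<open>
  The effect on positions of taking the letter with list index k to the front of a word while
  the other letters keep their order.
\<close>

definition move_front :: "nat \<Rightarrow> int \<Rightarrow> int" where
  "move_front k j = (if \<bar>j\<bar> = int k + 1 then sgn j else if \<bar>j\<bar> \<le> int k then outward j else j)"

definition move_back :: "nat \<Rightarrow> int \<Rightarrow> int" where
  "move_back k j = (if \<bar>j\<bar> = 1 then sgn j * (int k + 1) else if \<bar>j\<bar> \<le> int k + 1 then inward j else j)"

text \<open>
  A single sign change is odd; this pairs the sign change of the first position with one of the last
  position, whose sign has no influence on the number of inversions.
\<close>

definition flip_ends :: "nat \<Rightarrow> int \<Rightarrow> int" where
  "flip_ends n j = (if \<bar>j\<bar> = 1 \<or> \<bar>j\<bar> = int n then - j else j)"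

lemma move_front_back: "move_front k \<circ> move_back k = id" "move_back k \<circ> move_front k = id"
proof -
  show "move_front k \<circ> move_back k = id"
  proof
    fix j :: int
    have "j = 0 \<or> \<bar>j\<bar> = 1 \<or> \<bar>j\<bar> > 1" by arith
    then consider "j = 0" | "\<bar>j\<bar> = 1" | "\<bar>j\<bar> > 1" by blast
    then show "(move_front k \<circ> move_back k) j = id j"
    proof cases
      case 2
      then have "j = 1 \<or> j = - 1" by arith
      then show ?thesis by (auto simp: move_front_def move_back_def)
    next
      case 3
      then show ?thesis
        by (simp add: move_front_def move_back_def outward_inward abs_inward)
    qed (simp add: move_front_def move_back_def inward_def outward_def)
  qed
  show "move_back k \<circ> move_front k = id"
  proof
    fix j :: int
    consider "j = 0" | "\<bar>j\<bar> = int k + 1" | "j \<noteq> 0" "\<bar>j\<bar> \<noteq> int k + 1" by blast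
    then show "(move_back k \<circ> move_front k) j = id j"
    proof cases
      case 2
      then have "j \<noteq> 0" "sgn j * (int k + 1) = j" by (auto, metis sgn_mult_abs)
      with 2 show ?thesis by (simp add: move_front_def move_back_def abs_sgn_eq)
    next
      case 3
      then show ?thesis
        by (simp add: move_front_def move_back_def abs_outward)
    qed (simp add: move_front_def move_back_def inward_def outward_def)
  qed
qed

lemma move_front_even:
  assumes "k < n"
  shows "move_front k \<in> even_signed_perms n"
proof -
  have "move_front k \<in> signed_perms n"
    by (rule signed_perms_bijI[OF move_front_back])
      (use assms in \<open>auto simp: move_front_def outward_minus sgn_minus\<close>)
  moreover have "sgn (move_front k j) = 1" if "j \<in> {1..int n}" for j
    using that by (simp add: move_front_def)
  ultimately show ?thesis by (simp add: even_signed_perms_def sign_product_def)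
qed

lemma flip_ends_involution: "flip_ends n \<circ> flip_ends n = id"
  by (auto simp: flip_ends_def fun_eq_iff)

lemma flip_ends_even:
  assumes "2 \<le> n"
  shows "flip_ends n \<in> even_signed_perms n"
proof -
  have "flip_ends n \<in> signed_perms n"
    by (rule signed_perms_bijI[OF flip_ends_involution flip_ends_involution])
      (use assms in \<open>auto simp: flip_ends_def\<close>)
  moreover have *: "{1..int n} = insert 1 (insert (int n) {2..<int n})" using assms by auto
  have "sgn (flip_ends n j) = 1" if "j \<in> {2..<int n}" for j
    using that by (simp add: flip_ends_def)
  then have "sign_product n (flip_ends n) = 1"
    unfolding sign_product_def * using assms by (simp add: flip_ends_def)
  ultimately show ?thesis by (simp add: even_signed_perms_def)
qed

text \<open>
  The representative of minimal length of the elements that send the position k + 1, or its negative if c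
  holds, to the first position.
\<close>

definition coset_rep :: "nat \<Rightarrow> nat \<Rightarrow> bool \<Rightarrow> int \<Rightarrow> int" where
  "coset_rep n k c = (if c then flip_ends n \<circ> move_front k else move_front k)"

definition coset_rep_inv :: "nat \<Rightarrow> nat \<Rightarrow> bool \<Rightarrow> int \<Rightarrow> int" where
  "coset_rep_inv n k c = (if c then move_back k \<circ> flip_ends n else move_back k)"

lemma coset_rep_inverse:
  "coset_rep n k c \<circ> coset_rep_inv n k c = id" "coset_rep_inv n k c \<circ> coset_rep n k c = id"
proof -
  have "flip_ends n (move_front k (move_back k (flip_ends n j))) = j"
    and "move_back k (flip_ends n (flip_ends n (move_front k j))) = j"
    and "move_front k (move_back k j) = j"
    and "move_back k (move_front k j) = j" for j
    using move_front_back flip_ends_involution by (auto simp: fun_eq_iff)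
  then show "coset_rep n k c \<circ> coset_rep_inv n k c = id" "coset_rep_inv n k c \<circ> coset_rep n k c = id"
    by (auto simp: coset_rep_def coset_rep_inv_def fun_eq_iff)
qed

lemma inv_coset_rep: "inv_into UNIV (coset_rep n k c) = coset_rep_inv n k c"
  by (rule inv_unique_comp[OF coset_rep_inverse])

lemma inv_coset_rep_inv: "inv_into UNIV (coset_rep_inv n k c) = coset_rep n k c"
  by (rule inv_unique_comp[OF coset_rep_inverse(2,1)])

lemma coset_rep_even:
  assumes "k < n" "c \<Longrightarrow> 2 \<le> n"
  shows "coset_rep n k c \<in> even_signed_perms n" "coset_rep_inv n k c \<in> even_signed_perms n"
proof -
  show "coset_rep n k c \<in> even_signed_perms n"
    using assms by (simp add: coset_rep_def move_front_even flip_ends_even comp_even)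
  then show "coset_rep_inv n k c \<in> even_signed_perms n"
    using inv_even inv_coset_rep by metis
qed

lemma coset_rep_inv_1: "coset_rep_inv n k c 1 = (if c then - (int k + 1) else int k + 1)"
  by (simp add: coset_rep_inv_def move_back_def flip_ends_def)

text \<open>
  Bringing the position k + 1 to the front takes k steps.  The position -(k + 1)
  has to travel through the far end first, past all the other positions.
\<close>

definition coset_length :: "nat \<Rightarrow> nat \<Rightarrow> bool \<Rightarrow> nat" where
  "coset_length n k c = (if c then 2 * n - 2 - k else k)"

text \<open>
  The roots with leading term e(1) that the inverse of the representative makes negative; they make up
  its length.
\<close>

lemma card_neg_root_coset_rep:
  assumes "k < n" "c \<Longrightarrow> 2 \<le> n"
  shows "card {b. 2 \<le> \<bar>b\<bar> \<and> \<bar>b\<bar> \<le> int n \<and> neg_root (coset_rep_inv n k c 1) (coset_rep_inv n k c b)}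
    = coset_length n k c"
proof (cases c)
  case False
  have "neg_root (int k + 1) (move_back k b) \<longleftrightarrow> - (int k + 1) \<le> b \<and> b \<le> - 2" if "2 \<le> \<bar>b\<bar>" for b
    using that by (auto simp: neg_root_def move_back_def inward_def sgn_if)
  then have "{b. 2 \<le> \<bar>b\<bar> \<and> \<bar>b\<bar> \<le> int n \<and> neg_root (int k + 1) (move_back k b)}
      = {- (int k + 1)..- 2}"
    using assms(1) by auto
  then show ?thesis
    using False coset_rep_inv_1[of n k c] by (simp add: coset_rep_inv_def coset_length_def)
next
  case True
  then have n: "2 \<le> n" using assms by simp
  have eq: "neg_root (- (int k + 1)) (move_back k (flip_ends n b)) \<longleftrightarrow>
      b = int n \<or> b = - int n \<and> int k + 1 < int n \<or> b \<noteq> - int n \<and> b < 0 \<or> int k + 1 < b"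
    if "2 \<le> \<bar>b\<bar>" "\<bar>b\<bar> \<le> int n" for b
  proof -
    have "b = int n \<or> b = - int n \<or> \<bar>b\<bar> < int n" using that by arith
    then consider "b = int n" | "b = - int n" | "\<bar>b\<bar> < int n" by blast
    then show ?thesis
    proof cases
      case 1
      then show ?thesis using n that by (auto simp: neg_root_def move_back_def flip_ends_def inward_def)
    next
      case 2
      then show ?thesis using n that assms(1) by (auto simp: neg_root_def move_back_def flip_ends_def inward_def)
    next
      case 3
      then show ?thesis using n that by (auto simp: neg_root_def move_back_def flip_ends_def inward_def sgn_if)
    qed
  qed
  let ?A = "{b. 2 \<le> \<bar>b\<bar> \<and> \<bar>b\<bar> \<le> int n \<and> neg_root (- (int k + 1)) (move_back k (flip_ends n b))}"
  have "card ?A = 2 * n - 2 - k"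
  proof (cases "Suc k = n")
    case True
    \<comment> \<open>If the last position itself is moved, the sign change at the end exchanges its two roots.\<close>
    have "?A = insert (int n) {- (int n - 1)..- 2}"
    proof (rule Set.set_eqI)
      fix b
      show "b \<in> ?A \<longleftrightarrow> b \<in> insert (int n) {- (int n - 1)..- 2}"
      proof (cases "2 \<le> \<bar>b\<bar> \<and> \<bar>b\<bar> \<le> int n")
        case range: True
        then show ?thesis using eq[of b] n True by auto
      next
        case False
        then show ?thesis using n by auto
      qed
    qed
    then show ?thesis using True n by (simp add: nat_diff_distrib)
  next
    case False
    \<comment> \<open>Every index beyond k + 1 counts with both signs, every other one with the negative sign only.\<close>
    have "?A = {- int n..- 2} \<union> {int k + 2..int n}"
    proof (rule Set.set_eqI)
      fix b
      show "b \<in> ?A \<longleftrightarrow> b \<in> {- int n..- 2} \<union> {int k + 2..int n}"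
      proof (cases "2 \<le> \<bar>b\<bar> \<and> \<bar>b\<bar> \<le> int n")
        case range: True
        then show ?thesis using eq[of b] n False assms(1) by auto
      next
        case False
        then show ?thesis using n by auto
      qed
    qed
    moreover have "card ({- int n..- 2} \<union> {int k + 2..int n}) = card {- int n..- 2} + card {int k + 2..int n}"
      by (rule card_Un_disjoint) auto
    ultimately show ?thesis using False assms(1) n by auto
  qed
  then show ?thesis
    using True coset_rep_inv_1[of n k c] by (simp add: coset_rep_inv_def coset_length_def)
qed

text \<open>
  The letters that are not moved to the front keep their relative order, and of their signs at most the one at
  the last position changes; the sign of the last term never decides the sign of a root.
\<close>

lemma coset_rep_pos_root:
  assumes "k < n" "c \<Longrightarrow> 2 \<le> n" "2 \<le> a" "a < \<bar>b\<bar>" "\<bar>b\<bar> \<le> int n"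
  shows "\<not> neg_root (coset_rep_inv n k c a) (coset_rep_inv n k c b)"
proof -
  have "flip_ends n a = a" using assms by (simp add: flip_ends_def)
  then have "coset_rep_inv n k c a = move_back k a" by (simp add: coset_rep_inv_def)
  then have a: "coset_rep_inv n k c a = (if a \<le> int k + 1 then a - 1 else a)"
    using assms by (simp add: move_back_def inward_def)
  have "\<bar>coset_rep_inv n k c b\<bar> = \<bar>move_back k b\<bar>"
    using assms by (auto simp: coset_rep_inv_def flip_ends_def move_back_def inward_minus)
  also have "\<dots> = (if \<bar>b\<bar> \<le> int k + 1 then \<bar>b\<bar> - 1 else \<bar>b\<bar>)"
    using assms by (simp add: move_back_def abs_inward)
  finally show ?thesis using a assms by (simp add: neg_root_def split: if_splits)
qed

text \<open>
  An element of the stabilizer makes only roots without e(1) negative, and the inverse of the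
  representative only roots with e(1); so their sign patterns differ at the union of two disjoint sets.
\<close>

lemma inversions_shift_coset_rep:
  assumes \<tau>: "\<tau> \<in> signed_perms n" and k: "k < Suc n" "c \<Longrightarrow> 2 \<le> Suc n"
  shows "inversions (Suc n) (shift \<tau> \<circ> coset_rep (Suc n) k c) =
    inversions n \<tau> + coset_length (Suc n) k c"
proof -
  let ?r = "coset_rep_inv (Suc n) k c"
  let ?X = "{b. 2 \<le> \<bar>b\<bar> \<and> \<bar>b\<bar> \<le> int (Suc n) \<and> neg_root (?r 1) (?r b)}"
  let ?Y = "{(a, b) \<in> pos_roots n. neg_root (\<tau> a) (\<tau> b)}"
  let ?D = "{(a, b) \<in> pos_roots (Suc n). neg_root (shift \<tau> a) (shift \<tau> b) \<noteq> neg_root (?r a) (?r b)}"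
  have r: "?r \<in> signed_perms (Suc n)"
    using coset_rep_even[OF k] by (simp add: even_signed_permsD)
  have "inversions (Suc n) (shift \<tau> \<circ> inv_into UNIV ?r) = card ?D"
    by (subst inversions_comp_inv[OF shift_signed_perms[OF \<tau>] r]) (simp only: root_dist_def)
  moreover have "?D = Pair 1 ` ?X \<union> map_prod outward outward ` ?Y"
  proof (rule Set.set_eqI)
    fix p :: "int \<times> int"
    obtain a b where p: "p = (a, b)" by (cases p)
    consider "a \<le> 0" | "a = 1" | "2 \<le> a" by linarith
    then show "p \<in> ?D \<longleftrightarrow> p \<in> Pair 1 ` ?X \<union> map_prod outward outward ` ?Y"
    proof cases
      case 1
      then show ?thesis by (auto simp: p pos_roots_def outward_def)
    next
      case 2
      have "\<not> neg_root (shift \<tau> 1) (shift \<tau> b)" if b: "2 \<le> \<bar>b\<bar>" "\<bar>b\<bar> \<le> int (Suc n)"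
      proof -
        have "\<bar>shift \<tau> 1\<bar> \<noteq> \<bar>shift \<tau> b\<bar>" "shift \<tau> b \<noteq> 0"
          using signed_perms_abs_eq[OF shift_signed_perms[OF \<tau>], of 1 b] b
            signed_perms_range(1)[OF shift_signed_perms[OF \<tau>], of b] by auto
        moreover have "shift \<tau> 1 = 1" by (simp add: shift_def)
        ultimately show ?thesis by (auto simp: neg_root_def)
      qed
      then show ?thesis using 2 by (auto simp: p pos_roots_def outward_def)
    next
      case 3
      have "p \<in> ?D \<longleftrightarrow> a < \<bar>b\<bar> \<and> \<bar>b\<bar> \<le> int (Suc n) \<and> neg_root (shift \<tau> a) (shift \<tau> b)"
        using 3 coset_rep_pos_root[OF k 3] by (auto simp: p pos_roots_def)
      also have "\<dots> \<longleftrightarrow> (inward a, inward b) \<in> ?Y"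
      proof (cases "a < \<bar>b\<bar>")
        case True
        have "\<tau> (inward a) \<noteq> 0 \<and> \<tau> (inward b) \<noteq> 0"
          using signed_perms_inj[OF \<tau>, of _ 0] signed_perms_zero[OF \<tau>] 3 True by (simp add: inward_nz)
        then have "neg_root (shift \<tau> a) (shift \<tau> b) \<longleftrightarrow> neg_root (\<tau> (inward a)) (\<tau> (inward b))"
          using 3 True by (simp add: shift_def neg_root_outward)
        then show ?thesis
          using 3 True abs_inward[of b] by (auto simp: pos_roots_def inward_def[of a])
      next
        case False
        have "\<bar>inward b\<bar> \<le> \<bar>b\<bar> - 1 \<or> b = 0" by (auto simp: abs_inward)
        then show ?thesis using False 3 by (auto simp: pos_roots_def inward_def)
      qed
      also have "\<dots> \<longleftrightarrow> p \<in> map_prod outward outward ` ?Y"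
      proof
        assume *: "(inward a, inward b) \<in> ?Y"
        have "\<bar>b\<bar> \<noteq> 1"
        proof
          assume "\<bar>b\<bar> = 1"
          then have "b = 1 \<or> b = - 1" by arith
          with * show False by (auto simp: pos_roots_def inward_def)
        qed
        with 3 have "p = map_prod outward outward (inward a, inward b)"
          by (simp add: p outward_inward)
        with * show "p \<in> map_prod outward outward ` ?Y" by blast
      qed (auto simp: p)
      finally show ?thesis using 3 by (auto simp: p)
    qed
  qed
  moreover have "card (Pair 1 ` ?X \<union> map_prod outward outward ` ?Y) = card ?X + card ?Y"
  proof -
    have fX: "finite ?X" by (rule finite_subset[of _ "{- int (Suc n)..int (Suc n)}"]) auto
    have fY: "finite ?Y" by (rule finite_subset[OF _ finite_pos_roots[of n]]) auto
    have "card (Pair 1 ` ?X \<union> map_prod outward outward ` ?Y)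
        = card (Pair (1::int) ` ?X) + card (map_prod outward outward ` ?Y)"
      by (rule card_Un_disjoint) (use fX fY in \<open>auto simp: pos_roots_def outward_def\<close>)
    moreover have "card (Pair (1::int) ` ?X) = card ?X"
      by (rule card_image) (auto simp: inj_on_def)
    moreover have "card (map_prod outward outward ` ?Y) = card ?Y"
      by (rule card_image) (auto simp: inj_on_def dest: arg_cong[where f = inward])
    ultimately show ?thesis by simp
  qed
  ultimately show ?thesis
    using card_neg_root_coset_rep[OF k] inversions_eq[of n \<tau>] by (simp add: inv_coset_rep_inv)
qed

text \<open>
  On a single position the group is trivial, since the parity condition rules out the sign change.
\<close>

definition coset_signs :: "nat \<Rightarrow> bool set" where
  "coset_signs n = (if n < 2 then {False} else UNIV)"

text \<open>
  The representative of the coset of \<sigma> can be read off from the signed position that \<sigma> sends to the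
  first one.
\<close>

lemma bij_betw_even_coset:
  "bij_betw (\<lambda>((k, c), \<tau>). shift \<tau> \<circ> coset_rep (Suc n) k c)
     (({..<Suc n} \<times> coset_signs (Suc n)) \<times> even_signed_perms n) (even_signed_perms (Suc n))"
proof (rule bij_betw_imageI)
  let ?A = "({..<Suc n} \<times> coset_signs (Suc n)) \<times> even_signed_perms n"
  let ?f = "\<lambda>((k, c), \<tau>). shift \<tau> \<circ> coset_rep (Suc n) k c"
  have signs: "2 \<le> Suc n" if "c \<in> coset_signs (Suc n)" c for c
    using that by (auto simp: coset_signs_def split: if_splits)
  show "inj_on ?f ?A"
  proof (rule inj_onI, unfold split_paired_all)
    fix k c \<tau> k' c' \<tau>'
    assume "((k, c), \<tau>) \<in> ?A" "((k', c'), \<tau>') \<in> ?A" "?f ((k, c), \<tau>) = ?f ((k', c'), \<tau>')"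
    then have \<tau>: "\<tau> \<in> even_signed_perms n" "\<tau>' \<in> even_signed_perms n"
      and eq: "shift \<tau> \<circ> coset_rep (Suc n) k c = shift \<tau>' \<circ> coset_rep (Suc n) k' c'"
      by auto
    have one: "(shift \<rho> \<circ> coset_rep (Suc n) i d) (coset_rep_inv (Suc n) i d 1) = 1" for \<rho> i d
      using fun_cong[OF coset_rep_inverse(1), of "Suc n" i d 1] by (simp add: shift_def)
    have inj: "inj (shift \<tau> \<circ> coset_rep (Suc n) k c)"
      using \<tau>(1) coset_rep_inverse(2)[of "Suc n" k c] shift_signed_perms[OF even_signed_permsD(1)]
      by (intro inj_compose inj_on_inverseI[of _ "coset_rep_inv (Suc n) k c"] bij_is_inj[OF type_B_inv(1)])
        (auto simp: fun_eq_iff)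
    have "coset_rep_inv (Suc n) k c 1 = coset_rep_inv (Suc n) k' c' 1"
      using one[of \<tau> k c] one[of \<tau>' k' c'] inj unfolding eq[symmetric] by (metis injD)
    then have kc: "k = k'" "c = c'" by (auto simp: coset_rep_inv_1 split: if_splits)
    have "shift \<tau> \<circ> (coset_rep (Suc n) k c \<circ> coset_rep_inv (Suc n) k c)
        = shift \<tau>' \<circ> (coset_rep (Suc n) k c \<circ> coset_rep_inv (Suc n) k c)"
      using eq unfolding kc comp_assoc[symmetric] by simp
    then have "shift \<tau> = shift \<tau>'" by (simp only: coset_rep_inverse(1) comp_id)
    then have "\<tau> = \<tau>'"
      by (rule shift_inject)
        (simp only: signed_perms_zero[OF even_signed_permsD(1)[OF \<tau>(1)]]
          signed_perms_zero[OF even_signed_permsD(1)[OF \<tau>(2)]])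
    with kc show "((k, c), \<tau>) = ((k', c'), \<tau>')" by simp
  qed
  show "?f ` ?A = even_signed_perms (Suc n)"
  proof (intro Set.set_eqI iffI)
    fix \<sigma> assume "\<sigma> \<in> ?f ` ?A"
    then show "\<sigma> \<in> even_signed_perms (Suc n)"
      using signs by (auto intro!: comp_even shift_even coset_rep_even)
  next
    fix \<sigma> assume \<sigma>: "\<sigma> \<in> even_signed_perms (Suc n)"
    note \<sigma>B = even_signed_permsD(1)[OF \<sigma>]
    \<comment> \<open>This signed position determines the coset.\<close>
    define m where "m = inv_into UNIV \<sigma> 1"
    define k where "k = nat \<bar>m\<bar> - 1"
    have \<sigma>m: "\<sigma> m = 1" unfolding m_def by (rule signed_perms_inverse(1)[OF \<sigma>B])
    have m: "m \<noteq> 0" "\<bar>m\<bar> \<le> int (Suc n)"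
      unfolding m_def using signed_perms_range[OF inv_signed_perms[OF \<sigma>B], of 1] by simp_all
    then have k: "k < Suc n" "int k + 1 = \<bar>m\<bar>" by (auto simp: k_def)
    have c: "(m < 0) \<in> coset_signs (Suc n)"
    proof (cases "n = 0")
      case True
      then have "sgn (\<sigma> 1) = 1"
        using even_signed_permsD(2)[OF \<sigma>] by (simp add: sign_product_def)
      moreover have "m = 1 \<or> m = - 1" using m True by auto
      ultimately have "m = 1" using \<sigma>m type_B_inv(2)[OF \<sigma>B, of 1] by auto
      then show ?thesis by (simp add: coset_signs_def True)
    qed (simp add: coset_signs_def)
    note rep = coset_rep_even[OF k(1) signs[OF c]]
    let ?r = "coset_rep_inv (Suc n) k (m < 0)"
    have "?r 1 = m" using k m by (simp add: coset_rep_inv_1)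
    then have "(\<sigma> \<circ> ?r) 1 = 1" using \<sigma>m by simp
    moreover have even: "\<sigma> \<circ> ?r \<in> even_signed_perms (Suc n)" by (rule comp_even[OF \<sigma> rep(2)])
    ultimately obtain \<tau> where \<tau>: "\<tau> \<in> signed_perms n" "\<sigma> \<circ> ?r = shift \<tau>"
      using unshift[OF even_signed_permsD(1)[OF even]] by blast
    have "\<tau> \<in> even_signed_perms n"
      using \<tau> even by (simp add: even_signed_perms_def sign_product_shift)
    moreover have "\<sigma> = shift \<tau> \<circ> coset_rep (Suc n) k (m < 0)"
      unfolding \<tau>(2)[symmetric] comp_assoc coset_rep_inverse by simp
    ultimately show "\<sigma> \<in> ?f ` ?A"
      using k c by (intro image_eqI[of _ _ "((k, m < 0), \<tau>)"]) auto
  qed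
qed

subsection \<open>The action on words\<close>

definition delete_at :: "nat \<Rightarrow> 'a list \<Rightarrow> 'a list" where
  "delete_at k w = take k w @ drop (Suc k) w"

definition flip_last :: "('a \<Rightarrow> 'a) \<Rightarrow> 'a list \<Rightarrow> 'a list" where
  "flip_last J w = (if w = [] then [] else butlast w @ [J (last w)])"

lemma length_delete_at [simp]: "k < length w \<Longrightarrow> length (delete_at k w) = length w - 1"
  by (simp add: delete_at_def)

lemma length_flip_last [simp]: "length (flip_last J w) = length w"
  by (simp add: flip_last_def)

lemma flip_last_Cons: "w \<noteq> [] \<Longrightarrow> flip_last J (y # w) = y # flip_last J w"
  by (simp add: flip_last_def)

lemma nth_flip_last:
  "i < length w \<Longrightarrow> flip_last J w ! i = (if Suc i = length w then J (w ! i) else w ! i)"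
proof (cases "Suc i = length w")
  assume "i < length w"
  case True
  then have "i = length w - 1" "w \<noteq> []" by auto
  then show ?thesis by (simp add: flip_last_def nth_append last_conv_nth)
next
  assume "i < length w"
  case False
  then have "i < length w - 1" "w \<noteq> []" using \<open>i < length w\<close> by auto
  then show ?thesis using False by (simp add: flip_last_def nth_append nth_butlast)
qed

lemma delete_at_Cons: "delete_at 0 (y # w) = w" "delete_at (Suc k) (y # w) = y # delete_at k w"
  by (simp_all add: delete_at_def)

lemma act_word_shift:
  assumes "\<tau> \<in> signed_perms n" "length w = n"
  shows "act_word J (shift \<tau>) (y # w) = y # act_word J \<tau> w"
proof (rule nth_equalityI)
  fix i assume i: "i < length (act_word J (shift \<tau>) (y # w))"
  show "act_word J (shift \<tau>) (y # w) ! i = (y # act_word J \<tau> w) ! i"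
  proof (cases i)
    case 0
    then show ?thesis
      using i by (simp add: nth_act_word inv_shift[OF assms(1)] shift_def signed_letter_def del: upt_Suc)
  next
    case (Suc j)
    define m where "m = inv_into UNIV \<tau> (int j + 1)"
    have "m \<noteq> 0" unfolding m_def
      using signed_perms_range(1)[OF inv_signed_perms[OF assms(1)], of "int j + 1"] i Suc assms(2) by simp
    have "inv_into UNIV (shift \<tau>) (int i + 1) = outward m"
      unfolding inv_shift[OF assms(1)] m_def by (simp add: shift_def inward_def Suc add.commute)
    then have "act_word J (shift \<tau>) (y # w) ! i = signed_letter J (y # w) (outward m)"
      using i by (simp add: nth_act_word)
    also have "\<dots> = signed_letter J w m"
    proof -
      consider p where "m = int (Suc p)" | p where "m = - int (Suc p)"
        using \<open>m \<noteq> 0\<close> by (metis int_cases int_cases3 gr0_implies_Suc)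
      then show ?thesis
        by cases (simp_all add: signed_letter_def outward_def nat_add_distrib)
    qed
    also have "\<dots> = (y # act_word J \<tau> w) ! i"
      using i Suc assms(2) by (simp add: nth_act_word m_def)
    finally show ?thesis .
  qed
qed simp

lemma act_word_move_front:
  assumes "k < length w"
  shows "act_word J (move_front k) w = w ! k # delete_at k w"
proof (rule nth_equalityI)
  fix i assume i: "i < length (act_word J (move_front k) w)"
  have "inv_into UNIV (move_front k) = move_back k" by (rule inv_unique_comp[OF move_front_back])
  with i have "act_word J (move_front k) w ! i = signed_letter J w (move_back k (int i + 1))"
    by (simp add: nth_act_word)
  also have "\<dots> = (w ! k # delete_at k w) ! i"
  proof -
    consider "i = 0" | "0 < i" "i \<le> k" | "k < i" by linarith
    then show ?thesis
    proof cases
      case 1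
      then show ?thesis by (simp add: move_back_def signed_letter_def nat_add_distrib)
    next
      case 2
      then have "move_back k (int i + 1) = int i" by (simp add: move_back_def inward_def)
      moreover have "i - 1 < k" using 2 by linarith
      ultimately show ?thesis using 2 assms
        by (simp add: signed_letter_def delete_at_def nth_append nth_Cons')
    next
      case 3
      then have "move_back k (int i + 1) = int i + 1" by (simp add: move_back_def)
      moreover have "\<not> i - 1 < k" using 3 by linarith
      ultimately show ?thesis using 3 assms i
        by (simp add: signed_letter_def delete_at_def nth_append nth_Cons' nat_add_distrib min_def)
    qed
  qed
  finally show "act_word J (move_front k) w ! i = (w ! k # delete_at k w) ! i" .
qed (use assms in simp)

lemma act_word_flip_ends:
  assumes "w \<noteq> []"
  shows "act_word J (flip_ends (Suc (length w))) (y # w) = J y # flip_last J w"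
proof (rule nth_equalityI)
  let ?n = "Suc (length w)"
  fix i assume i: "i < length (act_word J (flip_ends ?n) (y # w))"
  have "inv_into UNIV (flip_ends ?n) = flip_ends ?n"
    by (rule inv_unique_comp[OF flip_ends_involution flip_ends_involution])
  with i have "act_word J (flip_ends ?n) (y # w) ! i = signed_letter J (y # w) (flip_ends ?n (int i + 1))"
    by (simp add: nth_act_word)
  also have "\<dots> = (J y # flip_last J w) ! i"
  proof -
    consider "i = 0" | "i = length w" "i > 0" | "0 < i" "i < length w" using i by fastforce
    then show ?thesis
      using assms i
      by cases (auto simp: flip_ends_def signed_letter_def nth_Cons' nth_flip_last nat_add_distrib)
  qed
  finally show "act_word J (flip_ends ?n) (y # w) ! i = (J y # flip_last J w) ! i" .
qed simp

lemma act_word_coset_rep: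
  assumes J: "\<And>x. J (J x) = x" and "k < length w" "c \<Longrightarrow> 2 \<le> length w"
  shows "act_word J (coset_rep (length w) k c) w =
    (if c then J (w ! k) # flip_last J (delete_at k w) else w ! k # delete_at k w)"
proof (cases c)
  case True
  then have 2: "2 \<le> length w" using assms by simp
  then have ne: "delete_at k w \<noteq> []" and len: "Suc (length (delete_at k w)) = length w"
    using assms(2) by (auto simp: delete_at_def)
  have "act_word J (flip_ends (length w) \<circ> move_front k) w
      = act_word J (flip_ends (length w)) (act_word J (move_front k) w)"
    by (rule act_word_comp[OF J even_signed_permsD(1)[OF flip_ends_even[OF 2]]
          even_signed_permsD(1)[OF move_front_even[OF assms(2)]] refl])
  also have "\<dots> = J (w ! k) # flip_last J (delete_at k w)"
    unfolding act_word_move_front[OF assms(2)] using act_word_flip_ends[OF ne] len by simp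
  finally show ?thesis using True by (simp add: coset_rep_def)
qed (simp add: coset_rep_def act_word_move_front[OF assms(2)])

section \<open>Positivity of the deformed inner product\<close>

subsection \<open>Gram kernels of words\<close>

lemma cinner_zero_right [simp]: "cinner x (0::'h::complex_hilbert_space) = 0"
  using cinner_add_right[of x 0 0] by simp

lemma cinner_sum_right: "cinner x (\<Sum>i\<in>I. f i :: 'h::complex_hilbert_space) = (\<Sum>i\<in>I. cinner x (f i))"
  by (induction I rule: infinite_finite_induct) (simp_all add: cinner_add_right)

lemma cinner_diff_right: "cinner x (y - z :: 'h::complex_hilbert_space) = cinner x y - cinner x z"
  using cinner_add_right[of x "y - z" z] by simp

lemma cinner_self: "cinner x x = complex_of_real ((norm (x::'h::complex_hilbert_space))\<^sup>2)"
proof -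
  have "Im (cinner x x) = 0"
    using arg_cong[OF cinner_commute[of x x], of Im] by simp
  then show ?thesis
    by (simp add: complex_eq_iff norm_eq_sqrt_cinner cinner_ge_zero)
qed

text \<open>
  Gram-Schmidt orthogonalization.
\<close>

lemma orthonormal_expansion:
  fixes S :: "'h::complex_hilbert_space set"
  assumes "finite S"
  shows "\<exists>E. finite E \<and> (\<forall>e\<in>E. \<forall>e'\<in>E. cinner e e' = (if e = e' then 1 else 0)) \<and>
    (\<forall>u\<in>S. u = (\<Sum>e\<in>E. cinner e u *\<^sub>C e))"
  using assms
proof (induction S)
  case empty
  show ?case by (intro exI[of _ "{}"]) simp
next
  case (insert x S)
  then obtain E where E: "finite E" "\<And>e e'. e \<in> E \<Longrightarrow> e' \<in> E \<Longrightarrow> cinner e e' = (if e = e' then 1 else 0)"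
    "\<And>u. u \<in> S \<Longrightarrow> u = (\<Sum>e\<in>E. cinner e u *\<^sub>C e)" by blast
  define p where "p = (\<Sum>e\<in>E. cinner e x *\<^sub>C e)"
  define r where "r = x - p"
  have Er: "cinner e r = 0" if "e \<in> E" for e
  proof -
    have "cinner e p = (\<Sum>e'\<in>E. if e = e' then cinner e x else 0)"
      unfolding p_def cinner_sum_right
      by (rule sum.cong[OF refl]) (simp add: cinner_scaleC_right E(2)[OF that])
    then show ?thesis using that E(1) by (simp add: r_def cinner_diff_right)
  qed
  show ?case
  proof (cases "r = 0")
    case True
    then have "x = p" by (simp add: r_def)
    then show ?thesis using E by (intro exI[of _ E]) (simp add: p_def)
  next
    case False
    define e0 where "e0 = complex_of_real (1 / norm r) *\<^sub>C r"
    have e0E: "cinner e e0 = 0" if "e \<in> E" for e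
      using Er[OF that] by (simp add: e0_def cinner_scaleC_right)
    have Ee0: "cinner e0 e = 0" if "e \<in> E" for e
      using e0E[OF that] cinner_commute[of e0 e] by simp
    have e0r: "cinner e0 r = norm r"
      using False by (simp add: e0_def cinner_scaleC_left cinner_self power2_eq_square)
    have e0e0: "cinner e0 e0 = 1"
      using False e0r by (subst (2) e0_def) (simp add: cinner_scaleC_right)
    have fresh: "e0 \<notin> E" using e0E e0e0 by force
    have "cinner e0 p = 0"
      unfolding p_def cinner_sum_right by (rule sum.neutral) (simp add: cinner_scaleC_right Ee0)
    then have e0x: "cinner e0 x = norm r"
      using e0r by (simp add: r_def cinner_diff_right)
    have "norm r *\<^sub>C e0 = r"
      using False by (simp add: e0_def scaleC_scaleC scaleC_one)
    then have "x = (\<Sum>e\<in>insert e0 E. cinner e x *\<^sub>C e)"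
      using E(1) fresh e0x by (simp add: r_def flip: p_def)
    moreover have "u = (\<Sum>e\<in>insert e0 E. cinner e u *\<^sub>C e)" if u: "u \<in> S" for u
    proof -
      have "cinner e0 u = 0"
        by (subst E(3)[OF u], unfold cinner_sum_right, rule sum.neutral) (simp add: cinner_scaleC_right Ee0)
      then show ?thesis using E(1) fresh E(3)[OF u] by simp
    qed
    ultimately show ?thesis
      using E(1,2) e0E Ee0 e0e0 fresh by (intro exI[of _ "insert e0 E"]) auto
  qed
qed

text \<open>
  On finitely many vectors the inner product is a finite sum of kernels of rank one.
\<close>

lemma parseval_family:
  fixes S :: "'h::complex_hilbert_space set"
  assumes "finite S"
  obtains E where "\<And>u v. u \<in> S \<Longrightarrow> v \<in> S \<Longrightarrow> cinner u v = (\<Sum>e\<in>E. cinner u e * cinner e v)"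
proof -
  obtain E where E: "\<And>u. u \<in> S \<Longrightarrow> u = (\<Sum>e\<in>E. cinner e u *\<^sub>C e)"
    using orthonormal_expansion[OF assms] by blast
  show ?thesis
  proof
    fix u v assume "u \<in> S" "v \<in> S"
    have "cinner u v = cinner u (\<Sum>e\<in>E. cinner e v *\<^sub>C e)"
      using E[OF \<open>v \<in> S\<close>] by simp
    also have "\<dots> = (\<Sum>e\<in>E. cinner u e * cinner e v)"
      by (simp add: cinner_sum_right cinner_scaleC_right mult.commute)
    finally show "cinner u v = (\<Sum>e\<in>E. cinner u e * cinner e v)" .
  qed
qed

lemma word_inner_Cons: "word_inner (x # u) (y # v) = cinner x y * word_inner u v"
  by (simp add: word_inner_def prod.lessThan_Suc_shift del: prod.lessThan_Suc)

lemma cnj_mult_self_nonneg: "0 \<le> cnj z * z"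
  by (simp add: less_eq_complex_def)

text \<open>
  The Gram kernel of words is the entrywise product of the Gram kernels of their letters, so this is
  a case of the Schur product theorem.  Decomposing the first kernel into kernels of rank one moves
  its factors into the coefficients and leaves words that are shorter by one letter.
\<close>

lemma word_inner_positive:
  fixes w :: "'i \<Rightarrow> 'h::complex_hilbert_space list"
  assumes "finite I" "\<And>i. i \<in> I \<Longrightarrow> length (w i) = n"
  shows "0 \<le> (\<Sum>i\<in>I. \<Sum>j\<in>I. cnj (c i) * c j * word_inner (w i) (w j))"
  using assms(2)
proof (induction n arbitrary: w c)
  case 0
  then have "(\<Sum>i\<in>I. \<Sum>j\<in>I. cnj (c i) * c j * word_inner (w i) (w j))
      = (\<Sum>i\<in>I. \<Sum>j\<in>I. cnj (c i) * c j)"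
    by (intro sum.cong refl) (simp add: word_inner_def)
  also have "\<dots> = cnj (\<Sum>i\<in>I. c i) * (\<Sum>j\<in>I. c j)"
    by (simp add: sum_product)
  also have "0 \<le> \<dots>" by (rule cnj_mult_self_nonneg)
  finally show ?case .
next
  case (Suc n)
  obtain E where E: "\<And>u v. u \<in> (hd \<circ> w) ` I \<Longrightarrow> v \<in> (hd \<circ> w) ` I \<Longrightarrow>
      cinner u v = (\<Sum>e\<in>E. cinner u e * cinner e v)"
    using parseval_family[of "(hd \<circ> w) ` I"] assms(1) by blast
  define d where "d e i = c i * cinner e (hd (w i))" for e i
  have "cnj (c i) * c j * word_inner (w i) (w j)
      = (\<Sum>e\<in>E. cnj (d e i) * d e j * word_inner (tl (w i)) (tl (w j)))"
    if ij: "i \<in> I" "j \<in> I" for i j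
  proof -
    have "w i = hd (w i) # tl (w i)" "w j = hd (w j) # tl (w j)"
      using Suc.prems[OF ij(1)] Suc.prems[OF ij(2)] by (metis list.collapse list.size(3) nat.simps(3))+
    then have "word_inner (w i) (w j) = cinner (hd (w i)) (hd (w j)) * word_inner (tl (w i)) (tl (w j))"
      using word_inner_Cons by metis
    also have "cinner (hd (w i)) (hd (w j)) = (\<Sum>e\<in>E. cinner (hd (w i)) e * cinner e (hd (w j)))"
      using ij by (intro E) auto
    also have "\<dots> = (\<Sum>e\<in>E. cnj (cinner e (hd (w i))) * cinner e (hd (w j)))"
      using cinner_commute by metis
    finally show ?thesis
      by (simp add: d_def sum_distrib_left sum_distrib_right mult_ac)
  qed
  then have "(\<Sum>i\<in>I. \<Sum>j\<in>I. cnj (c i) * c j * word_inner (w i) (w j))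
      = (\<Sum>i\<in>I. \<Sum>j\<in>I. \<Sum>e\<in>E. cnj (d e i) * d e j * word_inner (tl (w i)) (tl (w j)))"
    by (intro sum.cong refl) 
  also have "\<dots> = (\<Sum>i\<in>I. \<Sum>e\<in>E. \<Sum>j\<in>I. cnj (d e i) * d e j * word_inner (tl (w i)) (tl (w j)))"
    by (intro sum.cong refl sum.swap)
  also have "\<dots> = (\<Sum>e\<in>E. \<Sum>i\<in>I. \<Sum>j\<in>I. cnj (d e i) * d e j * word_inner (tl (w i)) (tl (w j)))"
    by (rule sum.swap)
  also have "0 \<le> \<dots>"
    using Suc.prems by (intro sum_nonneg Suc.IH) simp
  finally show ?case .
qed

subsection \<open>The deformed kernel on words\<close>

text \<open>
  The deformed inner product of two simple tensors.
\<close>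

definition word_form :: "('h::complex_hilbert_space \<Rightarrow> 'h) \<Rightarrow> real \<Rightarrow> 'h list \<Rightarrow> 'h list \<Rightarrow> complex" where
  "word_form J q u v = (\<Sum>\<sigma>\<in>even_signed_perms (length v).
     complex_of_real (q ^ inversions (length v) \<sigma>) * word_inner u (act_word J \<sigma> v))"

lemma finite_even_signed_perms [simp]: "finite (even_signed_perms n)"
proof (rule finite_subset)
  show "even_signed_perms n \<subseteq> {\<sigma>. \<sigma> permutes signed_points n}"
    using signed_perms_permutes even_signed_permsD(1) by blast
  show "finite {\<sigma>. \<sigma> permutes signed_points n}"
    by (rule finite_permutations) (simp add: signed_points_def)
qed

lemma word_inner_length: "length u \<noteq> length v \<Longrightarrow> word_inner u v = 0"
  by (simp add: word_inner_def)

lemma word_form_length: "length u \<noteq> length v \<Longrightarrow> word_form J q u v = 0"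
  by (simp add: word_form_def word_inner_length)

text \<open>
  Signed permutations act by unitary operators, because J is a selfadjoint involution.
\<close>

lemma word_inner_act_word:
  assumes J: "selfadjoint_involution J" and \<sigma>: "\<sigma> \<in> signed_perms n"
    and len: "length u = n" "length v = n"
  shows "word_inner (act_word J \<sigma> u) (act_word J \<sigma> v) = word_inner u v"
proof -
  let ?s = "inv_into UNIV \<sigma>"
  let ?F = "\<lambda>k. cinner (u ! (nat k - 1)) (v ! (nat k - 1))"
  have JJ: "cinner (J a) (J b) = cinner a b" for a b
    using J by (simp add: selfadjoint_involution_def)
  have letter: "cinner (signed_letter J u k) (signed_letter J v k) = ?F \<bar>k\<bar>" for k
    by (simp add: signed_letter_def JJ)
  have nat: "bij_betw (\<lambda>i. int i + 1) {..<n} {1..int n}"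
    by (rule bij_betw_byWitness[where f' = "\<lambda>k. nat k - 1"]) auto
  have "word_inner (act_word J \<sigma> u) (act_word J \<sigma> v) = (\<Prod>i<n. ?F \<bar>?s (int i + 1)\<bar>)"
    using len by (simp add: word_inner_def nth_act_word letter)
  also have "\<dots> = (\<Prod>k\<in>{1..int n}. ?F \<bar>?s k\<bar>)"
    by (rule prod.reindex_bij_betw[OF nat])
  also have "\<dots> = (\<Prod>k\<in>{1..int n}. ?F k)"
    by (rule prod.reindex_bij_betw[OF bij_abs_signed_perm[OF inv_signed_perms[OF \<sigma>]]])
  also have "\<dots> = (\<Prod>i<n. ?F (int i + 1))"
    by (rule prod.reindex_bij_betw[OF nat, symmetric])
  also have "\<dots> = word_inner u v"
    using len by (simp add: word_inner_def nat_add_distrib)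
  finally show ?thesis .
qed

definition root_sign :: "(int \<Rightarrow> int) \<Rightarrow> int \<times> int \<Rightarrow> real" where
  "root_sign \<sigma> p = (if neg_root (\<sigma> (fst p)) (\<sigma> (snd p)) then - 1 else 1)"

text \<open>
  For signs s and t, the number (1 - q) / 2 * (s * t) + (1 + q) / 2 is 1 or q, depending on whether s and t
  agree.  Multiplying this out over all roots writes the kernel as a combination of kernels of rank one,
  with coefficients that are nonnegative for \<bar>q\<bar> \<le> 1.
\<close>

lemma power_root_dist:
  "q ^ root_dist n \<sigma> \<tau> = (\<Sum>A\<in>Pow (pos_roots n).
     ((1 - q) / 2) ^ card A * ((1 + q) / 2) ^ card (pos_roots n - A) *
     ((\<Prod>p\<in>A. root_sign \<sigma> p) * (\<Prod>p\<in>A. root_sign \<tau> p)))"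
proof -
  let ?P = "pos_roots n"
  let ?D = "{(a, b) \<in> ?P. neg_root (\<sigma> a) (\<sigma> b) \<noteq> neg_root (\<tau> a) (\<tau> b)}"
  have "q ^ root_dist n \<sigma> \<tau> = (\<Prod>p\<in>?P. if p \<in> ?D then q else 1)"
  proof -
    have "?P \<inter> ?D = ?D" by auto
    then have "(\<Prod>p\<in>?P. if p \<in> ?D then q else 1) = (\<Prod>p\<in>?D. q)"
      using prod.inter_restrict[of ?P "\<lambda>_. q" ?D] by simp
    then show ?thesis by (simp add: root_dist_def)
  qed
  also have "\<dots> = (\<Prod>p\<in>?P. (1 - q) / 2 * (root_sign \<sigma> p * root_sign \<tau> p) + (1 + q) / 2)"
    by (rule prod.cong[OF refl]) (auto simp: root_sign_def field_simps)
  also have "\<dots> = (\<Sum>A\<in>Pow ?P. (\<Prod>p\<in>A. (1 - q) / 2 * (root_sign \<sigma> p * root_sign \<tau> p)) *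
      (\<Prod>p\<in>?P - A. (1 + q) / 2))"
    by (rule prod_add) simp
  finally show ?thesis
    by (simp only: prod.distrib prod_constant mult_ac)
qed

text \<open>
  Averaging over the group replaces the function of one group element by a kernel in two of them, to
  which positive definiteness applies.
\<close>

lemma word_form_average:
  assumes J: "selfadjoint_involution J" and len: "length u = n" "length v = n"
  shows "of_nat (card (even_signed_perms n)) * word_form J q u v =
    (\<Sum>\<sigma>\<in>even_signed_perms n. \<Sum>\<tau>\<in>even_signed_perms n.
       complex_of_real (q ^ root_dist n (inv_into UNIV \<sigma>) (inv_into UNIV \<tau>)) *
       word_inner (act_word J \<sigma> u) (act_word J \<tau> v))"
proof -
  let ?G = "even_signed_perms n"
  have JJ: "\<And>x. J (J x) = x" using J by (simp add: selfadjoint_involution_def)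
  have "(\<Sum>\<tau>\<in>?G. complex_of_real (q ^ root_dist n (inv_into UNIV \<sigma>) (inv_into UNIV \<tau>)) *
       word_inner (act_word J \<sigma> u) (act_word J \<tau> v)) = word_form J q u v" if \<sigma>: "\<sigma> \<in> ?G" for \<sigma>
  proof -
    note \<sigma>B = even_signed_permsD(1)[OF \<sigma>]
    have "bij_betw (\<lambda>\<rho>. \<sigma> \<circ> \<rho>) ?G ?G"
    proof (rule bij_betw_byWitness[where f' = "\<lambda>\<tau>. inv_into UNIV \<sigma> \<circ> \<tau>"])
      show "\<forall>\<rho>\<in>?G. inv_into UNIV \<sigma> \<circ> (\<sigma> \<circ> \<rho>) = \<rho>" "\<forall>\<tau>\<in>?G. \<sigma> \<circ> (inv_into UNIV \<sigma> \<circ> \<tau>) = \<tau>"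
        by (auto simp: fun_eq_iff signed_perms_inverse[OF \<sigma>B])
    qed (use \<sigma> in \<open>auto intro!: comp_even inv_even\<close>)
    then have "(\<Sum>\<tau>\<in>?G. complex_of_real (q ^ root_dist n (inv_into UNIV \<sigma>) (inv_into UNIV \<tau>)) *
       word_inner (act_word J \<sigma> u) (act_word J \<tau> v)) =
      (\<Sum>\<rho>\<in>?G. complex_of_real (q ^ root_dist n (inv_into UNIV \<sigma>) (inv_into UNIV (\<sigma> \<circ> \<rho>))) *
       word_inner (act_word J \<sigma> u) (act_word J (\<sigma> \<circ> \<rho>) v))"
      by (rule sum.reindex_bij_betw[symmetric])
    also have "\<dots> = (\<Sum>\<rho>\<in>?G. complex_of_real (q ^ inversions n \<rho>) * word_inner u (act_word J \<rho> v))"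
    proof (rule sum.cong[OF refl])
      fix \<rho> assume \<rho>: "\<rho> \<in> ?G"
      note \<rho>B = even_signed_permsD(1)[OF \<rho>]
      have c: "\<sigma> \<circ> \<rho> \<in> signed_perms n" by (rule comp_signed_perms[OF \<sigma>B \<rho>B])
      have "root_dist n (inv_into UNIV \<sigma>) (inv_into UNIV (\<sigma> \<circ> \<rho>))
          = inversions n (inv_into UNIV \<sigma> \<circ> inv_into UNIV (inv_into UNIV (\<sigma> \<circ> \<rho>)))"
        by (rule inversions_comp_inv[OF inv_signed_perms[OF \<sigma>B] inv_signed_perms[OF c], symmetric])
      also have "inv_into UNIV (inv_into UNIV (\<sigma> \<circ> \<rho>)) = \<sigma> \<circ> \<rho>"
        by (rule inv_inv_eq[OF type_B_inv(1)[OF c]])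
      also have "inv_into UNIV \<sigma> \<circ> (\<sigma> \<circ> \<rho>) = \<rho>"
        by (auto simp: fun_eq_iff signed_perms_inverse[OF \<sigma>B])
      finally have 1: "root_dist n (inv_into UNIV \<sigma>) (inv_into UNIV (\<sigma> \<circ> \<rho>)) = inversions n \<rho>" .
      have "word_inner (act_word J \<sigma> u) (act_word J (\<sigma> \<circ> \<rho>) v) = word_inner u (act_word J \<rho> v)"
        unfolding act_word_comp[OF JJ \<sigma>B \<rho>B len(2)]
        by (rule word_inner_act_word[OF J \<sigma>B]) (use len in simp_all)
      then show "complex_of_real (q ^ root_dist n (inv_into UNIV \<sigma>) (inv_into UNIV (\<sigma> \<circ> \<rho>))) *
          word_inner (act_word J \<sigma> u) (act_word J (\<sigma> \<circ> \<rho>) v) =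
          complex_of_real (q ^ inversions n \<rho>) * word_inner u (act_word J \<rho> v)"
        unfolding 1 by simp
    qed
    also have "\<dots> = word_form J q u v" by (simp add: word_form_def len)
    finally show ?thesis .
  qed
  then show ?thesis by simp
qed

text \<open>
  For each rank one part of the kernel, the double sum over words and over the group is a Gram sum of
  the translated words.
\<close>

theorem word_form_positive:
  fixes w :: "'i \<Rightarrow> 'h::complex_hilbert_space list"
  assumes J: "selfadjoint_involution J" and q: "- 1 \<le> q" "q \<le> 1"
    and I: "finite I" and len: "\<And>i. i \<in> I \<Longrightarrow> length (w i) = n"
  shows "0 \<le> (\<Sum>i\<in>I. \<Sum>j\<in>I. cnj (c i) * c j * word_form J q (w i) (w j))"
    (is "0 \<le> ?S")
proof -
  let ?G = "even_signed_perms n"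
  define m where "m A = ((1 - q) / 2) ^ card A * ((1 + q) / 2) ^ card (pos_roots n - A)" for A
  define \<chi> where "\<chi> A \<sigma> = (\<Prod>p\<in>A. root_sign (inv_into UNIV \<sigma>) p)" for A \<sigma>
  have m: "0 \<le> m A" for A using q by (simp add: m_def)
  have K: "q ^ root_dist n (inv_into UNIV \<sigma>) (inv_into UNIV \<tau>) = (\<Sum>A\<in>Pow (pos_roots n). m A * (\<chi> A \<sigma> * \<chi> A \<tau>))"
    for \<sigma> \<tau> unfolding m_def \<chi>_def by (rule power_root_dist)
  \<comment> \<open>The Gram sum runs over pairs of a word and a group element; the rank one factors go into its coefficients.\<close>
  define d where "d A = (\<lambda>(i, \<sigma>). c i * complex_of_real (\<chi> A \<sigma>))" for A
  define v where "v = (\<lambda>(i, \<sigma>). act_word J \<sigma> (w i))"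
  have "of_nat (card ?G) * ?S = (\<Sum>i\<in>I. \<Sum>j\<in>I. cnj (c i) * c j * (of_nat (card ?G) * word_form J q (w i) (w j)))"
    by (simp add: sum_distrib_left mult_ac)
  also have "\<dots> = (\<Sum>i\<in>I. \<Sum>j\<in>I. \<Sum>\<sigma>\<in>?G. \<Sum>\<tau>\<in>?G. \<Sum>A\<in>Pow (pos_roots n).
      complex_of_real (m A) * (cnj (d A (i, \<sigma>)) * d A (j, \<tau>) * word_inner (v (i, \<sigma>)) (v (j, \<tau>))))"
    by (intro sum.cong refl)
      (simp add: word_form_average[OF J len len] K d_def v_def sum_distrib_left sum_distrib_right mult_ac)
  also have "\<dots> = (\<Sum>i\<in>I. \<Sum>\<sigma>\<in>?G. \<Sum>j\<in>I. \<Sum>\<tau>\<in>?G. \<Sum>A\<in>Pow (pos_roots n).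
      complex_of_real (m A) * (cnj (d A (i, \<sigma>)) * d A (j, \<tau>) * word_inner (v (i, \<sigma>)) (v (j, \<tau>))))"
    by (intro sum.cong refl sum.swap)
  also have "\<dots> = (\<Sum>x\<in>I \<times> ?G. \<Sum>y\<in>I \<times> ?G. \<Sum>A\<in>Pow (pos_roots n).
      complex_of_real (m A) * (cnj (d A x) * d A y * word_inner (v x) (v y)))"
    by (simp add: sum.cartesian_product')
  also have "\<dots> = (\<Sum>x\<in>I \<times> ?G. \<Sum>A\<in>Pow (pos_roots n). \<Sum>y\<in>I \<times> ?G.
      complex_of_real (m A) * (cnj (d A x) * d A y * word_inner (v x) (v y)))"
    by (intro sum.cong refl sum.swap)
  also have "\<dots> = (\<Sum>A\<in>Pow (pos_roots n). \<Sum>x\<in>I \<times> ?G. \<Sum>y\<in>I \<times> ?G.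
      complex_of_real (m A) * (cnj (d A x) * d A y * word_inner (v x) (v y)))"
    by (rule sum.swap)
  also have "\<dots> = (\<Sum>A\<in>Pow (pos_roots n). complex_of_real (m A) *
      (\<Sum>x\<in>I \<times> ?G. \<Sum>y\<in>I \<times> ?G. cnj (d A x) * d A y * word_inner (v x) (v y)))"
    by (simp add: sum_distrib_left)
  also have "0 \<le> \<dots>"
  proof (rule sum_nonneg, rule mult_nonneg_nonneg)
    fix A
    show "0 \<le> complex_of_real (m A)" using m[of A] by (simp add: less_eq_complex_def)
    show "0 \<le> (\<Sum>x\<in>I \<times> ?G. \<Sum>y\<in>I \<times> ?G. cnj (d A x) * d A y * word_inner (v x) (v y))"
      by (rule word_inner_positive[where n = n]) (use I len in \<open>auto simp: v_def\<close>)
  qed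
  finally have "0 \<le> of_nat (card ?G) * ?S" .
  moreover have "card ?G > 0" using id_even[of n] by (auto simp: card_gt_0_iff)
  ultimately show ?thesis by (auto simp: less_eq_complex_def zero_le_mult_iff)
qed

subsection \<open>Peeling off the first letter\<close>

text \<open>
  The sum over the group is split according to the signed letter that is brought to the first place.
\<close>

lemma word_form_Cons:
  assumes J: "\<And>x. J (J x) = x" and len: "length w = Suc n"
  shows "word_form J q (x # u) w =
    (\<Sum>k<Suc n. \<Sum>c\<in>coset_signs (Suc n). complex_of_real (q ^ coset_length (Suc n) k c) *
      (if c then cinner x (J (w ! k)) * word_form J q u (flip_last J (delete_at k w))
       else cinner x (w ! k) * word_form J q u (delete_at k w)))"
proof -
  let ?G = "even_signed_perms n" and ?N = "Suc n"
  let ?F = "\<lambda>\<sigma>. complex_of_real (q ^ inversions ?N \<sigma>) * word_inner (x # u) (act_word J \<sigma> w)"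
  have "word_form J q (x # u) w = (\<Sum>\<sigma>\<in>even_signed_perms ?N. ?F \<sigma>)"
    by (simp add: word_form_def len)
  also have "\<dots> = (\<Sum>((k, c), \<tau>)\<in>({..<?N} \<times> coset_signs ?N) \<times> ?G. ?F (shift \<tau> \<circ> coset_rep ?N k c))"
    using sum.reindex_bij_betw[OF bij_betw_even_coset, of ?F n, symmetric]
    by (simp add: case_prod_unfold)
  also have "\<dots> = (\<Sum>k<?N. \<Sum>c\<in>coset_signs ?N. \<Sum>\<tau>\<in>?G. ?F (shift \<tau> \<circ> coset_rep ?N k c))"
    by (simp add: sum.cartesian_product')
  also have "\<dots> = (\<Sum>k<?N. \<Sum>c\<in>coset_signs ?N. complex_of_real (q ^ coset_length ?N k c) *
      (if c then cinner x (J (w ! k)) * word_form J q u (flip_last J (delete_at k w))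
       else cinner x (w ! k) * word_form J q u (delete_at k w)))"
  proof (intro sum.cong refl)
    fix k c assume "k \<in> {..<?N}" "c \<in> coset_signs ?N"
    then have k: "k < ?N" "c \<Longrightarrow> 2 \<le> ?N" by (auto simp: coset_signs_def split: if_splits)
    define y where "y = (if c then J (w ! k) else w ! k)"
    define v where "v = (if c then flip_last J (delete_at k w) else delete_at k w)"
    have v: "length v = n" using k len by (simp add: v_def)
    have "?F (shift \<tau> \<circ> coset_rep ?N k c) = complex_of_real (q ^ coset_length ?N k c) * cinner x y *
        (complex_of_real (q ^ inversions n \<tau>) * word_inner u (act_word J \<tau> v))" if \<tau>: "\<tau> \<in> ?G" for \<tau>
    proof -
      note \<tau>B = even_signed_permsD(1)[OF \<tau>]
      have "act_word J (shift \<tau> \<circ> coset_rep ?N k c) w = act_word J (shift \<tau>) (act_word J (coset_rep ?N k c) w)"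
        using k by (intro act_word_comp[OF J shift_signed_perms[OF \<tau>B] _ len] even_signed_permsD(1) coset_rep_even)
      also have "act_word J (coset_rep ?N k c) w = y # v"
        using act_word_coset_rep[OF J, of k w c] k len by (simp add: y_def v_def)
      also have "act_word J (shift \<tau>) (y # v) = y # act_word J \<tau> v"
        by (rule act_word_shift[OF \<tau>B v])
      finally have act: "act_word J (shift \<tau> \<circ> coset_rep ?N k c) w = y # act_word J \<tau> v" .
      have len: "inversions ?N (shift \<tau> \<circ> coset_rep ?N k c) = inversions n \<tau> + coset_length ?N k c"
        using k by (rule inversions_shift_coset_rep[OF \<tau>B])
      show ?thesis
        unfolding act len by (simp add: word_inner_Cons power_add)
    qed
    then have "(\<Sum>\<tau>\<in>?G. ?F (shift \<tau> \<circ> coset_rep ?N k c))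
        = complex_of_real (q ^ coset_length ?N k c) * cinner x y * word_form J q u v"
      by (simp add: word_form_def v sum_distrib_left)
    then show "(\<Sum>\<tau>\<in>?G. ?F (shift \<tau> \<circ> coset_rep ?N k c)) = complex_of_real (q ^ coset_length ?N k c) *
      (if c then cinner x (J (w ! k)) * word_form J q u (flip_last J (delete_at k w))
       else cinner x (w ! k) * word_form J q u (delete_at k w))"
      by (simp add: y_def v_def)
  qed
  finally show ?thesis .
qed

section \<open>Linear maps on the Fock space\<close>

lemma fock_induct [case_names zero step]:
  assumes "P 0" "\<And>c w f. P f \<Longrightarrow> P (c *\<^sub>C tensor w + f)"
  shows "P f"
proof -
  have sum: "P (abs_fock (\<Sum>w\<in>I. Poly_Mapping.single w (c w)))" if "finite I" for I and c :: "'a list \<Rightarrow> complex"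
    using that
  proof (induction I)
    case empty
    show ?case using assms(1) by (simp add: zero_fock.abs_eq)
  next
    case (insert w I)
    have "Poly_Mapping.single w (c w) = formal_scale (c w) (formal_word w)"
      by (rule poly_mapping_eqI) (simp add: lookup_single when_def)
    then have "abs_fock (\<Sum>v\<in>insert w I. Poly_Mapping.single v (c v))
        = c w *\<^sub>C tensor w + abs_fock (\<Sum>v\<in>I. Poly_Mapping.single v (c v))"
      using insert.hyps by (simp add: plus_fock.abs_eq[symmetric] scaleC_fock.abs_eq[symmetric] tensor.abs_eq)
    then show ?case using assms(2) insert.IH by simp
  qed
  obtain p where "f = abs_fock p" by (metis Quotient3_fock Quotient3_abs_rep)
  moreover have "p = (\<Sum>w\<in>Poly_Mapping.keys p. Poly_Mapping.single w (Poly_Mapping.lookup p w))"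
    by (rule poly_mapping_eqI) (auto simp: lookup_sum lookup_single when_def in_keys_iff sum.delta')
  ultimately show ?thesis using sum[of "Poly_Mapping.keys p" "Poly_Mapping.lookup p"] by simp
qed

lemma clinear_add: "clinear T \<Longrightarrow> T (x + y) = T x + T y"
  and clinear_scaleC: "clinear T \<Longrightarrow> T (a *\<^sub>C x) = a *\<^sub>C T x"
  by (simp_all add: clinear_def)

lemma clinear_zero: "clinear T \<Longrightarrow> T 0 = 0"
  using clinear_scaleC[of T 0 0] by simp

lemma clinear_sum: "clinear T \<Longrightarrow> T (\<Sum>i\<in>I. f i) = (\<Sum>i\<in>I. T (f i))"
  by (induction I rule: infinite_finite_induct) (simp_all add: clinear_zero clinear_add)

lemma clinear_eq_on_tensors:
  assumes "clinear S" "clinear T" "\<And>w. S (tensor w) = T (tensor w)"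
  shows "S f = T f"
  by (induction f rule: fock_induct)
    (simp_all add: clinear_zero clinear_add clinear_scaleC assms)

lemma clinearI:
  "(\<And>x y. T (x + y) = T x + T y) \<Longrightarrow> (\<And>a x. T (a *\<^sub>C x) = a *\<^sub>C T x) \<Longrightarrow> clinear T"
  by (simp add: clinear_def)

lemma clinear_comp: "clinear S \<Longrightarrow> clinear T \<Longrightarrow> clinear (\<lambda>f. S (T f))"
  by (simp add: clinear_def)

lemma multilinear_on_wordsI:
  "(\<And>w i a x y. i < length w \<Longrightarrow> f (w[i := a *\<^sub>C x + y]) = a *\<^sub>C f (w[i := x]) + f (w[i := y])) \<Longrightarrow>
    multilinear_on_words f"
  by (simp add: multilinear_on_words_def)

lemma multilinear_on_wordsD:
  "multilinear_on_words f \<Longrightarrow> i < length w \<Longrightarrow>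
    f (w[i := a *\<^sub>C x + y]) = a *\<^sub>C f (w[i := x]) + f (w[i := y])"
  by (simp add: multilinear_on_words_def)

lemma scaleC_complex [simp]: "a *\<^sub>C (z::complex) = a * z"
  by (simp add: scaleC_complex_def)

text \<open>
  The undeformed inner product is built from two nested linear extensions; this allows the outer
  one to be evaluated for an arbitrary right argument.
\<close>

lemma multilinear_cnj_linear_ext:
  "multilinear_on_words (\<lambda>u. cnj (linear_ext (word_inner u) g))"
proof (induction g rule: fock_induct)
  case zero
  show ?case
    by (simp add: multilinear_on_words_def clinear_zero[OF clinear_linear_ext[OF multilinear_word_inner]])
next
  case (step c w g)
  have "cnj (linear_ext (word_inner u) (c *\<^sub>C tensor w + g))
      = cnj c * word_inner w u + cnj (linear_ext (word_inner u) g)" for u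
    using word_inner_commute[of w u]
    by (simp add: clinear_add[OF clinear_linear_ext[OF multilinear_word_inner]]
        clinear_scaleC[OF clinear_linear_ext[OF multilinear_word_inner]]
        linear_ext_tensor[OF multilinear_word_inner])
  then show ?case
    using multilinear_on_wordsD[OF step] multilinear_on_wordsD[OF multilinear_word_inner[of w]]
    by (intro multilinear_on_wordsI) (simp add: algebra_simps)
qed

lemma fock_inner0_add_left: "fock_inner0 (f + f') g = fock_inner0 f g + fock_inner0 f' g"
  and fock_inner0_scaleC_left: "fock_inner0 (a *\<^sub>C f) g = cnj a * fock_inner0 f g"
  by (simp_all add: fock_inner0_def clinear_add clinear_scaleC clinear_linear_ext multilinear_cnj_linear_ext)

lemma fock_inner0_tensor_left: "fock_inner0 (tensor u) g = linear_ext (word_inner u) g"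
  by (simp add: fock_inner0_def linear_ext_tensor multilinear_cnj_linear_ext)

lemma fock_inner0_zero_left: "fock_inner0 0 g = 0"
  using fock_inner0_scaleC_left[of 0 0 g] by simp

lemma clinear_fock_inner0: "clinear (fock_inner0 f)"
proof (induction f rule: fock_induct)
  case zero
  show ?case by (simp add: clinear_def fock_inner0_zero_left)
next
  case (step c w f)
  have "clinear (linear_ext (word_inner w))" by (rule clinear_linear_ext[OF multilinear_word_inner])
  with step show ?case
    by (simp add: clinear_def fock_inner0_add_left fock_inner0_scaleC_left fock_inner0_tensor_left algebra_simps)
qed

subsection \<open>Sesquilinear forms\<close>

text \<open>
  Stated for semidefinite forms, so that it covers the deformed inner product as well as the one of
  the Hilbert space.
\<close>

lemma cauchy_schwarz_form:
  fixes B :: "'a::complex_vector \<Rightarrow> 'a \<Rightarrow> complex"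
  assumes add: "\<And>f g h. B f (g + h) = B f g + B f h" and scale: "\<And>f a g. B f (a *\<^sub>C g) = a * B f g"
    and herm: "\<And>f g. B f g = cnj (B g f)" and pos: "\<And>f. 0 \<le> Re (B f f)"
  shows "(cmod (B f g))\<^sup>2 \<le> Re (B f f) * Re (B g g)"
proof -
  have add': "B (f + g) h = B f h + B g h" for f g h by (metis add herm complex_cnj_add)
  have scale': "B (a *\<^sub>C g) f = cnj a * B g f" for a f g by (metis scale herm complex_cnj_mult)
  let ?a = "(cmod (B f g))\<^sup>2"
  have ineq: "0 \<le> Re (B f f) - 2 * s * ?a + s\<^sup>2 * ?a * Re (B g g)" for s :: real
  proof -
    \<comment> \<open>The phase of c makes the mixed terms real.\<close>
    define c where "c = - of_real s * B g f"
    have gf: "B g f = cnj (B f g)" by (rule herm)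
    have "B (f + c *\<^sub>C g) (f + c *\<^sub>C g) = B f f + c * B f g + cnj c * B g f + cnj c * c * B g g"
      by (simp add: add add' scale scale' algebra_simps)
    also have "Re \<dots> = Re (B f f) - 2 * s * ?a + s\<^sup>2 * ?a * Re (B g g)"
      unfolding c_def gf cmod_power2 by (simp add: power2_eq_square algebra_simps)
    finally show ?thesis using pos[of "f + c *\<^sub>C g"] by simp
  qed
  show ?thesis
  proof (cases "Re (B g g) = 0")
    case True
    have "?a = 0"
    proof (rule ccontr)
      assume "?a \<noteq> 0"
      \<comment> \<open>If g has length 0, the expression is affine in s and would become negative for large s.\<close>
      then have "2 * ((Re (B f f) + 1) / ?a) * ?a = 2 * (Re (B f f) + 1)" by simp
      then show False using ineq[of "(Re (B f f) + 1) / ?a"] True pos[of f] by simp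
    qed
    then show ?thesis using True by simp
  next
    case False
    then have g: "Re (B g g) > 0" using pos[of g] by simp
    have "2 * (1 / Re (B g g)) * ?a = 2 * (?a / Re (B g g))"
      "(1 / Re (B g g))\<^sup>2 * ?a * Re (B g g) = ?a / Re (B g g)"
      using False by (simp_all add: power2_eq_square field_simps)
    then have "0 \<le> Re (B f f) - ?a / Re (B g g)" using ineq[of "1 / Re (B g g)"] by linarith
    then show ?thesis using g by (simp add: field_simps)
  qed
qed

lemma cinner_cauchy_schwarz: "cmod (cinner x y) \<le> norm x * norm (y::'h::complex_hilbert_space)"
proof -
  have "(cmod (cinner x y))\<^sup>2 \<le> Re (cinner x x) * Re (cinner y y)"
    by (rule cauchy_schwarz_form)
      (rule cinner_add_right cinner_scaleC_right cinner_commute cinner_ge_zero)+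
  also have "\<dots> = (norm x * norm y)\<^sup>2" by (simp add: cinner_self power_mult_distrib)
  finally show ?thesis by (rule power2_le_imp_le) simp
qed

section \<open>Homogeneous elements\<close>

text \<open>
  The elements of degree n, generated one simple tensor at a time to provide an
  induction principle.
\<close>

inductive homogeneous :: "nat \<Rightarrow> 'h::complex_vector fock \<Rightarrow> bool" for n where
  zero: "homogeneous n 0"
| step: "length w = n \<Longrightarrow> homogeneous n f \<Longrightarrow> homogeneous n (c *\<^sub>C tensor w + f)"

lemma homogeneous_add: "homogeneous n f \<Longrightarrow> homogeneous n g \<Longrightarrow> homogeneous n (f + g)"
  by (induction rule: homogeneous.induct) (simp_all add: add.assoc homogeneous.step)

lemma homogeneous_scaleC: "homogeneous n f \<Longrightarrow> homogeneous n (a *\<^sub>C f)"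
  by (induction rule: homogeneous.induct)
    (simp_all add: scaleC_add_right scaleC_scaleC homogeneous.intros)

lemma homogeneous_tensor: "length w = n \<Longrightarrow> homogeneous n (tensor w)"
  using homogeneous.step[OF _ homogeneous.zero, of w n 1] by (simp add: scaleC_one)

lemma homogeneous_sum: "(\<And>i. i \<in> I \<Longrightarrow> homogeneous n (f i)) \<Longrightarrow> homogeneous n (\<Sum>i\<in>I. f i)"
  by (induction I rule: infinite_finite_induct) (simp_all add: homogeneous.zero homogeneous_add)

lemma homogeneous_clinear:
  assumes "homogeneous n f" "clinear T" "\<And>w. length w = n \<Longrightarrow> homogeneous m (T (tensor w))"
  shows "homogeneous m (T f)"
  using assms(1)
  by (induction rule: homogeneous.induct)
    (simp_all add: clinear_zero clinear_add clinear_scaleC assms(2,3) homogeneous.zero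
      homogeneous_add homogeneous_scaleC)

lemma homogeneous_eq:
  assumes "homogeneous n f" "clinear S" "clinear T" "\<And>w. length w = n \<Longrightarrow> S (tensor w) = T (tensor w)"
  shows "S f = T f"
  using assms(1)
  by (induction rule: homogeneous.induct)
    (simp_all add: clinear_zero clinear_add clinear_scaleC assms(2,3,4))

lemma homogeneous_decomposition:
  "\<exists>M g. (\<forall>n. homogeneous n (g n)) \<and> f = (\<Sum>n<M. g n)"
proof -
  have "\<exists>M g. (\<forall>n. homogeneous n (g n)) \<and> (\<forall>n\<ge>M. g n = 0) \<and> f = (\<Sum>n<M. g n)"
  proof (induction f rule: fock_induct)
    case zero
    show ?case by (intro exI[of _ 0] exI[of _ "\<lambda>_. 0"]) (simp add: homogeneous.zero)
  next
    case (step c w f)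
    then obtain M g where g: "\<And>n. homogeneous n (g n)" "\<And>n. n \<ge> M \<Longrightarrow> g n = 0" "f = (\<Sum>n<M. g n)"
      by blast
    let ?M = "max M (Suc (length w))"
    let ?g = "\<lambda>n. (if n = length w then c *\<^sub>C tensor w else 0) + g n"
    have "(\<Sum>n<?M. g n) = f"
      unfolding g(3) by (rule sum.mono_neutral_right) (auto simp: g(2))
    moreover have "(\<Sum>n<?M. if n = length w then c *\<^sub>C tensor w else 0) = c *\<^sub>C tensor w"
      by (simp add: sum.delta' less_max_iff_disj)
    ultimately have "c *\<^sub>C tensor w + f = (\<Sum>n<?M. ?g n)"
      by (simp add: sum.distrib)
    moreover have "homogeneous n (?g n)" for n
      using g(1)[of n] by (auto intro: homogeneous.step)
    ultimately show ?case
      using g(2) by (intro exI[of _ ?M] exI[of _ ?g]) auto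
  qed
  then show ?thesis by blast
qed

lemma homogeneous_indexed:
  "homogeneous n f \<Longrightarrow> \<exists>k c w. (\<forall>i<k. length (w i) = n) \<and> f = (\<Sum>i<(k::nat). c i *\<^sub>C tensor (w i))"
proof (induction rule: homogeneous.induct)
  case zero
  show ?case by (intro exI[of _ 0]) simp
next
  case (step v f d)
  then obtain k c w where kcw: "\<forall>i<k. length (w i) = n" "f = (\<Sum>i<(k::nat). c i *\<^sub>C tensor (w i))" by blast
  have "f = (\<Sum>i<k. (c(k := d)) i *\<^sub>C tensor ((w(k := v)) i))"
    unfolding kcw(2) by (rule sum.cong) auto
  then have "d *\<^sub>C tensor v + f = (\<Sum>i<Suc k. (c(k := d)) i *\<^sub>C tensor ((w(k := v)) i))"
    by (simp add: add.commute)
  moreover have "\<forall>i<Suc k. length ((w(k := v)) i) = n" using kcw(1) step.hyps by (auto simp: less_Suc_eq)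
  ultimately show ?case by blast
qed

text \<open>
  In degree 1 every element is a single vector, which permits explicit computations.
\<close>

lemma homogeneous_1: "homogeneous 1 f \<Longrightarrow> \<exists>z. f = tensor [z]"
proof (induction rule: homogeneous.induct)
  case zero
  have "tensor [0::'a] = tensor [0] + tensor [0]"
    using tensor_update[of 0 "[0::'a]" 1 0 0] by (simp add: scaleC_one)
  then have "tensor [0::'a] = 0" by simp
  then show ?case by metis
next
  case (step w f c)
  then obtain y z where "w = [y]" "f = tensor [z]" by (auto simp: length_Suc_conv)
  then have "c *\<^sub>C tensor w + f = tensor [c *\<^sub>C y + z]"
    using tensor_update[of 0 "[y]" c y z] by simp
  then show ?case by blast
qed

lemma clinear_creation: "clinear (creation x)"
  unfolding creation_def by (rule clinear_linear_ext[OF multilinear_creation])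

lemma homogeneous_creation: "homogeneous n f \<Longrightarrow> homogeneous (Suc n) (creation x f)"
  by (rule homogeneous_clinear[OF _ clinear_creation])
    (auto simp: creation_tensor intro!: homogeneous_tensor)

section \<open>Annihilation and the last sign\<close>

lemma flip_last_update:
  assumes "i < length w"
  shows "flip_last J (w[i := z]) = (flip_last J w)[i := if Suc i = length w then J z else z]"
  by (rule nth_equalityI) (use assms in \<open>auto simp: nth_flip_last nth_list_update\<close>)

lemma multilinear_flip_last:
  assumes "clinear J"
  shows "multilinear_on_words (\<lambda>w. tensor (flip_last J w))"
  by (rule multilinear_on_wordsI)
    (simp add: flip_last_update tensor_update clinear_add[OF assms] clinear_scaleC[OF assms])

lemma delete_at_update:
  assumes "k < length w" "i < length w"
  shows "delete_at k (w[i := z]) = (if i = k then delete_at k w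
    else (delete_at k w)[(if i < k then i else i - 1) := z])"
  using assms
proof (induction w arbitrary: k i)
  case (Cons y w)
  show ?case
    using Cons by (cases k; cases i) (auto simp: delete_at_Cons Let_def split: nat.splits)
qed simp

lemma multilinear_delete_at:
  assumes g: "multilinear_on_words g" and w: "k < length w" "i < length w"
  shows "cinner x ((w[i := a *\<^sub>C y + z]) ! k) *\<^sub>C g (delete_at k (w[i := a *\<^sub>C y + z])) =
    a *\<^sub>C (cinner x ((w[i := y]) ! k) *\<^sub>C g (delete_at k (w[i := y]))) +
    cinner x ((w[i := z]) ! k) *\<^sub>C g (delete_at k (w[i := z]))"
proof (cases "i = k")
  case True
  then show ?thesis using w
    by (simp add: delete_at_update cinner_add_right cinner_scaleC_right scaleC_add_left scaleC_scaleC)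
next
  case False
  then have "(if i < k then i else i - 1) < length (delete_at k w)" using w by auto
  from multilinear_on_wordsD[OF g this, of a y z] show ?thesis
    using False w by (simp add: delete_at_update scaleC_add_right scaleC_scaleC mult.commute)
qed

locale q_fock =
  fixes J :: "'h::complex_hilbert_space \<Rightarrow> 'h" and q :: real
  assumes involution: "selfadjoint_involution J" and q_bounds: "- 1 < q" "q < 1"
begin

lemma J_clinear: "clinear J"
  and J_J [simp]: "J (J x) = x"
  and J_adjoint: "cinner (J x) y = cinner x (J y)"
  using involution by (simp_all add: selfadjoint_involution_def)

lemma norm_J [simp]: "norm (J x) = norm x"
  by (simp add: norm_eq_sqrt_cinner J_adjoint)

abbreviation inner_q :: "'h fock \<Rightarrow> 'h fock \<Rightarrow> complex" where
  "inner_q \<equiv> fock_inner J q"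

lemma clinear_inner_q: "clinear (inner_q f)"
  using clinear_comp[OF clinear_fock_inner0 clinear_linear_ext[OF multilinear_symmetrizer[OF J_clinear]]]
  by (simp add: fock_inner_def[abs_def] fock_symmetrizer_def)

lemmas inner_q_add_right = clinear_add[OF clinear_inner_q]
lemmas inner_q_scaleC_right = clinear_scaleC[OF clinear_inner_q, unfolded scaleC_complex]
lemmas inner_q_zero_right = clinear_zero[OF clinear_inner_q]

lemma inner_q_add_left: "inner_q (f + f') g = inner_q f g + inner_q f' g"
  and inner_q_scaleC_left: "inner_q (a *\<^sub>C f) g = cnj a * inner_q f g"
  by (simp_all add: fock_inner_def fock_inner0_add_left fock_inner0_scaleC_left)

lemma inner_q_zero_left: "inner_q 0 g = 0"
  by (simp add: fock_inner_def fock_inner0_zero_left)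

lemma inner_q_sum_right: "inner_q f (\<Sum>i\<in>I. g i) = (\<Sum>i\<in>I. inner_q f (g i))"
  by (induction I rule: infinite_finite_induct) (simp_all add: inner_q_zero_right inner_q_add_right)

lemma inner_q_sum_left: "inner_q (\<Sum>i\<in>I. f i) g = (\<Sum>i\<in>I. inner_q (f i) g)"
  by (induction I rule: infinite_finite_induct) (simp_all add: inner_q_zero_left inner_q_add_left)

lemma inner_q_tensor: "inner_q (tensor u) (tensor v) = word_form J q u v"
proof -
  let ?n = "length v"
  have lin: "clinear (linear_ext (word_inner u))" by (rule clinear_linear_ext[OF multilinear_word_inner])
  have act: "act J ?n \<sigma> (tensor v) = tensor (act_word J \<sigma> v)" if "\<sigma> \<in> even_signed_perms ?n" for \<sigma>
    using act_tensor[OF J_clinear even_signed_permsD(1)[OF that], of v] by simp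
  have "inner_q (tensor u) (tensor v) = linear_ext (word_inner u) (symmetrizer J q ?n (tensor v))"
    by (simp add: fock_inner_def fock_inner0_tensor_left fock_symmetrizer_tensor[OF J_clinear])
  also have "\<dots> = (\<Sum>\<sigma>\<in>even_signed_perms ?n. complex_of_real (q ^ type_D_length ?n \<sigma>) *
      linear_ext (word_inner u) (act J ?n \<sigma> (tensor v)))"
    unfolding symmetrizer_def clinear_sum[OF lin] clinear_scaleC[OF lin] scaleC_complex type_D_eq_even ..
  also have "\<dots> = word_form J q u v"
    unfolding word_form_def
    by (rule sum.cong[OF refl])
      (simp add: act type_D_length_eq_inversions linear_ext_tensor[OF multilinear_word_inner])
  finally show ?thesis .
qed

lemma inner_q_commute: "inner_q f g = cnj (inner_q g f)"
proof -
  have words: "word_form J q u v = cnj (word_form J q v u)" for u v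
  proof (cases "length u = length v")
    case True
    let ?G = "even_signed_perms (length v)"
    have "of_nat (card ?G) * word_form J q u v = (\<Sum>\<sigma>\<in>?G. \<Sum>\<tau>\<in>?G.
       complex_of_real (q ^ root_dist (length v) (inv_into UNIV \<sigma>) (inv_into UNIV \<tau>)) *
       word_inner (act_word J \<sigma> u) (act_word J \<tau> v))"
      by (rule word_form_average[OF involution True refl])
    also have "\<dots> = (\<Sum>\<tau>\<in>?G. \<Sum>\<sigma>\<in>?G.
       complex_of_real (q ^ root_dist (length v) (inv_into UNIV \<sigma>) (inv_into UNIV \<tau>)) *
       word_inner (act_word J \<sigma> u) (act_word J \<tau> v))"
      by (rule sum.swap)
    also have "\<dots> = cnj (\<Sum>\<tau>\<in>?G. \<Sum>\<sigma>\<in>?G.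
       complex_of_real (q ^ root_dist (length v) (inv_into UNIV \<tau>) (inv_into UNIV \<sigma>)) *
       word_inner (act_word J \<tau> v) (act_word J \<sigma> u))"
      unfolding cnj_sum
      by (intro sum.cong refl)
        (simp add: root_dist_commute word_inner_commute[of "act_word J _ u"])
    also have "\<dots> = cnj (of_nat (card ?G) * word_form J q v u)"
      by (subst word_form_average[OF involution refl True]) simp
    finally have "of_nat (card ?G) * word_form J q u v = of_nat (card ?G) * cnj (word_form J q v u)" by simp
    moreover have "card ?G \<noteq> 0" using id_even[of "length v"] by (auto simp: card_eq_0_iff)
    ultimately show ?thesis by simp
  qed (simp add: word_form_length)
  have "inner_q (tensor u) g = cnj (inner_q g (tensor u))" for u
    by (induction g rule: fock_induct)
      (simp_all add: inner_q_zero_left inner_q_zero_right inner_q_add_left inner_q_add_right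
        inner_q_scaleC_left inner_q_scaleC_right inner_q_tensor words[of u])
  then show ?thesis
    by (induction f rule: fock_induct)
      (simp_all add: inner_q_zero_left inner_q_zero_right inner_q_add_left inner_q_add_right
        inner_q_scaleC_left inner_q_scaleC_right)
qed

lemma inner_q_homogeneous_nonneg:
  assumes "homogeneous n f"
  shows "0 \<le> inner_q f f"
proof -
  obtain k c w where w: "\<And>i. i < k \<Longrightarrow> length (w i) = n" and f: "f = (\<Sum>i<(k::nat). c i *\<^sub>C tensor (w i))"
    using homogeneous_indexed[OF assms] by blast
  have "inner_q f f = (\<Sum>i<k. \<Sum>j<k. cnj (c i) * c j * word_form J q (w i) (w j))"
    unfolding f inner_q_sum_left
    by (simp add: inner_q_sum_right inner_q_scaleC_left inner_q_scaleC_right inner_q_tensor mult_ac)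
  also have "0 \<le> \<dots>"
    by (rule word_form_positive[OF involution]) (use q_bounds w in auto)
  finally show ?thesis .
qed

lemma inner_q_orthogonal:
  assumes "homogeneous m f" "homogeneous n g" "m \<noteq> n"
  shows "inner_q f g = 0"
proof -
  have "inner_q (tensor u) g = 0" if "length u = m" for u
    using assms(2) that assms(3)
    by (induction rule: homogeneous.induct)
      (simp_all add: inner_q_zero_right inner_q_add_right inner_q_scaleC_right inner_q_tensor word_form_length)
  with assms(1) show ?thesis
    by (induction rule: homogeneous.induct)
      (simp_all add: inner_q_zero_left inner_q_add_left inner_q_scaleC_left)
qed

lemma inner_q_sum_homogeneous:
  assumes g: "\<And>n. homogeneous (d n) (g n)" and d: "inj d"
  shows "inner_q (\<Sum>n<M. g n) (\<Sum>n<M. g n) = (\<Sum>n<(M::nat). inner_q (g n) (g n))"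
proof -
  have "inner_q (\<Sum>n<M. g n) (\<Sum>n<M. g n) = (\<Sum>m<M. \<Sum>n<M. inner_q (g m) (g n))"
    unfolding inner_q_sum_left by (simp add: inner_q_sum_right)
  also have "\<dots> = (\<Sum>m<M. \<Sum>n<M. if n = m then inner_q (g n) (g n) else 0)"
    by (intro sum.cong refl) (simp add: inner_q_orthogonal[OF g g] inj_eq[OF d])
  finally show ?thesis by simp
qed

lemma inner_q_nonneg: "0 \<le> inner_q f f"
proof -
  obtain M g where g: "\<And>n. homogeneous n (g n)" "f = (\<Sum>n<M. g n)"
    using homogeneous_decomposition[of f] by blast
  have "inner_q f f = (\<Sum>n<M. inner_q (g n) (g n))"
    unfolding g(2) by (rule inner_q_sum_homogeneous[of "\<lambda>n. n"]) (auto simp: g(1))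
  then show ?thesis using inner_q_homogeneous_nonneg[OF g(1)] by (simp add: sum_nonneg)
qed

text \<open>
  The candidate for the adjoint of creation: the terms correspond to the coset representatives, with
  the scalar product of x and the letter that was brought to the front.
\<close>

definition annihilate_word :: "'h \<Rightarrow> 'h list \<Rightarrow> 'h fock" where
  "annihilate_word x w = (\<Sum>k<length w. \<Sum>c\<in>coset_signs (length w).
     complex_of_real (q ^ coset_length (length w) k c) *\<^sub>C
       (if c then cinner x (J (w ! k)) *\<^sub>C tensor (flip_last J (delete_at k w))
        else cinner x (w ! k) *\<^sub>C tensor (delete_at k w)))"

definition annihilation :: "'h \<Rightarrow> 'h fock \<Rightarrow> 'h fock" where
  "annihilation x = linear_ext (annihilate_word x)"

text \<open>
  The sign change of the last position.  It does not belong to the type D group, but it normalizes the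
  group and preserves lengths, as it exchanges the last two generators.
\<close>

definition flip :: "'h fock \<Rightarrow> 'h fock" where
  "flip = linear_ext (\<lambda>w. tensor (flip_last J w))"

lemma multilinear_tensor: "multilinear_on_words tensor"
  by (rule multilinear_on_wordsI) (rule tensor_update)

lemma multilinear_annihilate_word: "multilinear_on_words (annihilate_word x)"
proof (rule multilinear_on_wordsI)
  fix w :: "'h list" and i a y z
  assume i: "i < length w"
  let ?t = "\<lambda>w k c. complex_of_real (q ^ coset_length (length w) k c) *\<^sub>C
       (if c then cinner x (J (w ! k)) *\<^sub>C tensor (flip_last J (delete_at k w))
        else cinner x (w ! k) *\<^sub>C tensor (delete_at k w))"
  have "?t (w[i := a *\<^sub>C y + z]) k c = a *\<^sub>C ?t (w[i := y]) k c + ?t (w[i := z]) k c"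
    if k: "k < length w" for k c
    using multilinear_delete_at[OF multilinear_flip_last[OF J_clinear] k i, of "J x" a y z]
      multilinear_delete_at[OF multilinear_tensor k i, of x a y z]
    by (simp add: J_adjoint scaleC_add_right scaleC_scaleC mult_ac)
  then show "annihilate_word x (w[i := a *\<^sub>C y + z]) =
      a *\<^sub>C annihilate_word x (w[i := y]) + annihilate_word x (w[i := z])"
    unfolding annihilate_word_def length_list_update
    by (simp add: scaleC_sum_right sum.distrib)
qed

lemma annihilation_tensor: "annihilation x (tensor w) = annihilate_word x w"
  unfolding annihilation_def by (rule linear_ext_tensor[OF multilinear_annihilate_word])

lemma clinear_annihilation: "clinear (annihilation x)"
  unfolding annihilation_def by (rule clinear_linear_ext[OF multilinear_annihilate_word])

lemma flip_tensor: "flip (tensor w) = tensor (flip_last J w)"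
  unfolding flip_def by (rule linear_ext_tensor[OF multilinear_flip_last[OF J_clinear]])

lemma clinear_flip: "clinear flip"
  unfolding flip_def by (rule clinear_linear_ext[OF multilinear_flip_last[OF J_clinear]])

text \<open>
  On words this is the coset decomposition of the group sum.
\<close>

theorem creation_adjoint: "inner_q (creation x f) g = inner_q f (annihilation x g)"
proof -
  have words: "inner_q (creation x (tensor u)) (tensor w) = inner_q (tensor u) (annihilation x (tensor w))" for u w
  proof (cases w)
    case Nil
    then show ?thesis
      by (simp add: creation_tensor inner_q_tensor annihilation_tensor annihilate_word_def
          word_form_length inner_q_zero_right)
  next
    case (Cons y v)
    have "inner_q (creation x (tensor u)) (tensor w) = word_form J q (x # u) w"
      by (simp add: creation_tensor inner_q_tensor)
    also have "\<dots> = inner_q (tensor u) (annihilate_word x w)"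
      unfolding annihilate_word_def inner_q_sum_right
      by (subst word_form_Cons[of J w "length v"])
        (auto simp: Cons inner_q_scaleC_right inner_q_tensor if_distrib intro!: sum.cong simp del: sum.lessThan_Suc)
    finally show ?thesis by (simp add: annihilation_tensor)
  qed
  have "inner_q (creation x (tensor u)) g = inner_q (tensor u) (annihilation x g)" for u
    by (rule clinear_eq_on_tensors[OF clinear_inner_q clinear_comp[OF clinear_inner_q clinear_annihilation] words])
  then show ?thesis
    by (induction f rule: fock_induct)
      (simp_all add: clinear_zero[OF clinear_creation] clinear_add[OF clinear_creation]
        clinear_scaleC[OF clinear_creation] inner_q_zero_left inner_q_add_left inner_q_scaleC_left)
qed

lemma flip_last_involution [simp]: "flip_last J (flip_last J w) = w"
  by (simp add: flip_last_def)

lemma flip_flip [simp]: "flip (flip f) = f"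
proof -
  have "clinear (\<lambda>f :: 'h fock. f)" by (simp add: clinear_def)
  from clinear_eq_on_tensors[OF clinear_comp[OF clinear_flip clinear_flip] this] show ?thesis
    by (simp add: flip_tensor)
qed

lemma flip_creation:
  assumes "homogeneous n f" "n \<noteq> 0"
  shows "flip (creation x f) = creation x (flip f)"
  by (rule homogeneous_eq[OF assms(1) clinear_comp[OF clinear_flip clinear_creation]
        clinear_comp[OF clinear_creation clinear_flip]])
    (use assms(2) in \<open>auto simp: creation_tensor flip_tensor flip_last_Cons\<close>)

lemma homogeneous_annihilation:
  assumes "homogeneous n f"
  shows "homogeneous (n - 1) (annihilation x f)"
  using assms clinear_annihilation
proof (rule homogeneous_clinear)
  fix w :: "'h list" assume "length w = n"
  then show "homogeneous (n - 1) (annihilation x (tensor w))"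
    unfolding annihilation_tensor annihilate_word_def
    by (intro homogeneous_sum homogeneous_scaleC) (auto intro!: homogeneous_scaleC homogeneous_tensor)
qed

lemma annihilate_word_single: "annihilate_word x [y] = cinner x y *\<^sub>C tensor []"
  by (simp add: annihilate_word_def coset_signs_def coset_length_def delete_at_def scaleC_one)

lemma annihilate_word_pair: "annihilate_word x [y, z] =
    cinner x y *\<^sub>C tensor [z] + of_real q *\<^sub>C cinner x z *\<^sub>C tensor [y] +
    of_real q *\<^sub>C cinner x (J z) *\<^sub>C tensor [J y] + of_real (q\<^sup>2) *\<^sub>C cinner x (J y) *\<^sub>C tensor [J z]"
  by (simp add: annihilate_word_def coset_signs_def coset_length_def delete_at_def flip_last_def
      UNIV_bool numeral_2_eq_2 scaleC_one add_ac)

text \<open>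
  The signed letter brought to the front is either the first letter y, or a letter of the remaining
  word, which has one more step to go, or the negative of y.  There have to be at least two
  remaining letters because a single one is annihilated without a sign term, although in a word of two
  letters it can be brought to the front with either sign.
\<close>

lemma annihilate_word_Cons:
  assumes "2 \<le> length w"
  shows "annihilate_word x (y # w) = cinner x y *\<^sub>C tensor w +
    of_real q *\<^sub>C creation y (annihilate_word x w) +
    of_real (q ^ (2 * length w)) *\<^sub>C cinner x (J y) *\<^sub>C tensor (flip_last J w)"
proof -
  let ?n = "length w"
  let ?t = "\<lambda>w k c. complex_of_real (q ^ coset_length (length w) k c) *\<^sub>C
       (if c then cinner x (J (w ! k)) *\<^sub>C tensor (flip_last J (delete_at k w))
        else cinner x (w ! k) *\<^sub>C tensor (delete_at k w))"
  have signs: "coset_signs (Suc ?n) = {False, True}" "coset_signs ?n = {False, True}"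
    using assms by (auto simp: coset_signs_def)
  have "?t (y # w) (Suc k) c = of_real q *\<^sub>C creation y (?t w k c)" if k: "k < ?n" for k c
  proof -
    have ne: "delete_at k w \<noteq> []" using assms k by (auto simp: delete_at_def)
    have "coset_length (Suc ?n) (Suc k) c = Suc (coset_length ?n k c)"
      using k assms by (auto simp: coset_length_def)
    then show ?thesis
      by (simp add: delete_at_Cons flip_last_Cons[OF ne] clinear_scaleC[OF clinear_creation] creation_tensor
          scaleC_scaleC)
  qed
  then have "(\<Sum>k<?n. \<Sum>c\<in>{False, True}. ?t (y # w) (Suc k) c)
      = of_real q *\<^sub>C creation y (\<Sum>k<?n. \<Sum>c\<in>{False, True}. ?t w k c)"
    unfolding clinear_sum[OF clinear_creation] scaleC_sum_right by (intro sum.cong refl) auto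
  moreover have "(\<Sum>c\<in>{False, True}. ?t (y # w) 0 c) = cinner x y *\<^sub>C tensor w +
      of_real (q ^ (2 * length w)) *\<^sub>C cinner x (J y) *\<^sub>C tensor (flip_last J w)"
    by (simp add: coset_length_def delete_at_Cons scaleC_one)
  moreover have "annihilate_word x (y # w) = (\<Sum>c\<in>{False, True}. ?t (y # w) 0 c) +
      (\<Sum>k<?n. \<Sum>c\<in>{False, True}. ?t (y # w) (Suc k) c)"
    unfolding annihilate_word_def length_Cons signs by (rule sum.lessThan_Suc_shift)
  ultimately show ?thesis
    unfolding annihilate_word_def[of x w] signs by (simp only: add_ac)
qed

text \<open>
  The commutation relation that replaces the relation of the q-Fock space of type A; the last
  term is the contribution of the new sign changes.
\<close>

lemma annihilation_creation:
  assumes "homogeneous n f" "2 \<le> n"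
  shows "annihilation x (creation y f) = cinner x y *\<^sub>C f + of_real q *\<^sub>C creation y (annihilation x f) +
    of_real (q ^ (2 * n)) *\<^sub>C cinner x (J y) *\<^sub>C flip f"
  using assms(1)
proof (rule homogeneous_eq)
  show "clinear (\<lambda>f. annihilation x (creation y f))"
    by (rule clinear_comp[OF clinear_annihilation clinear_creation])
  show "clinear (\<lambda>f. cinner x y *\<^sub>C f + of_real q *\<^sub>C creation y (annihilation x f) +
    of_real (q ^ (2 * n)) *\<^sub>C cinner x (J y) *\<^sub>C flip f)"
    by (rule clinearI) (simp_all add: clinear_add[OF clinear_creation] clinear_add[OF clinear_annihilation]
        clinear_add[OF clinear_flip] clinear_scaleC[OF clinear_creation] clinear_scaleC[OF clinear_annihilation]
        clinear_scaleC[OF clinear_flip] scaleC_add_right scaleC_scaleC mult_ac add_ac)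
  show "annihilation x (creation y (tensor w)) = cinner x y *\<^sub>C tensor w +
    of_real q *\<^sub>C creation y (annihilation x (tensor w)) +
    of_real (q ^ (2 * n)) *\<^sub>C cinner x (J y) *\<^sub>C flip (tensor w)" if "length w = n" for w
    using annihilate_word_Cons[of w x y] assms(2) that
    by (simp add: creation_tensor annihilation_tensor flip_tensor)
qed

lemma flip_annihilate_word: "2 \<le> length w \<Longrightarrow> flip (annihilate_word x w) = annihilate_word x (flip_last J w)"
proof (induction w)
  case (Cons y w)
  show ?case
  proof (cases "length w = 1")
    case True
    then obtain z where w: "w = [z]" by (auto simp: length_Suc_conv)
    have "flip_last J [y, z] = [y, J z]" by (simp add: flip_last_def)
    then show ?thesis
      by (simp add: w annihilate_word_pair clinear_add[OF clinear_flip] clinear_scaleC[OF clinear_flip] flip_tensor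
          flip_last_def add_ac)
  next
    case False
    then have 2: "2 \<le> length w" "w \<noteq> []" using Cons.prems by auto
    have "homogeneous (length w - 1) (annihilate_word x w)"
      using homogeneous_annihilation[OF homogeneous_tensor[OF refl], of w x] by (simp add: annihilation_tensor)
    then have "flip (creation y (annihilate_word x w)) = creation y (annihilate_word x (flip_last J w))"
      using Cons.IH 2 by (subst flip_creation) auto
    then show ?thesis
      using annihilate_word_Cons[of "flip_last J w" x y] 2
      by (simp add: flip_last_Cons annihilate_word_Cons clinear_add[OF clinear_flip]
          clinear_scaleC[OF clinear_flip] flip_tensor)
  qed
qed simp

lemma flip_annihilation:
  assumes "homogeneous n f" "2 \<le> n"
  shows "flip (annihilation x f) = annihilation x (flip f)"
  by (rule homogeneous_eq[OF assms(1) clinear_comp[OF clinear_flip clinear_annihilation]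
        clinear_comp[OF clinear_annihilation clinear_flip]])
    (use assms(2) in \<open>auto simp: annihilation_tensor flip_tensor flip_annihilate_word\<close>)

lemma inner_q_vacuum: "inner_q (tensor []) (tensor []) = 1"
proof -
  have "even_signed_perms 0 = {id}"
    using id_even[of 0] by (auto simp: even_signed_perms_def type_B_group_def signed_points_def)
  then show ?thesis
    by (simp add: inner_q_tensor word_form_def word_inner_def root_dist_def pos_roots_def)
qed

lemma inner_q_single: "inner_q (tensor [y]) (tensor [z]) = cinner y z"
proof -
  show ?thesis
    using creation_adjoint[of y "tensor []" "tensor [z]"]
    by (simp add: creation_tensor annihilation_tensor annihilate_word_single inner_q_scaleC_right inner_q_vacuum)
qed

text \<open>
  Moving creation operators to the other side strips the letters of the left word one by one,
  because the flip commutes with annihilation; the last letter is left to the symmetry of J.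
\<close>

theorem flip_symmetric: "inner_q (flip f) g = inner_q f (flip g)"
proof -
  have words: "inner_q (tensor (flip_last J u)) (tensor v) = inner_q (tensor u) (tensor (flip_last J v))" for u v
  proof (induction u arbitrary: v)
    case Nil
    then show ?case by (cases "v = []") (simp_all add: inner_q_tensor word_form_length flip_last_def)
  next
    case (Cons x u)
    show ?case
    proof (cases "length v = Suc (length u)")
      case False
      then show ?thesis by (simp add: inner_q_tensor word_form_length)
    next
      case len: True
      show ?thesis
      proof (cases "u = []")
        case True
        then obtain z where "v = [z]" using len by (auto simp: length_Suc_conv)
        then show ?thesis using True by (simp add: flip_last_def inner_q_single J_adjoint)
      next
        case False
        then have v: "2 \<le> length v" using len by (cases u) auto
        have IH: "inner_q (tensor (flip_last J u)) g = inner_q (tensor u) (flip g)" for g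
          by (rule clinear_eq_on_tensors[OF clinear_inner_q clinear_comp[OF clinear_inner_q clinear_flip]])
            (simp add: Cons.IH flip_tensor)
        have "inner_q (tensor (flip_last J (x # u))) (tensor v) = inner_q (creation x (tensor (flip_last J u))) (tensor v)"
          using False by (simp add: flip_last_Cons creation_tensor)
        also have "\<dots> = inner_q (tensor u) (flip (annihilation x (tensor v)))"
          by (simp add: creation_adjoint IH)
        also have "\<dots> = inner_q (tensor u) (annihilation x (flip (tensor v)))"
          using flip_annihilation[OF homogeneous_tensor[OF refl] v] by simp
        also have "\<dots> = inner_q (tensor (x # u)) (tensor (flip_last J v))"
          by (simp flip: creation_adjoint add: creation_tensor flip_tensor)
        finally show ?thesis .
      qed
    qed
  qed
  have "inner_q (flip (tensor u)) g = inner_q (tensor u) (flip g)" for u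
    by (rule clinear_eq_on_tensors[OF clinear_inner_q clinear_comp[OF clinear_inner_q clinear_flip]])
      (simp add: words flip_tensor)
  then show ?thesis
    by (induction f rule: fock_induct)
      (simp_all add: clinear_zero[OF clinear_flip] clinear_add[OF clinear_flip]
        clinear_scaleC[OF clinear_flip] inner_q_zero_left inner_q_add_left inner_q_scaleC_left)
qed

end

section \<open>Norm bounds for the creation operator\<close>

context q_fock
begin

abbreviation normsq_q :: "'h fock \<Rightarrow> real" where
  "normsq_q f \<equiv> Re (inner_q f f)"

lemma inner_q_self: "inner_q f f = of_real (normsq_q f)"
  using inner_q_nonneg[of f] by (simp add: complex_eq_iff less_eq_complex_def)

lemma Re_of_real_mult: "Re (of_real r * z) = r * Re z"
  by simp

lemma normsq_q_nonneg: "0 \<le> normsq_q f"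
  using inner_q_nonneg[of f] by (simp add: less_eq_complex_def)

lemma normsq_q_scaleC: "normsq_q (a *\<^sub>C f) = (cmod a)\<^sup>2 * normsq_q f"
proof -
  have "inner_q (a *\<^sub>C f) (a *\<^sub>C f) = (cnj a * a) * inner_q f f"
    by (simp add: inner_q_scaleC_left inner_q_scaleC_right)
  also have "cnj a * a = of_real ((cmod a)\<^sup>2)"
    unfolding complex_norm_square by (simp add: mult.commute)
  finally show ?thesis by (simp only: Re_of_real_mult)
qed

lemma inner_q_cauchy_schwarz: "(cmod (inner_q f g))\<^sup>2 \<le> normsq_q f * normsq_q g"
  by (rule cauchy_schwarz_form)
    (rule inner_q_add_right inner_q_scaleC_right inner_q_commute normsq_q_nonneg)+

text \<open>
  The elements f + flip f and f - flip f have nonnegative squared norms, and the flip is a symmetric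
  involution.
\<close>

lemma inner_q_flip_bound: "\<bar>Re (inner_q f (flip f))\<bar> \<le> normsq_q f"
proof -
  have ff: "inner_q (flip f) (flip f) = inner_q f f" by (simp add: flip_symmetric)
  have "normsq_q (f + c *\<^sub>C flip f) = 2 * (normsq_q f + Re c * Re (inner_q f (flip f)))"
    if "c = 1 \<or> c = - 1" for c
    using that ff
    by (auto simp: inner_q_add_left inner_q_add_right inner_q_scaleC_left inner_q_scaleC_right flip_symmetric)
  from this[of 1] this[of "- 1"] show ?thesis
    using normsq_q_nonneg[of "f + 1 *\<^sub>C flip f"] normsq_q_nonneg[of "f + (- 1) *\<^sub>C flip f"] by auto
qed

lemma cinner_J_real: "cinner x (J x) = of_real (Re (cinner x (J x)))"
proof -
  have "cinner x (J x) = cnj (cinner x (J x))"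
    using cinner_commute[of x "J x"] by (simp add: J_adjoint)
  from arg_cong[OF this, of Im] show ?thesis by (simp add: complex_eq_iff)
qed

lemma cinner_J_bound: "\<bar>Re (cinner x (J x))\<bar> \<le> (norm x)\<^sup>2"
  using abs_Re_le_cmod[of "cinner x (J x)"] cinner_cauchy_schwarz[of x "J x"]
  by (simp add: power2_eq_square)

lemma cinner_J_flip_bound:
  "Re (cinner x (J x)) * Re (inner_q f (flip f)) \<le> (norm x)\<^sup>2 * normsq_q f"
proof -
  have "Re (cinner x (J x)) * Re (inner_q f (flip f)) \<le> \<bar>Re (cinner x (J x))\<bar> * \<bar>Re (inner_q f (flip f))\<bar>"
    by (metis abs_ge_self abs_mult)
  also have "\<dots> \<le> (norm x)\<^sup>2 * normsq_q f"
    by (intro mult_mono cinner_J_bound inner_q_flip_bound) simp_all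
  finally show ?thesis .
qed

lemma cinner_J_product_bound:
  "Re (cinner x (J x)) * Re (cinner z (J z)) \<le> (norm x)\<^sup>2 * (norm z)\<^sup>2"
proof -
  have "Re (cinner x (J x)) * Re (cinner z (J z)) \<le> \<bar>Re (cinner x (J x))\<bar> * \<bar>Re (cinner z (J z))\<bar>"
    by (metis abs_ge_self abs_mult)
  also have "\<dots> \<le> (norm x)\<^sup>2 * (norm z)\<^sup>2"
    by (intro mult_mono cinner_J_bound) simp_all
  finally show ?thesis .
qed

text \<open>
  The commutation relation, paired with f.
\<close>

lemma normsq_creation:
  assumes "homogeneous n f" "2 \<le> n"
  shows "normsq_q (creation x f) = (norm x)\<^sup>2 * normsq_q f + q * normsq_q (annihilation x f) +
    q ^ (2 * n) * (Re (cinner x (J x)) * Re (inner_q f (flip f)))"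
proof -
  have "inner_q f (creation x (annihilation x f)) = inner_q (annihilation x f) (annihilation x f)"
    using creation_adjoint[of x "annihilation x f" f] inner_q_commute by metis
  then have "inner_q (creation x f) (creation x f) =
      of_real ((norm x)\<^sup>2) * inner_q f f + of_real q * inner_q (annihilation x f) (annihilation x f) +
      of_real (q ^ (2 * n)) * (of_real (Re (cinner x (J x))) * inner_q f (flip f))"
    unfolding creation_adjoint annihilation_creation[OF assms]
    by (simp only: inner_q_add_right inner_q_scaleC_right cinner_self cinner_J_real[symmetric])
  then show ?thesis by (simp only: plus_complex.sel Re_of_real_mult)
qed

lemma normsq_creation_vacuum: "homogeneous 0 f \<Longrightarrow> normsq_q (creation x f) = (norm x)\<^sup>2 * normsq_q f"
proof -
  assume "homogeneous 0 f"
  then have "annihilation x (creation x f) = cinner x x *\<^sub>C f"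
    by (rule homogeneous_eq[OF _ clinear_comp[OF clinear_annihilation clinear_creation]])
      (auto intro!: clinearI simp: scaleC_add_right scaleC_scaleC mult.commute creation_tensor
        annihilation_tensor annihilate_word_single)
  then show ?thesis by (simp add: creation_adjoint inner_q_scaleC_right cinner_self)
qed

lemma normsq_creation_single:
  "normsq_q (creation x (tensor [z])) = (norm x)\<^sup>2 * (norm z)\<^sup>2 +
    q * ((cmod (cinner x z))\<^sup>2 + (cmod (cinner x (J z)))\<^sup>2) +
    q\<^sup>2 * (Re (cinner x (J x)) * Re (cinner z (J z)))"
proof -
  have sq: "a * cnj a = of_real ((cmod a)\<^sup>2)" for a by (rule complex_norm_square[symmetric])
  have "inner_q (creation x (tensor [z])) (creation x (tensor [z])) =
      cinner x x * cinner z z + of_real q * (cinner x z * cinner z x) +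
      of_real q * (cinner x (J z) * cinner z (J x)) + of_real (q\<^sup>2) * (cinner x (J x) * cinner z (J z))"
    unfolding creation_adjoint
    by (simp add: creation_tensor annihilation_tensor annihilate_word_pair inner_q_add_right
        inner_q_scaleC_right inner_q_single)
  also have "cinner z x = cnj (cinner x z)" by (rule cinner_commute)
  also have "cinner z (J x) = cnj (cinner x (J z))" by (metis J_adjoint cinner_commute)
  also have "cinner x x * cinner z z + of_real q * (cinner x z * cnj (cinner x z)) +
      of_real q * (cinner x (J z) * cnj (cinner x (J z))) + of_real (q\<^sup>2) * (cinner x (J x) * cinner z (J z)) =
    of_real ((norm x)\<^sup>2 * (norm z)\<^sup>2 + q * ((cmod (cinner x z))\<^sup>2 + (cmod (cinner x (J z)))\<^sup>2) +
      q\<^sup>2 * (Re (cinner x (J x)) * Re (cinner z (J z))))"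
    unfolding sq of_real_add of_real_mult cinner_J_real[symmetric] cinner_self by (simp add: distrib_left)
  finally show ?thesis by (simp only: Re_complex_of_real)
qed

lemma normsq_q_single: "normsq_q (tensor [z]) = (norm z)\<^sup>2"
  by (simp add: inner_q_single cinner_self)

text \<open>
  Annihilation of f is adjoint to creation applied to the result, so a bound for the latter carries
  over by the Cauchy-Schwarz inequality.
\<close>

lemma normsq_annihilation_le:
  assumes bound: "normsq_q (creation x (annihilation x f)) \<le> K * normsq_q (annihilation x f)" and "0 \<le> K"
  shows "normsq_q (annihilation x f) \<le> K * normsq_q f"
proof (cases "normsq_q (annihilation x f) = 0")
  case True
  then show ?thesis using \<open>0 \<le> K\<close> normsq_q_nonneg[of f] by simp
next
  case False
  let ?a = "normsq_q (annihilation x f)"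
  have a: "?a > 0" using False normsq_q_nonneg[of "annihilation x f"] by linarith
  have "?a\<^sup>2 = (cmod (inner_q (creation x (annihilation x f)) f))\<^sup>2"
    unfolding creation_adjoint by (subst inner_q_self) simp
  also have "\<dots> \<le> normsq_q (creation x (annihilation x f)) * normsq_q f"
    by (rule inner_q_cauchy_schwarz)
  also have "\<dots> \<le> K * ?a * normsq_q f"
    by (rule mult_right_mono[OF bound normsq_q_nonneg])
  finally show ?thesis using a by (simp add: power2_eq_square mult_ac)
qed

text \<open>
  For q \<le> 0 the annihilation term only lowers the norm, and the sign term has a factor that is at most
  the square of q.
\<close>

lemma creation_bound_neg:
  assumes "homogeneous n f" "q \<le> 0"
  shows "normsq_q (creation x f) \<le> (1 + q\<^sup>2) * (norm x)\<^sup>2 * normsq_q f"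
proof -
  consider "n = 0" | "n = 1" | "2 \<le> n" by linarith
  then show ?thesis
  proof cases
    case 1
    have "0 \<le> q\<^sup>2 * (norm x)\<^sup>2 * normsq_q f" by (simp add: normsq_q_nonneg)
    then show ?thesis using normsq_creation_vacuum assms(1) 1 by (simp add: algebra_simps)
  next
    case 2
    then obtain z where f: "f = tensor [z]" using homogeneous_1 assms(1) by blast
    have "q * ((cmod (cinner x z))\<^sup>2 + (cmod (cinner x (J z)))\<^sup>2) \<le> 0"
      using assms(2) by (simp add: mult_nonpos_nonneg)
    moreover have "q\<^sup>2 * (Re (cinner x (J x)) * Re (cinner z (J z))) \<le> q\<^sup>2 * ((norm x)\<^sup>2 * (norm z)\<^sup>2)"
      by (intro mult_left_mono cinner_J_product_bound) simp
    ultimately show ?thesis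
      unfolding f normsq_creation_single normsq_q_single by (simp add: algebra_simps)
  next
    case 3
    have "q * normsq_q (annihilation x f) \<le> 0"
      using assms(2) by (simp add: mult_nonpos_nonneg normsq_q_nonneg)
    moreover have "q ^ (2 * n) * (Re (cinner x (J x)) * Re (inner_q f (flip f))) \<le> q\<^sup>2 * ((norm x)\<^sup>2 * normsq_q f)"
    proof -
      have "q ^ (2 * n) * (Re (cinner x (J x)) * Re (inner_q f (flip f))) \<le> q ^ (2 * n) * ((norm x)\<^sup>2 * normsq_q f)"
        by (intro mult_left_mono cinner_J_flip_bound) simp
      also have "q ^ (2 * n) \<le> q\<^sup>2"
      proof -
        have "q\<^sup>2 \<le> 1" using q_bounds by (simp add: abs_square_le_1 abs_le_iff)
        then have "(q\<^sup>2) ^ n \<le> (q\<^sup>2) ^ 1" using 3 by (intro power_decreasing) auto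
        then show ?thesis by (simp add: power_mult)
      qed
      then have "q ^ (2 * n) * ((norm x)\<^sup>2 * normsq_q f) \<le> q\<^sup>2 * ((norm x)\<^sup>2 * normsq_q f)"
        by (intro mult_right_mono) (simp_all add: normsq_q_nonneg)
      finally show ?thesis .
    qed
    ultimately show ?thesis
      unfolding normsq_creation[OF assms(1) 3] by (simp add: algebra_simps)
  qed
qed

text \<open>
  Induction on the degree.  With K = 2 / (1 - q), the bound K in degree n - 1 gives 1 + q * K + 1 = K in
  degree n.
\<close>

lemma creation_bound_nonneg:
  assumes "homogeneous n f" "0 \<le> q"
  shows "normsq_q (creation x f) \<le> 2 / (1 - q) * (norm x)\<^sup>2 * normsq_q f"
  using assms(1)
proof (induction n arbitrary: f rule: less_induct)
  case (less n)
  let ?X = "(norm x)\<^sup>2 * normsq_q f"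
  have X: "0 \<le> ?X" by (simp add: normsq_q_nonneg)
  have q1: "0 < 1 - q" using q_bounds by simp
  consider "n = 0" | "n = 1" | "2 \<le> n" by linarith
  then have "normsq_q (creation x f) \<le> 2 / (1 - q) * ?X"
  proof cases
    case 1
    have "1 \<le> 2 / (1 - q)" using q1 assms(2) by (simp add: field_simps)
    from mult_right_mono[OF this X] show ?thesis
      using normsq_creation_vacuum less.prems 1 by simp
  next
    case 2
    then obtain z where f: "f = tensor [z]" using homogeneous_1 less.prems by blast
    have "(cmod (cinner x z))\<^sup>2 \<le> (norm x)\<^sup>2 * (norm z)\<^sup>2" "(cmod (cinner x (J z)))\<^sup>2 \<le> (norm x)\<^sup>2 * (norm z)\<^sup>2"
      using power_mono[OF cinner_cauchy_schwarz[of x z], of 2] power_mono[OF cinner_cauchy_schwarz[of x "J z"], of 2]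
      by (simp_all add: power_mult_distrib)
    then have "q * ((cmod (cinner x z))\<^sup>2 + (cmod (cinner x (J z)))\<^sup>2) \<le> q * (2 * ((norm x)\<^sup>2 * (norm z)\<^sup>2))"
      by (intro mult_left_mono assms(2)) simp
    moreover have "q\<^sup>2 * (Re (cinner x (J x)) * Re (cinner z (J z))) \<le> q\<^sup>2 * ((norm x)\<^sup>2 * (norm z)\<^sup>2)"
      by (intro mult_left_mono cinner_J_product_bound) simp
    ultimately have "normsq_q (creation x f) \<le> (1 + q)\<^sup>2 * ?X"
      unfolding f normsq_creation_single normsq_q_single by (simp add: power2_eq_square algebra_simps)
    also have "(1 + q)\<^sup>2 \<le> 2 / (1 - q)"
    proof -
      have "(1 + q)\<^sup>2 * (1 - q) = (1 + q) * (1 - q\<^sup>2)" by (simp add: power2_eq_square algebra_simps)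
      also have "\<dots> \<le> 2 * 1" using assms(2) q_bounds by (intro mult_mono) (auto simp: abs_square_le_1 abs_le_iff)
      finally show ?thesis using q1 by (simp add: field_simps)
    qed
    from mult_right_mono[OF this X] calculation show ?thesis by linarith
  next
    case 3
    have "normsq_q (creation x (annihilation x f)) \<le> 2 / (1 - q) * (norm x)\<^sup>2 * normsq_q (annihilation x f)"
      by (rule less.IH[of "n - 1"]) (use 3 homogeneous_annihilation[OF less.prems] in auto)
    then have "normsq_q (annihilation x f) \<le> 2 / (1 - q) * (norm x)\<^sup>2 * normsq_q f"
      by (rule normsq_annihilation_le) (use q1 in simp)
    then have "q * normsq_q (annihilation x f) \<le> q * (2 / (1 - q) * ?X)"
      by (intro mult_left_mono assms(2)) (simp add: mult.assoc)
    moreover have "q ^ (2 * n) * (Re (cinner x (J x)) * Re (inner_q f (flip f))) \<le> 1 * ?X"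
    proof -
      have "q ^ (2 * n) * (Re (cinner x (J x)) * Re (inner_q f (flip f))) \<le> q ^ (2 * n) * ?X"
        by (intro mult_left_mono cinner_J_flip_bound) simp
      also have "\<dots> \<le> 1 * ?X"
        using assms(2) q_bounds by (intro mult_right_mono X power_le_one) auto
      finally show ?thesis .
    qed
    ultimately have "normsq_q (creation x f) \<le> ?X + q * (2 / (1 - q) * ?X) + ?X"
      unfolding normsq_creation[OF less.prems 3] by linarith
    also have "\<dots> = 2 / (1 - q) * ?X" using q1 by (simp add: field_simps)
    finally show ?thesis .
  qed
  then show ?case by (simp add: mult.assoc)
qed

text \<open>
  Creation maps different degrees to different degrees, so the squared norms of the components add up on
  both sides.
\<close>

lemma creation_bound:
  assumes "\<And>n f. homogeneous n f \<Longrightarrow> normsq_q (creation x f) \<le> K * normsq_q f"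
  shows "normsq_q (creation x f) \<le> K * normsq_q f"
proof -
  obtain M g where g: "\<And>n. homogeneous n (g n)" "f = (\<Sum>n<M. g n)"
    using homogeneous_decomposition[of f] by blast
  have "normsq_q (creation x f) = (\<Sum>n<M. normsq_q (creation x (g n)))"
    unfolding g(2) clinear_sum[OF clinear_creation]
    by (subst inner_q_sum_homogeneous[of Suc]) (auto intro: homogeneous_creation[OF g(1)])
  also have "\<dots> \<le> (\<Sum>n<M. K * normsq_q (g n))"
    by (intro sum_mono assms[OF g(1)])
  also have "\<dots> = K * normsq_q f"
    unfolding g(2) by (subst inner_q_sum_homogeneous[of "\<lambda>n. n"]) (auto simp: g(1) sum_distrib_left)
  finally show ?thesis .
qed

lemma creation_onorm_le:
  assumes "0 \<le> K" "\<And>n f. homogeneous n f \<Longrightarrow> normsq_q (creation x f) \<le> K * (norm x)\<^sup>2 * normsq_q f"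
  shows "fock_onorm J q (creation x) \<le> ereal (sqrt K * norm x)"
  unfolding fock_onorm_def
proof (rule SUP_least)
  fix f assume "f \<in> {f. fock_norm J q f \<le> 1}"
  then have f: "normsq_q f \<le> 1" by (simp add: fock_norm_def)
  have "normsq_q (creation x f) \<le> K * (norm x)\<^sup>2 * normsq_q f"
    by (rule creation_bound[OF assms(2)])
  also have "\<dots> \<le> K * (norm x)\<^sup>2 * 1"
    using f assms(1) by (intro mult_left_mono) auto
  finally have "sqrt (normsq_q (creation x f)) \<le> sqrt (K * (norm x)\<^sup>2)" by simp
  then show "ereal (fock_norm J q (creation x f)) \<le> ereal (sqrt K * norm x)"
    by (simp add: fock_norm_def real_sqrt_mult)
qed

lemma creation_onorm_ge:
  assumes "0 < normsq_q f"
  shows "ereal (sqrt (normsq_q (creation x f) / normsq_q f)) \<le> fock_onorm J q (creation x)"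
proof -
  let ?a = "complex_of_real (1 / sqrt (normsq_q f))"
  have a: "(cmod ?a)\<^sup>2 = 1 / normsq_q f"
    using assms by (simp add: power_divide norm_divide)
  have "fock_norm J q (?a *\<^sub>C f) \<le> 1"
    unfolding fock_norm_def normsq_q_scaleC a using assms by simp
  then have "ereal (fock_norm J q (creation x (?a *\<^sub>C f))) \<le> fock_onorm J q (creation x)"
    unfolding fock_onorm_def by (intro SUP_upper) simp
  then show ?thesis
    unfolding fock_norm_def clinear_scaleC[OF clinear_creation] normsq_q_scaleC a by simp
qed

subsection \<open>Growth of the norms of tensor powers\<close>

abbreviation tensor_power :: "'h \<Rightarrow> nat \<Rightarrow> 'h fock" where
  "tensor_power x n \<equiv> tensor (replicate n x)"

lemma creation_tensor_power: "creation x (tensor_power x n) = tensor_power x (Suc n)"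
  by (simp add: creation_tensor)

lemma homogeneous_tensor_power: "homogeneous n (tensor_power x n)"
  by (rule homogeneous_tensor) simp

text \<open>
  The geometric sum comes from the representatives without a sign; the others contribute a
  nonnegative multiple of the inner product of x and J x.
\<close>

lemma annihilation_tensor_power:
  assumes "0 \<le> q" "1 \<le> n"
  shows "\<exists>\<beta>\<ge>0. annihilation x (tensor_power x (Suc n)) =
    of_real ((\<Sum>k\<le>n. q ^ k) * (norm x)\<^sup>2) *\<^sub>C tensor_power x n +
    of_real (\<beta> * Re (cinner x (J x))) *\<^sub>C flip (tensor_power x n)"
  using assms(2)
proof (induction n rule: nat_induct_at_least)
  case base
  have "replicate (Suc 1) x = [x, x]" "replicate 1 x = [x]" by simp_all
  then show ?case
    using assms(1) cinner_J_real[of x]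
    by (intro exI[of _ "q + q\<^sup>2"])
      (simp add: annihilation_tensor annihilate_word_pair flip_tensor flip_last_def
        cinner_self scaleC_scaleC scaleC_add_left[symmetric] algebra_simps)
next
  case (Suc n)
  let ?t = "Re (cinner x (J x))"
  let ?s = "(\<Sum>k\<le>n. q ^ k)"
  obtain \<beta> where \<beta>: "0 \<le> \<beta>" and IH: "annihilation x (tensor_power x (Suc n)) =
    of_real (?s * (norm x)\<^sup>2) *\<^sub>C tensor_power x n + of_real (\<beta> * ?t) *\<^sub>C flip (tensor_power x n)"
    using Suc.IH by blast
  have geom: "(\<Sum>k\<le>Suc n. q ^ k) = 1 + q * ?s"
    unfolding sum.atMost_Suc_shift by (simp add: sum_distrib_left)
  have fl: "creation x (flip (tensor_power x n)) = flip (tensor_power x (Suc n))"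
    using flip_creation[OF homogeneous_tensor_power, of n x x] Suc.hyps by (simp add: creation_tensor_power)
  have "creation x (annihilation x (tensor_power x (Suc n))) =
      of_real (?s * (norm x)\<^sup>2) *\<^sub>C tensor_power x (Suc n) + of_real (\<beta> * ?t) *\<^sub>C flip (tensor_power x (Suc n))"
    unfolding IH clinear_add[OF clinear_creation] clinear_scaleC[OF clinear_creation] creation_tensor_power fl ..
  moreover have "annihilation x (tensor_power x (Suc (Suc n))) = cinner x x *\<^sub>C tensor_power x (Suc n) +
      of_real q *\<^sub>C creation x (annihilation x (tensor_power x (Suc n))) +
      of_real (q ^ (2 * Suc n)) *\<^sub>C cinner x (J x) *\<^sub>C flip (tensor_power x (Suc n))"
    unfolding creation_tensor_power[of x "Suc n", symmetric]
    by (rule annihilation_creation[OF homogeneous_tensor_power]) (use Suc.hyps in simp)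
  ultimately have "annihilation x (tensor_power x (Suc (Suc n))) =
      (cinner x x + of_real q * of_real (?s * (norm x)\<^sup>2)) *\<^sub>C tensor_power x (Suc n) +
      (of_real q * of_real (\<beta> * ?t) + of_real (q ^ (2 * Suc n)) * of_real ?t) *\<^sub>C flip (tensor_power x (Suc n))"
    unfolding cinner_J_real[symmetric]
    by (simp only: scaleC_add_right scaleC_add_left scaleC_scaleC add_ac)
  also have "cinner x x + of_real q * of_real (?s * (norm x)\<^sup>2) = of_real ((\<Sum>k\<le>Suc n. q ^ k) * (norm x)\<^sup>2)"
    unfolding geom cinner_self by (simp add: algebra_simps)
  also have "of_real q * of_real (\<beta> * ?t) + of_real (q ^ (2 * Suc n)) * of_real ?t =
      (of_real ((q * \<beta> + q ^ (2 * Suc n)) * ?t) :: complex)"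
    by (simp add: algebra_simps)
  finally show ?case
    using \<beta> assms(1) by (intro exI[of _ "q * \<beta> + q ^ (2 * Suc n)"]) simp
qed

text \<open>
  Let t be the inner product of x and J x, let b(n) be that of the n-th tensor power and its flip, and
  a(n) the squared norm of the power.  Since flip commutes with annihilation and is an involution,
  t b(n+1) is a combination of t b(n) and the product of a(n) and the square of t, with nonnegative
  coefficients.
\<close>

lemma tensor_power_flip_nonneg:
  assumes "0 \<le> q" "1 \<le> n"
  shows "0 \<le> Re (cinner x (J x)) * Re (inner_q (tensor_power x n) (flip (tensor_power x n)))"
  using assms(2)
proof (induction n rule: nat_induct_at_least)
  case base
  show ?case by (simp add: flip_tensor flip_last_def inner_q_single)
next
  case (Suc n)
  let ?t = "Re (cinner x (J x))" and ?p = "tensor_power x n"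
  obtain \<beta> where \<beta>: "0 \<le> \<beta>" and ann: "annihilation x (tensor_power x (Suc n)) =
    of_real ((\<Sum>k\<le>n. q ^ k) * (norm x)\<^sup>2) *\<^sub>C ?p + of_real (\<beta> * ?t) *\<^sub>C flip ?p"
    using annihilation_tensor_power[OF assms(1) Suc.hyps] by blast
  have "inner_q (tensor_power x (Suc n)) (flip (tensor_power x (Suc n)))
      = inner_q ?p (annihilation x (flip (tensor_power x (Suc n))))"
    by (simp only: creation_adjoint flip: creation_tensor_power)
  also have "annihilation x (flip (tensor_power x (Suc n))) = flip (annihilation x (tensor_power x (Suc n)))"
    by (rule flip_annihilation[OF homogeneous_tensor_power, symmetric]) (use Suc.hyps in simp)
  also have "\<dots> = of_real ((\<Sum>k\<le>n. q ^ k) * (norm x)\<^sup>2) *\<^sub>C flip ?p + of_real (\<beta> * ?t) *\<^sub>C ?p"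
    unfolding ann clinear_add[OF clinear_flip] clinear_scaleC[OF clinear_flip] flip_flip ..
  finally have "?t * Re (inner_q (tensor_power x (Suc n)) (flip (tensor_power x (Suc n)))) =
      ((\<Sum>k\<le>n. q ^ k) * (norm x)\<^sup>2) * (?t * Re (inner_q ?p (flip ?p))) + \<beta> * ?t\<^sup>2 * normsq_q ?p"
    by (simp only: inner_q_add_right inner_q_scaleC_right plus_complex.sel Re_of_real_mult power2_eq_square) (simp add: algebra_simps)
  moreover have "0 \<le> (\<Sum>k\<le>n. q ^ k) * (norm x)\<^sup>2" using assms(1) by (simp add: sum_nonneg)
  ultimately show ?case using Suc.IH \<beta> normsq_q_nonneg[of ?p] by simp
qed

text \<open>
  Pairing the annihilated power with the next lower power leaves the geometric sum and a sign term of
  known sign.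
\<close>

lemma normsq_tensor_power_Suc:
  assumes "0 \<le> q" "1 \<le> n"
  shows "(\<Sum>k\<le>n. q ^ k) * (norm x)\<^sup>2 * normsq_q (tensor_power x n) \<le> normsq_q (tensor_power x (Suc n))"
proof -
  let ?t = "Re (cinner x (J x))" and ?p = "tensor_power x n"
  obtain \<beta> where \<beta>: "0 \<le> \<beta>" and ann: "annihilation x (tensor_power x (Suc n)) =
    of_real ((\<Sum>k\<le>n. q ^ k) * (norm x)\<^sup>2) *\<^sub>C ?p + of_real (\<beta> * ?t) *\<^sub>C flip ?p"
    using annihilation_tensor_power[OF assms] by blast
  have "inner_q (tensor_power x (Suc n)) (tensor_power x (Suc n)) = inner_q ?p (annihilation x (tensor_power x (Suc n)))"
    using creation_adjoint[of x ?p "tensor_power x (Suc n)"] by (simp only: creation_tensor_power)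
  then have "normsq_q (tensor_power x (Suc n)) = (\<Sum>k\<le>n. q ^ k) * (norm x)\<^sup>2 * normsq_q ?p +
      \<beta> * (?t * Re (inner_q ?p (flip ?p)))"
    unfolding ann by (simp add: inner_q_add_right inner_q_scaleC_right mult.assoc del: of_real_mult of_real_sum)
  then show ?thesis using tensor_power_flip_nonneg[OF assms] \<beta> by simp
qed

lemma normsq_tensor_power_pos:
  assumes "0 \<le> q" "x \<noteq> 0"
  shows "1 \<le> n \<Longrightarrow> 0 < normsq_q (tensor_power x n)"
proof (induction n rule: nat_induct_at_least)
  case base
  show ?case using assms by (simp add: normsq_q_single)
next
  case (Suc n)
  have "1 \<le> (\<Sum>k\<le>n. q ^ k)"
    unfolding sum.atMost_shift using assms(1) by (simp add: sum_nonneg)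
  then have "0 < (\<Sum>k\<le>n. q ^ k) * (norm x)\<^sup>2 * normsq_q (tensor_power x n)"
    using Suc.IH assms(2) by simp
  then show ?case using normsq_tensor_power_Suc[OF assms(1) Suc.hyps] by (rule less_le_trans)
qed

text \<open>
  The quotients of the squared norms of consecutive tensor powers are bounded below by partial sums of the
  geometric series.
\<close>

theorem creation_onorm_lower: "ereal (norm x / sqrt (1 - q)) \<le> fock_onorm J q (creation x)"
proof -
  consider "x = 0" | "x \<noteq> 0" "q < 0" | "x \<noteq> 0" "0 \<le> q" by linarith
  then show ?thesis
  proof cases
    case 1
    have "ereal (fock_norm J q (creation x 0)) \<le> fock_onorm J q (creation x)"
      unfolding fock_onorm_def by (rule SUP_upper) (simp add: fock_norm_def inner_q_zero_left)
    then show ?thesis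
      using 1 by (simp add: fock_norm_def clinear_zero[OF clinear_creation] inner_q_zero_left zero_ereal_def)
  next
    case 2
    have vac: "normsq_q (tensor []) = 1" by (simp add: inner_q_vacuum)
    have "ereal (sqrt (normsq_q (creation x (tensor [])) / normsq_q (tensor []))) \<le> fock_onorm J q (creation x)"
      by (rule creation_onorm_ge) (simp add: vac)
    then have "ereal (norm x) \<le> fock_onorm J q (creation x)"
      by (simp add: vac creation_tensor normsq_q_single)
    moreover have "norm x / sqrt (1 - q) \<le> norm x / 1"
      using 2 by (intro divide_left_mono) auto
    ultimately show ?thesis by (metis div_by_1 ereal_less_eq(3) order_trans)
  next
    case 3
    have bound: "ereal (sqrt (\<Sum>k\<le>n. q ^ k) * norm x) \<le> fock_onorm J q (creation x)" if n: "1 \<le> n" for n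
    proof -
      let ?p = "tensor_power x n"
      have p: "0 < normsq_q ?p" by (rule normsq_tensor_power_pos[OF 3(2,1) n])
      have "(\<Sum>k\<le>n. q ^ k) * (norm x)\<^sup>2 \<le> normsq_q (creation x ?p) / normsq_q ?p"
        using normsq_tensor_power_Suc[OF 3(2) n, of x] p by (simp add: creation_tensor_power pos_le_divide_eq)
      then have "sqrt ((\<Sum>k\<le>n. q ^ k) * (norm x)\<^sup>2) \<le> sqrt (normsq_q (creation x ?p) / normsq_q ?p)" by simp
      then have "ereal (sqrt (\<Sum>k\<le>n. q ^ k) * norm x) \<le> ereal (sqrt (normsq_q (creation x ?p) / normsq_q ?p))"
        by (simp add: real_sqrt_mult)
      also have "\<dots> \<le> fock_onorm J q (creation x)" by (rule creation_onorm_ge[OF p])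
      finally show ?thesis .
    qed
    have "(\<lambda>n. \<Sum>k\<le>n. q ^ k) \<longlonglongrightarrow> 1 / (1 - q)"
      using geometric_sums[of q] q_bounds by (simp add: sums_def_le abs_less_iff)
    then have "(\<lambda>n. ereal (sqrt (\<Sum>k\<le>n. q ^ k) * norm x)) \<longlonglongrightarrow> ereal (sqrt (1 / (1 - q)) * norm x)"
      by (intro tendsto_intros)
    then have "ereal (sqrt (1 / (1 - q)) * norm x) \<le> fock_onorm J q (creation x)"
      by (rule LIMSEQ_le_const2) (use bound in blast)
    then show ?thesis by (simp add: real_sqrt_divide)
  qed
qed

end

theorem proposition3p8:
  fixes J :: "'h::complex_hilbert_space \<Rightarrow> 'h" and x :: 'h and q :: real
  assumes "selfadjoint_involution J"
  shows "(-1 < q \<and> q < 1 \<longrightarrow>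
            ereal (norm x / sqrt (1 - q)) \<le> fock_onorm J q (creation x)) \<and>
         (0 \<le> q \<and> q < 1 \<longrightarrow>
            fock_onorm J q (creation x) \<le> ereal (sqrt (2 / (1 - q)) * norm x)) \<and>
         (-1 < q \<and> q < 0 \<longrightarrow>
            fock_onorm J q (creation x) \<le> ereal (sqrt (1 + \<bar>q\<bar> + q\<^sup>2) * norm x))"
proof (intro conjI impI; elim conjE)
  assume "- 1 < q" "q < 1"
  then interpret q_fock J q by unfold_locales (use assms in auto)
  show "ereal (norm x / sqrt (1 - q)) \<le> fock_onorm J q (creation x)"
    by (rule creation_onorm_lower)
next
  assume q: "0 \<le> q" "q < 1"
  then interpret q_fock J q by unfold_locales (use assms in auto)
  show "fock_onorm J q (creation x) \<le> ereal (sqrt (2 / (1 - q)) * norm x)"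
    by (rule creation_onorm_le[OF _ creation_bound_nonneg]) (use q in auto)
next
  assume q: "- 1 < q" "q < 0"
  then interpret q_fock J q by unfold_locales (use assms in auto)
  have "fock_onorm J q (creation x) \<le> ereal (sqrt (1 + q\<^sup>2) * norm x)"
    by (rule creation_onorm_le[OF _ creation_bound_neg]) (use q in auto)
  also have "\<dots> \<le> ereal (sqrt (1 + \<bar>q\<bar> + q\<^sup>2) * norm x)"
    by (auto intro!: mult_right_mono)
  finally show "fock_onorm J q (creation x) \<le> ereal (sqrt (1 + \<bar>q\<bar> + q\<^sup>2) * norm x)" .
qed

end
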